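(* Let $N\ge 2$ be an integer, $1<p<N$, $-\infty<\mu<\bar{\mu}=((N-p)/p)^{p}$, $0\le s<p$, $p^{*}(s)=(N-s)p/(N-p)$, $\lambda\in\mathbb{R}$, and let $B$ be an open finite ball in $\mathbb{R}^{N}$ centered at the origin. Let $u\in W_{0}^{1,p}(B)$ be a positive radial (weak) solution to $$\begin{cases}-\Delta_{p}u-\dfrac{\mu}{|x|^{p}}|u|^{p-2}u=\dfrac{|u|^{p^{*}(s)-2}u}{|x|^{s}}+\lambda|u|^{p-2}u & \text{in }B,\\ u=0 & \text{on }\partial B.\end{cases}$$ Then there exists a constant $C>0$ such that $$\lim_{|x|\to 0}u(x)|x|^{\gamma_{1}}=C\qquad\text{and}\qquad \lim_{|x|\to 0}|\nabla u(x)||x|^{\gamma_{1}+1}=|\gamma_{1}|C,$$ where $\gamma_{1}$ is the smaller of the two real roots $\gamma_{1}<\gamma_{2}$ of $\Gamma_{\mu}(\gamma)=(p-1)|\gamma|^{p}-(N-p)|\gamma|^{p-2}\gamma+\mu$.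
   Context: $\Delta_{p}u=\sum_{i=1}^{N}\partial_{x_{i}}(|\nabla u|^{p-2}\partial_{x_{i}}u)$ is the $p$-Laplacian. $W_{0}^{1,p}(B)$ is the completion of $C_{0}^{\infty}(B)$ in the norm $\|\nabla u\|_{L^{p}(B)}$. A (weak) solution is a function $u\in W_{0}^{1,p}(B)$ such that for all $\varphi\in C_{0}^{\infty}(B)$, $$\int_{B}\left(|\nabla u|^{p-2}\nabla u\cdot\nabla\varphi-\frac{\mu}{|x|^{p}}|u|^{p-2}u\varphi-\lambda|u|^{p-2}u\varphi\right)dx=\int_{B}\frac{|u|^{p^{*}(s)-2}u}{|x|^{s}}\varphi\, dx.$$ A radial function in $W_{0}^{1,p}(B)$ is identified with its representative that is continuous on $B\setminus\{0\}$ and written $u(x)=u(r)$, $r=|x|$ (for a positive radial solution this representative is $C^1$ on $B\setminus\{0\}$); "positive" means $u(r)>0$ for every $r>0$ less than the radius of $B$. The function $\Gamma_{\mu}:\mathbb{R}\to\mathbb{R}$ is understood with $|\gamma|^{p-2}\gamma=0$ at $\gamma=0$; under $1<p<N$ and $\mu<\bar\mu$ the equation $\Gamma_{\mu}(\gamma)=0$ has exactly two real solutions $\gamma_{1}<\gamma_{2}$. *)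

theory Defs
  imports "HOL-Analysis.Analysis"
begin

text \<open>Euclidean space of dimension N is rendered as a type \<^typ>\<open>'a::euclidean_space\<close>
  with \<open>N = DIM('a)\<close>.\<close>

definition grad :: "('a::euclidean_space \<Rightarrow> real) \<Rightarrow> 'a \<Rightarrow> 'a" where
  "grad f x = (\<Sum>b\<in>Basis. frechet_derivative f (at x) b *\<^sub>R b)"

primrec C_k :: "nat \<Rightarrow> ('a::euclidean_space \<Rightarrow> real) \<Rightarrow> bool" where
  "C_k 0 f \<longleftrightarrow> continuous_on UNIV f"
| "C_k (Suc k) f \<longleftrightarrow>
     (\<forall>x. f differentiable (at x)) \<and>
     (\<forall>b\<in>Basis. C_k k (\<lambda>x. frechet_derivative f (at x) b))"

text \<open>The class of smooth functions with compact support in the open set \<open>B\<close>; its members are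
  extended by zero to the whole space.\<close>

definition test_function :: "'a::euclidean_space set \<Rightarrow> ('a \<Rightarrow> real) \<Rightarrow> bool" where
  "test_function B \<phi> \<longleftrightarrow>
     (\<forall>k. C_k k \<phi>) \<and> compact (closure {x. \<phi> x \<noteq> 0}) \<and> closure {x. \<phi> x \<noteq> 0} \<subseteq> B"

definition Lp_tendsto ::
  "real \<Rightarrow> 'a::euclidean_space set \<Rightarrow> (nat \<Rightarrow> 'a \<Rightarrow> 'b::euclidean_space) \<Rightarrow> ('a \<Rightarrow> 'b) \<Rightarrow> bool" where
  "Lp_tendsto p B f g \<longleftrightarrow>
     (\<lambda>n. \<integral>\<^sup>+x. ennreal (norm (f n x - g x) powr p) \<partial>(lebesgue_on B)) \<longlonglongrightarrow> 0"

text \<open>\<open>W0_gradient p B u G\<close>: \<open>u\<close> belongs to \<open>W\<^sub>0\<^sup>1\<^sup>,\<^sup>p(B)\<close> with weak gradient \<open>G\<close>.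
  For bounded \<open>B\<close> a sequence of test functions that is Cauchy in the norm of
  \<open>L\<^sup>p\<close> of the gradient is, by the Poincare inequality, also Cauchy in \<open>L\<^sup>p(B)\<close>, so the elements of
  the completion are exactly the functions \<open>u\<close> for which such a \<open>G\<close> exists; \<open>u\<close> determines \<open>G\<close> up
  to null sets.\<close>

definition W0_gradient ::
  "real \<Rightarrow> 'a::euclidean_space set \<Rightarrow> ('a \<Rightarrow> real) \<Rightarrow> ('a \<Rightarrow> 'a) \<Rightarrow> bool" where
  "W0_gradient p B u G \<longleftrightarrow>
     u \<in> borel_measurable (lebesgue_on B) \<and> G \<in> borel_measurable (lebesgue_on B) \<and>
     (\<exists>\<phi>. (\<forall>n. test_function B (\<phi> n)) \<and>
          Lp_tendsto p B \<phi> u \<and> Lp_tendsto p B (\<lambda>n. grad (\<phi> n)) G)"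

definition crit_exp :: "nat \<Rightarrow> real \<Rightarrow> real \<Rightarrow> real" where
  "crit_exp N p s = (real N - s) * p / (real N - p)"

text \<open>The boundary condition is contained in the membership in \<open>W\<^sub>0\<^sup>1\<^sup>,\<^sup>p(B)\<close>. Since
  \<open>0 powr a = 0\<close> for every \<open>a\<close>, the expression \<open>\<bar>t\<bar> powr (p - 2) * t\<close> is \<open>0\<close> at \<open>t = 0\<close> also for
  \<open>p < 2\<close>. In the parameter range of interest all integrands below are integrable by the
  Hardy and Hardy-Sobolev inequalities.\<close>

definition weak_solution ::
  "real \<Rightarrow> real \<Rightarrow> real \<Rightarrow> real \<Rightarrow> 'a::euclidean_space set \<Rightarrow> ('a \<Rightarrow> real) \<Rightarrow> bool" where
  "weak_solution p s \<mu> lam B u \<longleftrightarrow>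
     (\<exists>G. W0_gradient p B u G \<and>
       (\<forall>\<phi>. test_function B \<phi> \<longrightarrow>
         (\<integral>x. norm (G x) powr (p - 2) * (G x \<bullet> grad \<phi> x)
               - \<mu> / norm x powr p * (\<bar>u x\<bar> powr (p - 2) * u x) * \<phi> x
               - lam * (\<bar>u x\<bar> powr (p - 2) * u x) * \<phi> x \<partial>(lebesgue_on B))
         = (\<integral>x. \<bar>u x\<bar> powr (crit_exp DIM('a) p s - 2) * u x / norm x powr s * \<phi> x
               \<partial>(lebesgue_on B))))"

definition radial_on :: "'a::real_normed_vector set \<Rightarrow> ('a \<Rightarrow> real) \<Rightarrow> bool" where
  "radial_on S u \<longleftrightarrow> (\<forall>x\<in>S. \<forall>y\<in>S. norm x = norm y \<longrightarrow> u x = u y)"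

definition Gamma_fun :: "nat \<Rightarrow> real \<Rightarrow> real \<Rightarrow> real \<Rightarrow> real" where
  "Gamma_fun N p \<mu> \<gamma> =
     (p - 1) * \<bar>\<gamma>\<bar> powr p - (real N - p) * (\<bar>\<gamma>\<bar> powr (p - 2) * \<gamma>) + \<mu>"

end

theory Submission imports Defs begin

text \<open>
  Write \<open>r = \<bar>x\<bar>\<close> and \<open>\<delta> = (N - p) / p\<close>. The idea is that for a radial solution the quantity
  \<open>\<gamma>(r) = - r u'(r) / u(r)\<close> nearly satisfies an autonomous first-order equation whose equilibria are
  \<open>\<gamma>\<^sub>1\<close> and \<open>\<gamma>\<^sub>2\<close>, and that finite energy excludes every behaviour except \<open>\<gamma>(r) \<rightarrow> \<gamma>\<^sub>1\<close>.

  \<^emph>\<open>Regularity.\<close> On an annulus the right-hand side of the equation is a continuous function of \<open>r\<close>,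
  because \<open>u\<close> is. The radial Dirichlet problem with that right-hand side and the boundary values of \<open>u\<close>
  has an explicit \<open>C\<^sup>1\<close> solution \<open>V\<close> (\<open>radial_dirichlet_problem\<close>). Testing the difference of the two
  equations with a smooth truncation of \<open>u - V\<close> and using the strict monotonicity of
  \<open>X \<mapsto> \<bar>X\<bar>\<^sup>p\<^sup>-\<^sup>2 X\<close> gives \<open>u = V\<close> (\<open>annulus_one_sided_comparison\<close>). Hence \<open>u\<close> is \<open>C\<^sup>1\<close> away from the origin and
  \<open>r\<^sup>N\<^sup>-\<^sup>1 \<bar>u'\<bar>\<^sup>p\<^sup>-\<^sup>2 u'\<close> is differentiable (\<open>radial_solution_ode\<close>). Only test functions that vanish near the
  origin occur, so no integrability at the origin is at stake.

  \<^emph>\<open>The phase-line equation.\<close> In the variable \<open>t = - ln r\<close> put \<open>X = u\<close>, \<open>W = \<bar>\<gamma>\<bar>\<^sup>p\<^sup>-\<^sup>2 \<gamma>\<close> and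
  \<open>Y = X e\<^sup>-\<^sup>\<delta>\<^sup>t\<close>. Then (\<open>emden_fowler_transform\<close>)
  \<open>W' = - (F(W) + h)\<close> with \<open>h = \<lambda> e\<^sup>-\<^sup>p\<^sup>t + Y\<^sup>\<kappa>\<close>, \<open>\<kappa> = p\<^sup>*(s) - p > 0\<close>, where \<open>F\<close> is \<open>\<Gamma>\<^sub>\<mu>\<close> rewritten in the variable
  \<open>W\<close>. The function \<open>F\<close> is strictly convex with its minimum at the value of \<open>W\<close> that belongs to
  \<open>\<gamma> = \<delta>\<close>, which lies strictly between the two roots \<open>w\<^sub>1 < w\<^sub>2\<close> (\<open>riccati_shape\<close>).

  \<^emph>\<open>Selecting the root.\<close> The term \<open>h\<close> is bounded below by a null function. Therefore \<open>W\<close> cannot be below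
  \<open>w\<^sub>1\<close> by a fixed amount at late times: the superlinear growth of \<open>F\<close> would drive it to \<open>- \<infinity>\<close> in finite time
  (\<open>riccati_eventually_above\<close>). A lower bound for \<open>W\<close> says that \<open>Y\<close> drops at most by a constant factor when
  \<open>r\<close> is halved, so the Hardy inequality, which makes \<open>u\<^sup>p / \<bar>x\<bar>\<^sup>p\<close> integrable for \<open>u \<in> W\<^sub>0\<^sup>1\<^sup>,\<^sup>p\<close>, forces
  \<open>Y \<rightarrow> 0\<close> (\<open>hardy_shell_decay\<close>). Thus \<open>h \<rightarrow> 0\<close>. If \<open>W\<close> were above \<open>w\<^sub>1\<close> at a late time, it would move up
  past the minimum of \<open>F\<close>, that is \<open>\<gamma> > \<delta>\<close>, and \<open>Y\<close> would increase: a contradiction. So \<open>W \<rightarrow> w\<^sub>1\<close>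
  (\<open>riccati_tendsto_small_root\<close>).

  \<^emph>\<open>The exact power.\<close> Since \<open>\<gamma>\<^sub>1 < \<delta>\<close>, now \<open>Y\<close> and with it \<open>h\<close> decay exponentially in \<open>t\<close>. The
  equilibrium \<open>w\<^sub>1\<close> repels, so a solution that converges to it is as close to it as \<open>h\<close> is small
  (\<open>repelling_equilibrium_rate\<close>). Hence \<open>\<gamma> - \<gamma>\<^sub>1\<close>, the derivative of \<open>ln X - \<gamma>\<^sub>1 t\<close>, decays
  exponentially too, and \<open>u r\<^sup>\<gamma>\<^sup>1 = X e\<^sup>-\<^sup>\<gamma>\<^sup>1\<^sup>t\<close> has a positive limit (\<open>riccati_solution_asymptotics\<close>). The
  statement on the gradient follows from \<open>\<bar>\<nabla>u\<bar> r / u = \<bar>\<gamma>\<bar>\<close>.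
\<close>

section \<open>Smooth functions and cutoffs\<close>

lemma C_k_SucI:
  assumes "\<And>x. (f has_derivative f' x) (at x)"
    and "\<And>b. b \<in> Basis \<Longrightarrow> C_k k (\<lambda>x. f' x b)"
  shows "C_k (Suc k) f"
proof -
  have "frechet_derivative f (at x) = f' x" for x
    using frechet_derivative_at[OF assms(1)] by simp
  moreover have "f differentiable (at x)" for x
    using assms(1) differentiable_def by blast
  ultimately show ?thesis using assms(2) by simp
qed

lemma C_k_SucD:
  assumes "C_k (Suc k) f"
  shows "(f has_derivative frechet_derivative f (at x)) (at x)"
    and "b \<in> Basis \<Longrightarrow> C_k k (\<lambda>x. frechet_derivative f (at x) b)"
  using assms by (simp_all add: frechet_derivative_works[symmetric])

lemma C_k_Suc_imp: "C_k (Suc k) f \<Longrightarrow> C_k k f"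
proof (induction k arbitrary: f)
  case 0
  then show ?case
    by (auto intro!: differentiable_imp_continuous_within simp: continuous_on_eq_continuous_within)
next
  case (Suc k)
  then show ?case by (metis C_k.simps(2))
qed

lemma C_k_const: "C_k k (\<lambda>x. c)"
proof (induction k arbitrary: c)
  case (Suc k)
  show ?case by (rule C_k_SucI[where f' = "\<lambda>x h. 0"]) (auto simp: Suc)
qed auto

lemma C_k_add: "C_k k f \<Longrightarrow> C_k k g \<Longrightarrow> C_k k (\<lambda>x. f x + g x)"
proof (induction k arbitrary: f g)
  case (Suc k)
  note f = C_k_SucD[OF Suc.prems(1)] and g = C_k_SucD[OF Suc.prems(2)]
  show ?case
    by (rule C_k_SucI[OF has_derivative_add[OF f(1) g(1)]]) (intro Suc.IH f(2) g(2))
qed (auto intro: continuous_intros)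

lemma C_k_mult: "C_k k f \<Longrightarrow> C_k k g \<Longrightarrow> C_k k (\<lambda>x. f x * g x)"
proof (induction k arbitrary: f g)
  case (Suc k)
  note f = C_k_SucD[OF Suc.prems(1)] and g = C_k_SucD[OF Suc.prems(2)]
  note low = C_k_Suc_imp[OF Suc.prems(1)] C_k_Suc_imp[OF Suc.prems(2)]
  show ?case
    by (rule C_k_SucI[OF has_derivative_mult[OF f(1) g(1)]]) (intro C_k_add Suc.IH f(2) g(2) low)
qed (auto intro: continuous_intros)

lemma C_k_inner: "C_k k (\<lambda>x. x \<bullet> c)"
proof (cases k)
  case (Suc m)
  show ?thesis unfolding Suc
    by (rule C_k_SucI[where f' = "\<lambda>x h. h \<bullet> c"]) (auto intro!: derivative_eq_intros C_k_const)
qed (auto intro: continuous_intros)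

lemma C_k_inner_self: "C_k k (\<lambda>x. x \<bullet> x)"
proof (cases k)
  case (Suc m)
  show ?thesis unfolding Suc
  proof (rule C_k_SucI[where f' = "\<lambda>x h. 2 * (x \<bullet> h)"])
    show "((\<lambda>x. x \<bullet> x) has_derivative (\<lambda>h. 2 * (x \<bullet> h))) (at x)" for x :: 'a
      by (auto intro!: derivative_eq_intros simp: inner_commute)
  qed (intro C_k_mult C_k_const C_k_inner)
qed (auto intro: continuous_intros)

lemma C_k_compose:
  fixes f :: "'a::euclidean_space \<Rightarrow> real" and g :: "real \<Rightarrow> real"
  shows "C_k k g \<Longrightarrow> C_k k f \<Longrightarrow> C_k k (\<lambda>x. g (f x))"
proof (induction k arbitrary: f g)
  case 0
  then show ?case by (auto intro: continuous_on_compose2[where t = UNIV])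
next
  case (Suc k)
  note f = C_k_SucD[OF Suc.prems(2)] and g = C_k_SucD[OF Suc.prems(1)]
  have lin: "frechet_derivative g (at y) h = h * frechet_derivative g (at y) 1" for y h
    using linear_scale[OF has_derivative_linear[OF g(1)[of y]], of h 1] by simp
  show ?case
  proof (rule C_k_SucI)
    show "((\<lambda>x. g (f x)) has_derivative
        (\<lambda>h. frechet_derivative f (at x) h * frechet_derivative g (at (f x)) 1)) (at x)" for x
      using has_derivative_compose[OF f(1) g(1)] by (subst (asm) lin)
    show "C_k k (\<lambda>x. frechet_derivative f (at x) b * frechet_derivative g (at (f x)) 1)"
      if "b \<in> Basis" for b
      using Suc.IH[OF g(2)[of 1] C_k_Suc_imp[OF Suc.prems(2)]] that
      by (intro C_k_mult f(2)) auto
  qed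
qed

lemma C_k_real_SucI:
  fixes f :: "real \<Rightarrow> real"
  assumes "\<And>x. (f has_real_derivative f' x) (at x)" and "C_k k f'"
  shows "C_k (Suc k) f"
  by (rule C_k_SucI[OF assms(1)[unfolded has_field_derivative_def]]) (simp add: assms)

text \<open>The derivative of a member of the family is a combination of two members, so one induction shows that
  all of them are smooth.\<close>

definition flat_exp :: "nat \<Rightarrow> real \<Rightarrow> real" where
  "flat_exp m t = (if t \<le> 0 then 0 else exp (- (1 / t)) / t ^ m)"

lemma flat_exp_tendsto_0: "(flat_exp m \<longlongrightarrow> 0) (at 0)"
proof -
  have "((\<lambda>y::real. y ^ m / exp y) \<longlongrightarrow> 0) at_top" by (rule tendsto_power_div_exp_0)
  from filterlim_compose[OF this filterlim_inverse_at_top_right]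
  have "((\<lambda>t::real. inverse t ^ m / exp (inverse t)) \<longlongrightarrow> 0) (at_right 0)" .
  moreover have "\<forall>\<^sub>F t in at_right (0::real). inverse t ^ m / exp (inverse t) = flat_exp m t"
    by (rule eventually_at_rightI[of 0 1])
      (auto simp: flat_exp_def exp_minus field_simps)
  ultimately have "(flat_exp m \<longlongrightarrow> 0) (at_right 0)" by (rule Lim_transform_eventually)
  moreover have "(flat_exp m \<longlongrightarrow> 0) (at_left 0)"
    by (rule tendsto_eventually, rule eventually_at_leftI[of "-1" 0]) (auto simp: flat_exp_def)
  ultimately show ?thesis by (simp add: filterlim_at_split)
qed

lemma flat_exp_deriv:
  "(flat_exp m has_real_derivative flat_exp (m + 2) t - real m * flat_exp (Suc m) t) (at t)"
proof -
  consider "t < 0" | "t = 0" | "t > 0" by linarith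
  then show ?thesis
  proof cases
    case 1
    have "((\<lambda>_. 0) has_real_derivative 0) (at t)" by simp
    then have "(flat_exp m has_real_derivative 0) (at t)"
      by (rule has_field_derivative_transform_within_open[where S = "{..<0}"])
        (use 1 in \<open>auto simp: flat_exp_def\<close>)
    then show ?thesis using 1 by (simp add: flat_exp_def)
  next
    case 2
    \<comment> \<open>The difference quotient at the origin is the next member of the family.\<close>
    have "((\<lambda>h. (flat_exp m (0 + h) - flat_exp m 0) / h) \<longlongrightarrow> 0) (at 0)"
      using flat_exp_tendsto_0[of "Suc m"]
      by (rule Lim_transform_eventually) (auto simp: flat_exp_def eventually_at_filter)
    then show ?thesis using 2 by (simp add: DERIV_def flat_exp_def)
  next
    case 3
    have "((\<lambda>t. exp (- (1 / t)) / t ^ m) has_real_derivative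
        (exp (- (1 / t)) * (1 / t ^ 2) * t ^ m - exp (- (1 / t)) * (real m * t ^ (m - 1))) / (t ^ m * t ^ m)) (at t)"
      using 3 by (auto intro!: derivative_eq_intros simp: power2_eq_square)
    also have "(exp (- (1 / t)) * (1 / t ^ 2) * t ^ m - exp (- (1 / t)) * (real m * t ^ (m - 1))) / (t ^ m * t ^ m)
        = flat_exp (m + 2) t - real m * flat_exp (Suc m) t"
    proof (cases m)
      case (Suc n)
      then show ?thesis using 3 by (simp add: flat_exp_def field_simps power_add power2_eq_square)
    qed (use 3 in \<open>simp add: flat_exp_def power2_eq_square\<close>)
    finally have "((\<lambda>t. exp (- (1 / t)) / t ^ m) has_real_derivative
        flat_exp (m + 2) t - real m * flat_exp (Suc m) t) (at t)" .
    then show ?thesis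
      by (rule has_field_derivative_transform_within_open[where S = "{0<..}"])
        (use 3 in \<open>auto simp: flat_exp_def\<close>)
  qed
qed

lemma flat_exp_cont: "isCont (flat_exp m) t"
  using DERIV_isCont flat_exp_deriv by blast

lemma C_k_flat_exp: "C_k k (flat_exp m)"
proof (induction k arbitrary: m)
  case 0
  show ?case by (auto intro: continuous_at_imp_continuous_on flat_exp_cont)
next
  case (Suc k)
  have "C_k k (\<lambda>t. flat_exp (m + 2) t + (- real m) * flat_exp (Suc m) t)"
    by (intro C_k_add C_k_mult C_k_const Suc)
  then show ?case by (intro C_k_real_SucI[OF flat_exp_deriv]) simp
qed

lemma flat_exp_nonneg: "0 \<le> flat_exp m t" by (simp add: flat_exp_def)
lemma flat_exp_pos: "0 < t \<Longrightarrow> 0 < flat_exp m t" by (simp add: flat_exp_def)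
lemma flat_exp_eq_0: "t \<le> 0 \<Longrightarrow> flat_exp m t = 0" by (simp add: flat_exp_def)

lemma flat_exp_le: "flat_exp m t \<le> fact m"
proof (cases "t \<le> 0")
  case False
  define y where "y = 1 / t"
  have y: "y > 0" using False by (simp add: y_def)
  have "y ^ m / fact m \<le> exp y"
  proof -
    have s: "(\<lambda>n. y ^ n / fact n) sums exp y" 
      using exp_converges[of y] by (simp add: field_simps scaleR_conv_of_real)
    show ?thesis
      using sum_le_suminf[OF sums_summable[OF s], of "{m}"] y s sums_unique[OF s] by auto
  qed
  then have "exp (- y) * y ^ m \<le> fact m"
    by (simp add: exp_minus field_simps)
  then show ?thesis using False by (simp add: flat_exp_def y_def power_one_over field_simps)
qed (simp add: flat_exp_def)

text \<open>A primitive of a smooth bump supported on \<open>[\<alpha>, \<beta>]\<close>, divided by its total mass.\<close>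

lemma smooth_step:
  fixes \<alpha> \<beta> :: real
  assumes "\<alpha> < \<beta>"
  shows "\<exists>S. (\<forall>k. C_k k S) \<and> (\<forall>t. 0 \<le> S t \<and> S t \<le> 1) \<and> (\<forall>t\<le>\<alpha>. S t = 0) \<and> (\<forall>t\<ge>\<beta>. S t = 1)"
proof -
  define b where "b t = flat_exp 0 (t - \<alpha>) * flat_exp 0 (\<beta> - t)" for t
  have Ck: "C_k k (\<lambda>t. t - \<alpha>)" "C_k k (\<lambda>t. \<beta> - t)" for k
    using C_k_add[OF C_k_inner[of k "1::real"] C_k_const[of k "-\<alpha>"]]
      C_k_add[OF C_k_const[of k "\<beta>"] C_k_inner[of k "-1::real"]] by simp_all
  have b_smooth: "C_k k b" for k
    unfolding b_def[abs_def] by (intro C_k_mult C_k_compose[OF C_k_flat_exp] Ck)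
  have b_cont: "continuous_on S b" for S
    using b_smooth[of 0] continuous_on_subset by auto
  have b_nonneg: "b t \<ge> 0" for t by (simp add: b_def flat_exp_nonneg)
  have b_zero: "b t = 0" if "t \<le> \<alpha> \<or> \<beta> \<le> t" for t
    using that by (auto simp: b_def flat_exp_eq_0)
  have b_pos: "b t > 0" if "\<alpha> < t" "t < \<beta>" for t
    using that by (auto simp: b_def flat_exp_pos)
  define I where "I t = integral {\<alpha>..t} b" for t
  have I0: "I t = 0" if "t \<le> \<alpha>" for t
    using that by (cases "t = \<alpha>") (auto simp: I_def)
  have int: "b integrable_on {x..y}" for x y by (rule integrable_continuous_interval[OF b_cont])
  have Id: "(I has_real_derivative b t) (at t)" for t
  proof (cases "t < \<alpha>")
    case True
    have "((\<lambda>_. 0) has_real_derivative 0) (at t)" by simp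
    then have "(I has_real_derivative 0) (at t)"
      by (rule has_field_derivative_transform_within_open[where S = "{..<\<alpha>}"])
        (use True in \<open>auto simp: I0\<close>)
    then show ?thesis using True by (simp add: b_zero)
  next
    case False
    define c where "c = \<alpha> - 1"
    \<comment> \<open>The integral from \<open>\<alpha>\<close> is one-sided at \<open>t = \<alpha>\<close>; starting further left gives the two-sided derivative.\<close>
    have eq: "I x = integral {c..x} b" if "x > c" for x
    proof (cases "x \<le> \<alpha>")
      case True
      have "integral {c..x} b = integral {c..x} (\<lambda>_. 0)"
        by (rule integral_cong) (use True in \<open>auto simp: b_zero\<close>)
      then show ?thesis using I0[OF True] by simp
    next
      case False
      have "integral {c..\<alpha>} b = integral {c..\<alpha>} (\<lambda>_. 0)"
        by (rule integral_cong) (auto simp: b_zero)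
      moreover have "integral {c..\<alpha>} b + integral {\<alpha>..x} b = integral {c..x} b"
        by (rule Henstock_Kurzweil_Integration.integral_combine) (use False int in \<open>auto simp: c_def\<close>)
      ultimately show ?thesis by (simp add: I_def)
    qed
    have "((\<lambda>x. integral {c..x} b) has_real_derivative b t) (at t within {c..t+1})"
      by (rule integral_has_real_derivative[OF b_cont]) (use False in \<open>auto simp: c_def\<close>)
    then have "((\<lambda>x. integral {c..x} b) has_real_derivative b t) (at t)"
      by (subst (asm) at_within_interior) (use False in \<open>auto simp: c_def\<close>)
    then show ?thesis
      by (rule has_field_derivative_transform_within_open[where S = "{c<..}"])
        (use False eq in \<open>auto simp: c_def\<close>)
  qed
  have mono: "I x \<le> I y" if "x \<le> y" for x y
    by (rule DERIV_nonneg_imp_nondecreasing[OF that]) (use Id b_nonneg in blast)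
  have "I \<alpha> < I \<beta>"
  proof (rule DERIV_pos_imp_increasing_open[OF assms])
    show "\<And>x. \<alpha> < x \<Longrightarrow> x < \<beta> \<Longrightarrow> \<exists>y. DERIV I x :> y \<and> 0 < y" using Id b_pos by blast
    show "continuous_on {\<alpha>..\<beta>} I" using Id DERIV_isCont continuous_at_imp_continuous_on by blast
  qed
  then have Ib: "I \<beta> > 0" by (simp add: I0)
  have Iconst: "I t = I \<beta>" if "\<beta> \<le> t" for t
  proof (rule antisym)
    show "I t \<le> I \<beta>"
      by (rule DERIV_nonpos_imp_nonincreasing[OF that]) (use Id b_zero in fastforce)
  qed (rule mono[OF that])
  define S where "S t = (1 / I \<beta>) * I t" for t
  have Sm: "C_k k S" for k
  proof -
    have "C_k (Suc k) I" by (rule C_k_real_SucI[OF Id b_smooth])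
    from C_k_mult[OF C_k_const C_k_Suc_imp[OF this]] show ?thesis unfolding S_def[abs_def] .
  qed
  have "0 \<le> S t \<and> S t \<le> 1" for t
  proof -
    have "0 \<le> I t" using mono[of \<alpha> t] I0[of t] I0[of \<alpha>] by (cases "t \<le> \<alpha>") auto
    moreover have "I t \<le> I \<beta>" by (cases "t \<le> \<beta>") (use mono[of t \<beta>] Iconst[of t] in linarith)+
    ultimately show ?thesis using Ib by (auto simp: S_def)
  qed
  moreover have "S t = 0" if "t \<le> \<alpha>" for t using I0[OF that] by (simp add: S_def)
  moreover have "S t = 1" if "\<beta> \<le> t" for t
    unfolding S_def Iconst[OF that] using Ib by simp
  ultimately show ?thesis using Sm by (intro exI[of _ S]) blast
qed

lemma smooth_cutoff:
  fixes \<alpha> \<alpha>' \<beta>' \<beta> :: real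
  assumes "\<alpha> < \<alpha>'" "\<beta>' < \<beta>"
  shows "\<exists>\<eta>. (\<forall>k. C_k k \<eta>) \<and> (\<forall>t. 0 \<le> \<eta> t \<and> \<eta> t \<le> 1) \<and> (\<forall>t\<in>{\<alpha>'..\<beta>'}. \<eta> t = 1) \<and>
    (\<forall>t. t \<le> \<alpha> \<or> \<beta> \<le> t \<longrightarrow> \<eta> t = 0)"
proof -
  obtain S where S: "\<And>k. C_k k S" "\<And>t. 0 \<le> S t" "\<And>t. S t \<le> 1" "\<And>t. t \<le> \<alpha> \<Longrightarrow> S t = 0"
      "\<And>t. t \<ge> \<alpha>' \<Longrightarrow> S t = 1"
    using smooth_step[OF assms(1)] by blast
  obtain S' where S': "\<And>k. C_k k S'" "\<And>t. 0 \<le> S' t" "\<And>t. S' t \<le> 1" "\<And>t. t \<le> \<beta>' \<Longrightarrow> S' t = 0"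
      "\<And>t. t \<ge> \<beta> \<Longrightarrow> S' t = 1"
    using smooth_step[OF assms(2)] by blast
  define \<eta> where "\<eta> t = S t * (1 + (-1) * S' t)" for t
  have "C_k k \<eta>" for k
    unfolding \<eta>_def[abs_def] by (intro C_k_mult C_k_add C_k_const S(1) S'(1))
  moreover have "0 \<le> \<eta> t \<and> \<eta> t \<le> 1" for t
    using S(2,3)[of t] S'(2,3)[of t] by (auto simp: \<eta>_def intro!: mult_le_one)
  ultimately show ?thesis
    by (intro exI[of _ \<eta>]) (auto simp: \<eta>_def S(4,5) S'(4,5))
qed

section \<open>Gradients, scaling and the Euler identity\<close>

lemma grad_eqI:
  assumes "(f has_derivative (\<lambda>h. g \<bullet> h)) (at x)"
  shows "grad f x = g"
proof -
  have "frechet_derivative f (at x) = (\<lambda>h. g \<bullet> h)"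
    by (rule frechet_derivative_at[OF assms, symmetric])
  then show ?thesis by (simp add: grad_def euclidean_representation)
qed

lemma has_derivative_grad:
  assumes "f differentiable (at x)"
  shows "(f has_derivative (\<lambda>h. grad f x \<bullet> h)) (at x)"
proof -
  have d: "(f has_derivative frechet_derivative f (at x)) (at x)"
    using assms by (simp add: frechet_derivative_works)
  then interpret linear "frechet_derivative f (at x)" by (rule has_derivative_linear)
  have "frechet_derivative f (at x) h = grad f x \<bullet> h" for h
  proof -
    have "frechet_derivative f (at x) h = frechet_derivative f (at x) (\<Sum>b\<in>Basis. (h \<bullet> b) *\<^sub>R b)"
      by (simp add: euclidean_representation)
    also have "\<dots> = (\<Sum>b\<in>Basis. (h \<bullet> b) * frechet_derivative f (at x) b)"
      by (simp add: sum scale)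
    also have "\<dots> = grad f x \<bullet> h"
      unfolding grad_def inner_sum_left by (rule sum.cong) (simp_all add: inner_commute)
    finally show ?thesis .
  qed
  then have "frechet_derivative f (at x) = (\<lambda>h. grad f x \<bullet> h)" by blast
  from d[unfolded this] show ?thesis .
qed

lemma smooth_grad:
  fixes f :: "'a::euclidean_space \<Rightarrow> real"
  assumes "\<And>k. C_k k f"
  shows "(f has_derivative (\<lambda>h. grad f x \<bullet> h)) (at x)" and "continuous_on S (grad f)"
    and "continuous_on S f"
proof -
  show "(f has_derivative (\<lambda>h. grad f x \<bullet> h)) (at x)"
    by (rule has_derivative_grad) (use assms[of 1] in simp)
  have "\<And>b. b \<in> Basis \<Longrightarrow> continuous_on S (\<lambda>x. frechet_derivative f (at x) b)"
    using C_k_SucD(2)[OF assms[of "Suc 0"]] continuous_on_subset[OF _ subset_UNIV] by fastforce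
  then show "continuous_on S (grad f)"
    unfolding grad_def[abs_def] by (intro continuous_intros) auto
  show "continuous_on S f" using assms[of 0] continuous_on_subset[OF _ subset_UNIV] by fastforce
qed

lemma has_derivative_locally_0:
  fixes f :: "'a::euclidean_space \<Rightarrow> real"
  assumes "open S" "x \<in> S" "\<And>y. y \<in> S \<Longrightarrow> f y = 0"
  shows "(f has_derivative (\<lambda>h. 0 \<bullet> h)) (at x)"
proof -
  have "((\<lambda>_. 0) has_derivative (\<lambda>h::'a. 0 \<bullet> h)) (at x)" by simp
  then show ?thesis
    by (rule has_derivative_transform_within_open[OF _ assms(1,2)]) (simp add: assms(3))
qed

lemma grad_eq_0_outside:
  fixes f :: "'a::euclidean_space \<Rightarrow> real"
  assumes "x \<notin> closure {x. f x \<noteq> 0}"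
  shows "f x = 0" "grad f x = 0"
proof -
  have z: "f y = 0" if "y \<in> - closure {x. f x \<noteq> 0}" for y
    using that closure_subset[of "{x. f x \<noteq> 0}"] by blast
  have o: "open (- closure {x. f x \<noteq> 0})" by (simp add: open_Compl)
  have x: "x \<in> - closure {x. f x \<noteq> 0}" using assms by blast
  show "grad f x = 0" by (rule grad_eqI[OF has_derivative_locally_0[OF o x z]])
  show "f x = 0" by (rule z[OF x])
qed

lemma lborel_integral_scaleR:
  fixes g :: "'a::euclidean_space \<Rightarrow> real"
  assumes [measurable]: "g \<in> borel_measurable borel" and "c > 0"
  shows "(\<integral>x. c ^ DIM('a) * g (c *\<^sub>R x) \<partial>lborel) = (\<integral>x. g x \<partial>lborel)"
proof -
  have "(\<integral>x. g x \<partial>lborel) = (\<integral>x. g x \<partial>density (distr lborel borel (\<lambda>x. 0 + c *\<^sub>R x)) (\<lambda>_. ennreal (\<bar>c\<bar>^DIM('a))))"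
    by (subst lborel_affine[of c 0]) (use assms in \<open>auto simp: ennreal_power\<close>)
  also have "\<dots> = (\<integral>x. c ^ DIM('a) * g (c *\<^sub>R x) \<partial>lborel)"
    using \<open>c > 0\<close> by (subst integral_density) (auto simp: integral_distr)
  finally show ?thesis by simp
qed

text \<open>The integral of \<open>s\<^sup>N g(s x)\<close> over \<open>x\<close> does not depend on \<open>s\<close>; the identity is its derivative at \<open>s = 1\<close>.
  It is the only form of the divergence theorem used below, with a field \<open>g(x) x\<close> each time.\<close>

lemma euler_identity:
  fixes g :: "'a::euclidean_space \<Rightarrow> real"
  assumes der: "\<And>x. (g has_derivative (\<lambda>h. Dg x \<bullet> h)) (at x)"
    and cont: "continuous_on UNIV Dg" and K: "compact K" and zero: "\<And>x. x \<notin> K \<Longrightarrow> g x = 0"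
  shows "integrable lborel (\<lambda>x. real DIM('a) * g x + Dg x \<bullet> x)"
    and "(\<integral>x. real DIM('a) * g x + Dg x \<bullet> x \<partial>lborel) = 0"
proof -
  let ?N = "DIM('a)"
  have gc: "continuous_on UNIV g"
    using der by (auto intro!: has_derivative_continuous simp: continuous_on_eq_continuous_within)
  have [measurable]: "g \<in> borel_measurable borel" "Dg \<in> borel_measurable borel"
    using gc cont by (auto intro: borel_measurable_continuous_onI)
  obtain \<rho> where \<rho>: "\<rho> > 0" "K \<subseteq> cball 0 \<rho>"
    using compact_imp_bounded[OF K] unfolding bounded_pos by (metis mem_cball_0 subsetI)
  have zg: "g x = 0" if "norm x > \<rho>" for x using that \<rho>(2) zero by fastforce
  have zDg: "Dg x = 0" if "norm x > \<rho>" for x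
  proof -
    have "(g has_derivative (\<lambda>h. 0 \<bullet> h)) (at x)"
      by (rule has_derivative_locally_0[where S = "- cball 0 \<rho>"]) (use that zg in auto)
    then have "grad g x = 0" by (rule grad_eqI)
    then show ?thesis using grad_eqI[OF der] by simp
  qed
  have "bounded (g ` cball 0 \<rho>)"
    by (intro compact_imp_bounded compact_continuous_image continuous_on_subset[OF gc]) auto
  then obtain M1 where M1: "\<And>x. x \<in> cball 0 \<rho> \<Longrightarrow> \<bar>g x\<bar> \<le> M1"
    unfolding bounded_iff by (metis imageI real_norm_def)
  have "bounded (Dg ` cball 0 \<rho>)"
    by (intro compact_imp_bounded compact_continuous_image continuous_on_subset[OF cont]) auto
  then obtain M2 where M2: "\<And>x. x \<in> cball 0 \<rho> \<Longrightarrow> norm (Dg x) \<le> M2"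
    unfolding bounded_iff by (metis imageI)
  have M0: "M1 \<ge> 0" "M2 \<ge> 0" using M1[of 0] M2[of 0] \<rho>(1) by (auto intro: order_trans[OF norm_ge_zero])
  have M1': "\<bar>g x\<bar> \<le> M1" for x using M1[of x] zg[of x] M0 by (cases "norm x \<le> \<rho>") auto
  have M2': "\<bar>Dg (s *\<^sub>R x) \<bullet> x\<bar> \<le> M2 * \<rho>" if "s \<ge> 1" for x s
  proof (cases "norm (s *\<^sub>R x) \<le> \<rho>")
    case True
    have "norm x \<le> norm (s *\<^sub>R x)"
      using mult_right_mono[OF that norm_ge_zero[of x]] that by simp
    then show ?thesis
      using Cauchy_Schwarz_ineq2[of "Dg (s *\<^sub>R x)" x] M2[of "s *\<^sub>R x"] True M0
      by (smt (verit) mem_cball_0 mult_mono norm_ge_zero)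
  next
    case False
    then show ?thesis using zDg[of "s *\<^sub>R x"] M0 \<rho>(1) by simp
  qed
  \<comment> \<open>Difference quotients of \<open>s \<mapsto> s\<^sup>N g(s x)\<close> at \<open>s = 1\<close>, along steps \<open>1 / (n + 1)\<close>.
     Their integrals vanish, and they are bounded by a multiple of the indicator of a ball.\<close>
  define D where "D n x = ((1 + 1 / real (Suc n)) ^ ?N * g ((1 + 1 / real (Suc n)) *\<^sub>R x) - g x) / (1 / real (Suc n))"
    for n x
  define C where "C = real ?N * 2 ^ (?N - 1) * M1 + 2 ^ ?N * (M2 * \<rho>)"
  define L where "L x s = real ?N * s ^ (?N - 1) * g (s *\<^sub>R x) + s ^ ?N * (Dg (s *\<^sub>R x) \<bullet> x)" for x s
  have dL: "((\<lambda>s. s ^ ?N * g (s *\<^sub>R x)) has_real_derivative L x s) (at s)" for x s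
  proof -
    have "((\<lambda>s. g (s *\<^sub>R x)) has_derivative (\<lambda>h. Dg (s *\<^sub>R x) \<bullet> (h *\<^sub>R x))) (at s)"
      by (rule has_derivative_compose[OF _ der]) (auto intro!: derivative_eq_intros)
    then have "((\<lambda>s. g (s *\<^sub>R x)) has_real_derivative Dg (s *\<^sub>R x) \<bullet> x) (at s)"
      by (rule has_derivative_imp_has_field_derivative) (simp add: mult.commute)
    then show ?thesis
      by (auto intro!: derivative_eq_intros simp: L_def mult.commute)
  qed
  have ind: "integrable lborel (\<lambda>x::'a. c * indicat_real (cball 0 \<rho>) x)" for c
    by (intro integrable_mult_right integrable_real_indicator emeasure_bounded_finite) auto
  have int_g: "integrable lborel g"
  proof (rule Bochner_Integration.integrable_bound)
    show "integrable lborel (\<lambda>x::'a. M1 * indicat_real (cball 0 \<rho>) x)"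
      by (rule ind)
    show "AE x in lborel. norm (g x) \<le> norm (M1 * indicat_real (cball 0 \<rho>) x)"
      using M1 zg M0 by (auto simp: indicator_def abs_mult)
  qed simp
  have Dbound: "\<bar>D n x\<bar> \<le> C * indicat_real (cball 0 \<rho>) x" for n x
  proof (cases "norm x \<le> \<rho>")
    case True
    let ?t = "1 + 1 / real (Suc n)"
    have "\<exists>z. 1 < z \<and> z < ?t \<and> ?t ^ ?N * g (?t *\<^sub>R x) - 1 ^ ?N * g (1 *\<^sub>R x) = (?t - 1) * L x z"
      by (rule MVT2) (auto intro: dL)
    then obtain z where z: "1 < z" "z < ?t" "?t ^ ?N * g (?t *\<^sub>R x) - g x = (?t - 1) * L x z"
      by auto
    have z2: "z < 2" using z(2) by (smt (verit) divide_le_eq_1 of_nat_Suc of_nat_0_le_iff)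
    have "D n x = L x z" using z(3) by (simp add: D_def)
    moreover have "\<bar>L x z\<bar> \<le> C"
    proof -
      have "\<bar>L x z\<bar> \<le> real ?N * z ^ (?N - 1) * \<bar>g (z *\<^sub>R x)\<bar> + z ^ ?N * \<bar>Dg (z *\<^sub>R x) \<bullet> x\<bar>"
        using z(1) abs_triangle_ineq[of "real ?N * z ^ (?N - 1) * g (z *\<^sub>R x)" "z ^ ?N * (Dg (z *\<^sub>R x) \<bullet> x)"]
        by (simp add: L_def abs_mult)
      also have "\<dots> \<le> C"
        unfolding C_def using z(1) z2 M1' M2'[of z x] M0 \<rho>(1)
        by (intro add_mono mult_mono mult_left_mono power_mono) (auto intro!: mult_nonneg_nonneg)
      finally show ?thesis .
    qed
    ultimately show ?thesis using True by simp
  next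
    case False
    have "norm x \<le> norm ((1 + 1 / real (Suc n)) *\<^sub>R x)"
      using mult_right_mono[of 1 "1 + 1 / real (Suc n)" "norm x"] by (simp del: of_nat_Suc)
    then have "norm ((1 + 1 / real (Suc n)) *\<^sub>R x) > \<rho>" using False by linarith
    then have "D n x = 0" using False unfolding D_def by (simp only: zg) (simp add: zg)
    then show ?thesis using False by simp
  qed
  have Dint: "(\<integral>x. D n x \<partial>lborel) = 0" for n
  proof -
    let ?t = "1 + 1 / real (Suc n)"
    have t: "?t > 0" by (smt (verit) divide_nonneg_nonneg of_nat_0_le_iff)
    have "integrable lborel (D n)"
    proof (rule Bochner_Integration.integrable_bound)
      show "integrable lborel (\<lambda>x::'a. C * indicat_real (cball 0 \<rho>) x)"
        by (rule ind)
      show "AE x in lborel. norm (D n x) \<le> norm (C * indicat_real (cball 0 \<rho>) x)"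
        using Dbound by (auto intro: order_trans[OF _ abs_ge_self])
    qed (simp add: D_def[abs_def])
    then have i1: "integrable lborel (\<lambda>x. 1 / real (Suc n) * D n x + g x)"
      using int_g by auto
    have "(\<lambda>x. 1 / real (Suc n) * D n x + g x) = (\<lambda>x. ?t ^ ?N * g (?t *\<^sub>R x))"
      by (simp add: D_def[abs_def])
    then have "(\<integral>x. 1 / real (Suc n) * D n x + g x \<partial>lborel) = (\<integral>x. g x \<partial>lborel)"
      using lborel_integral_scaleR[OF _ t, of g] by simp
    moreover have "(\<integral>x. 1 / real (Suc n) * D n x + g x \<partial>lborel)
        = 1 / real (Suc n) * (\<integral>x. D n x \<partial>lborel) + (\<integral>x. g x \<partial>lborel)"
      using \<open>integrable lborel (D n)\<close> int_g by (subst Bochner_Integration.integral_add) auto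
    ultimately show ?thesis by simp
  qed
  have Dlim: "(\<lambda>n. D n x) \<longlonglongrightarrow> real ?N * g x + Dg x \<bullet> x" for x
  proof -
    have "((\<lambda>h. ((1 + h) ^ ?N * g ((1 + h) *\<^sub>R x) - 1 ^ ?N * g (1 *\<^sub>R x)) / h) \<longlongrightarrow> L x 1) (at 0)"
      using dL[of x 1] by (simp add: DERIV_def)
    moreover have "filterlim (\<lambda>n. 1 / real (Suc n)) (at 0) sequentially"
      using LIMSEQ_inverse_real_of_nat by (auto simp: filterlim_at inverse_eq_divide)
    ultimately have "(\<lambda>n. ((1 + 1 / real (Suc n)) ^ ?N * g ((1 + 1 / real (Suc n)) *\<^sub>R x) - 1 ^ ?N * g (1 *\<^sub>R x)) / (1 / real (Suc n))) \<longlonglongrightarrow> L x 1"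
      by (rule filterlim_compose)
    then show ?thesis by (simp add: D_def L_def)
  qed
  have m: "(\<lambda>x. real ?N * g x + Dg x \<bullet> x) \<in> borel_measurable lborel" by simp
  have mD: "D n \<in> borel_measurable lborel" for n by (simp add: D_def[abs_def])
  have w: "integrable lborel (\<lambda>x::'a. C * indicat_real (cball 0 \<rho>) x)"
    by (rule ind)
  have l: "AE x in lborel. (\<lambda>n. D n x) \<longlonglongrightarrow> real ?N * g x + Dg x \<bullet> x" using Dlim by simp
  have b: "AE x in lborel. norm (D n x) \<le> C * indicat_real (cball 0 \<rho>) x" for n
    using Dbound by simp
  show "integrable lborel (\<lambda>x. real DIM('a) * g x + Dg x \<bullet> x)"
    by (rule integrable_dominated_convergence[OF m mD w l b])
  have "(\<lambda>n. \<integral>x. D n x \<partial>lborel) \<longlonglongrightarrow> (\<integral>x. real DIM('a) * g x + Dg x \<bullet> x \<partial>lborel)"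
    by (rule integral_dominated_convergence[OF m mD w l b])
  then show "(\<integral>x. real DIM('a) * g x + Dg x \<bullet> x \<partial>lborel) = 0"
    unfolding Dint by (simp add: LIMSEQ_const_iff)
qed

text \<open>The variant for a function that is differentiable only on a neighbourhood \<open>\<Omega>\<close> of its support, such as
  a product of a test function with a function that is singular at the origin.\<close>

lemma euler_identity_on:
  fixes g :: "'a::euclidean_space \<Rightarrow> real"
  assumes \<Omega>: "open \<Omega>" "\<Omega> \<subseteq> B" "B \<in> sets lebesgue" and K: "compact K" "K \<subseteq> \<Omega>"
    and der: "\<And>x. x \<in> \<Omega> \<Longrightarrow> (g has_derivative (\<lambda>h. Dg x \<bullet> h)) (at x)"
    and cont: "continuous_on \<Omega> Dg"
    and zero: "\<And>x. x \<notin> K \<Longrightarrow> g x = 0" "\<And>x. x \<notin> \<Omega> \<Longrightarrow> Dg x = 0"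
  shows "integrable (lebesgue_on B) (\<lambda>x. real DIM('a) * g x + Dg x \<bullet> x)"
    and "(\<integral>x. real DIM('a) * g x + Dg x \<bullet> x \<partial>lebesgue_on B) = 0"
proof -
  have opK: "open (- K)" using K(1) by (simp add: compact_imp_closed open_Compl)
  have d0: "(g has_derivative (\<lambda>h. 0 \<bullet> h)) (at x)" if "x \<notin> K" for x
    by (rule has_derivative_locally_0[OF opK]) (use that zero in auto)
  have z: "Dg x = 0" if "x \<notin> K" for x
    using grad_eqI[OF d0[OF that]] grad_eqI[OF der[of x]] zero(2)[of x] by force
  have der': "(g has_derivative (\<lambda>h. Dg x \<bullet> h)) (at x)" for x
    using der[of x] d0[of x] z[of x] K(2) by (cases "x \<in> K") auto
  have "continuous_on (- K) Dg"
    by (rule continuous_on_eq[where f = "\<lambda>_. 0"]) (auto simp: z)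
  then have "continuous_on (\<Omega> \<union> - K) Dg"
    using cont \<Omega>(1) opK by (intro continuous_on_open_Un)
  moreover have "\<Omega> \<union> - K = UNIV" using K(2) by auto
  ultimately have c: "continuous_on UNIV Dg" by simp
  note e = euler_identity[OF der' c K(1) zero(1)]
  let ?F = "\<lambda>x. real DIM('a) * g x + Dg x \<bullet> x"
  have F0: "?F x = 0" if "x \<notin> B" for x using that \<Omega>(2) zero[of x] K(2) by (metis add_0 inner_zero_left mult_zero_right subsetD)
  have ind: "indicat_real B x *\<^sub>R ?F x = ?F x" for x
    using F0[of x] by (cases "x \<in> B") auto
  have m: "?F \<in> borel_measurable lborel" using e(1) by (rule borel_measurable_integrable)
  have I: "integrable lebesgue ?F" using e(1) by (simp add: integrable_completion[OF m])
  show "integrable (lebesgue_on B) ?F"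
    using \<Omega>(3) I by (subst integrable_restrict_space) (auto simp: ind[unfolded real_scaleR_def])
  show "(\<integral>x. ?F x \<partial>lebesgue_on B) = 0"
    using \<Omega>(3) e(2) by (subst integral_restrict_space)
      (auto simp: ind[unfolded real_scaleR_def] integral_completion[OF m])
qed

section \<open>Dominated approximation by test functions\<close>

lemma powr_add_le:
  fixes a b p :: real
  assumes "0 \<le> a" "0 \<le> b" "0 \<le> p"
  shows "(a + b) powr p \<le> 2 powr p * (a powr p + b powr p)"
proof -
  have "(a + b) powr p \<le> (2 * max a b) powr p"
    by (rule powr_mono2) (use assms in auto)
  also have "\<dots> = 2 powr p * (max a b) powr p"
    using assms by (simp add: powr_mult)
  also have "\<dots> \<le> 2 powr p * (a powr p + b powr p)"
    by (intro mult_left_mono) (auto simp: max_def)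
  finally show ?thesis .
qed

lemma test_functionD:
  assumes "test_function B \<phi>"
  shows "C_k k \<phi>" "compact (closure {x. \<phi> x \<noteq> 0})" "closure {x. \<phi> x \<noteq> 0} \<subseteq> B"
    "(\<phi> has_derivative (\<lambda>h. grad \<phi> x \<bullet> h)) (at x)" "continuous_on S (grad \<phi>)" "continuous_on S \<phi>"
  using assms smooth_grad unfolding test_function_def by blast+

lemma test_function_bounded:
  assumes "test_function B \<phi>"
  obtains M where "\<And>x. norm (grad \<phi> x) \<le> M" "\<And>x. \<bar>\<phi> x\<bar> \<le> M" "M \<ge> 0"
proof -
  let ?K = "closure {x. \<phi> x \<noteq> 0}"
  have "bounded (grad \<phi> ` ?K)" "bounded (\<phi> ` ?K)"
    by (intro compact_imp_bounded compact_continuous_image test_functionD[OF assms])+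
  then obtain M1 M2 where M: "\<forall>x\<in>?K. norm (grad \<phi> x) \<le> M1" "\<forall>x\<in>?K. norm (\<phi> x) \<le> M2"
    unfolding bounded_iff by (metis imageI)
  have "norm (grad \<phi> x) \<le> max 0 (max M1 M2)" "\<bar>\<phi> x\<bar> \<le> max 0 (max M1 M2)" for x
    using M grad_eq_0_outside[of x \<phi>] by (cases "x \<in> ?K"; force simp: max_def)+
  then show ?thesis by (intro that[of "max 0 (max M1 M2)"]) auto
qed

text \<open>Choose approximants whose errors in the \<open>p\<close>-th power are summable. The sum of all the errors is then
  integrable, which turns \<open>L\<^sup>p\<close>-convergence into convergence almost everywhere under one majorant \<open>H\<close>;
  afterwards every limit can be taken by dominated convergence. The bound \<open>1 \<le> H\<close> lets \<open>H\<^sup>p\<close> absorb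
  constants and lower powers of \<open>H\<close>.\<close>

lemma W0_dominated_sequence:
  fixes u :: "'a::euclidean_space \<Rightarrow> real"
  assumes W: "W0_gradient p B u G" and p: "1 \<le> p" and B: "bounded B" "open B"
  obtains \<phi> H where "\<And>n. test_function B (\<phi> n)"
    "H \<in> borel_measurable (lebesgue_on B)" "\<And>x. 1 \<le> H x"
    "integrable (lebesgue_on B) (\<lambda>x. H x powr p)"
    "AE x in lebesgue_on B. (\<lambda>n. \<phi> n x) \<longlonglongrightarrow> u x \<and> (\<lambda>n. grad (\<phi> n) x) \<longlonglongrightarrow> G x \<and>
       norm (G x) \<le> H x \<and> (\<forall>n. norm (grad (\<phi> n) x) \<le> H x)"
proof -
  let ?M = "lebesgue_on B"
  have Bs: "B \<in> sets lebesgue" using B(2) by auto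
  have fin: "emeasure ?M (space ?M) < \<infinity>"
    using emeasure_bounded_finite[OF B(1)] Bs B(2)
    by (simp add: emeasure_restrict_space main_part_sets)
  have um[measurable]: "u \<in> borel_measurable ?M" "G \<in> borel_measurable ?M"
    using W by (auto simp: W0_gradient_def)
  obtain \<psi> where \<psi>: "\<And>n. test_function B (\<psi> n)" "Lp_tendsto p B \<psi> u" "Lp_tendsto p B (\<lambda>n. grad (\<psi> n)) G"
    using W by (auto simp: W0_gradient_def)
  have \<psi>m[measurable]: "\<psi> n \<in> borel_measurable ?M" "grad (\<psi> n) \<in> borel_measurable ?M" for n
    by (intro continuous_imp_measurable_on_sets_lebesgue[OF _ Bs] test_functionD[OF \<psi>(1)])+
  define a where "a n = (\<integral>\<^sup>+x. ennreal (norm (\<psi> n x - u x) powr p) \<partial>?M)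
      + (\<integral>\<^sup>+x. ennreal (norm (grad (\<psi> n) x - G x) powr p) \<partial>?M)" for n
  have "a \<longlonglongrightarrow> 0 + 0"
    unfolding a_def[abs_def] using \<psi>(2,3) by (intro tendsto_add) (auto simp: Lp_tendsto_def)
  then have a0: "a \<longlonglongrightarrow> 0" by simp
  have "\<exists>n. a n < ennreal ((1/2) ^ k)" for k
  proof -
    have "\<forall>\<^sub>F n in sequentially. a n < ennreal ((1/2) ^ k)"
      using order_tendstoD(2)[OF a0] by simp
    then show ?thesis by (auto simp: eventually_sequentially)
  qed
  then obtain r where r: "\<And>k. a (r k) < ennreal ((1/2) ^ k)" by metis
  define \<phi> where "\<phi> k = \<psi> (r k)" for k
  have \<phi>t: "test_function B (\<phi> k)" for k by (simp add: \<phi>_def \<psi>)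
  have [measurable]: "\<phi> n \<in> borel_measurable ?M" "grad (\<phi> n) \<in> borel_measurable ?M" for n
    by (simp_all add: \<phi>_def)
  \<comment> \<open>The series of these errors is integrable, hence finite almost everywhere.\<close>
  define d where "d k x = norm (\<phi> k x - u x) powr p + norm (grad (\<phi> k) x - G x) powr p" for k x
  have dm[measurable]: "d k \<in> borel_measurable ?M" for k unfolding d_def[abs_def] by measurable
  have d0: "0 \<le> d k x" for k x by (simp add: d_def)
  have "(\<integral>\<^sup>+x. (\<Sum>k. ennreal (d k x)) \<partial>?M) = (\<Sum>k. \<integral>\<^sup>+x. ennreal (d k x) \<partial>?M)"
    by (rule nn_integral_suminf) simp
  also have "\<dots> = (\<Sum>k. a (r k))"
    by (simp add: d_def a_def \<phi>_def nn_integral_add) 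
  also have "\<dots> \<le> (\<Sum>k. ennreal ((1/2) ^ k))"
    by (intro suminf_le less_imp_le r) auto
  also have "\<dots> = ennreal 2"
    using geometric_sums[of "1/2::real"] by (intro suminf_ennreal_eq) auto
  finally have Sfin: "(\<integral>\<^sup>+x. (\<Sum>k. ennreal (d k x)) \<partial>?M) \<le> ennreal 2" .
  have AEsum: "AE x in ?M. summable (\<lambda>k. d k x)"
  proof -
    have "AE x in ?M. (\<Sum>k. ennreal (d k x)) \<noteq> \<infinity>"
      by (rule nn_integral_noteq_infinite) (use Sfin in \<open>auto simp: top_unique\<close>)
    then show ?thesis by eventually_elim (rule summable_suminf_not_top, auto simp: d0)
  qed
  define S where "S x = \<bar>\<Sum>k. d k x\<bar>" for x
  have Sm[measurable]: "S \<in> borel_measurable ?M" unfolding S_def[abs_def] by measurable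
  have Sint: "integrable ?M S"
  proof (rule integrableI_nonneg)
    have "(\<integral>\<^sup>+x. ennreal (S x) \<partial>?M) = (\<integral>\<^sup>+x. (\<Sum>k. ennreal (d k x)) \<partial>?M)"
      by (rule nn_integral_cong_AE, use AEsum in eventually_elim)
        (simp add: S_def suminf_ennreal2 d0 suminf_nonneg)
    also have "\<dots> \<le> ennreal 2" by (rule Sfin)
    finally show "(\<integral>\<^sup>+x. ennreal (S x) \<partial>?M) < \<infinity>" by (auto simp: le_less_trans)
  qed (auto simp: S_def)
  obtain M where M: "\<And>x. norm (grad (\<phi> 0) x) \<le> M" "M \<ge> 0"
    using test_function_bounded[OF \<phi>t] by metis
  define H where "H x = 2 * S x powr (1 / p) + (M + 1)" for x
  have Hm[measurable]: "H \<in> borel_measurable ?M" unfolding H_def[abs_def] by measurable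
  have H1: "1 \<le> H x" for x using M(2) by (simp add: H_def)
  have Hint: "integrable ?M (\<lambda>x. H x powr p)"
  proof (rule Bochner_Integration.integrable_bound)
    show "integrable ?M (\<lambda>x. 2 powr p * (2 powr p * S x + (M + 1) powr p))"
      using Sint fin by (intro integrable_mult_right Bochner_Integration.integrable_add) 
        (auto intro!: finite_measure.integrable_const finite_measureI)
    have "H x powr p \<le> 2 powr p * (2 powr p * S x + (M + 1) powr p)" for x
    proof -
      have "H x powr p \<le> 2 powr p * ((2 * S x powr (1 / p)) powr p + (M + 1) powr p)"
        unfolding H_def using p M(2) by (intro powr_add_le) auto
      also have "(2 * S x powr (1 / p)) powr p = 2 powr p * S x"
        using p by (simp add: powr_mult powr_powr S_def)
      finally show ?thesis .
    qed
    then show "AE x in ?M. norm (H x powr p) \<le> norm (2 powr p * (2 powr p * S x + (M + 1) powr p))"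
      by (auto simp: S_def intro: order_trans[OF _ abs_ge_self])
  qed measurable
  have AEmain: "AE x in ?M. (\<lambda>n. \<phi> n x) \<longlonglongrightarrow> u x \<and> (\<lambda>n. grad (\<phi> n) x) \<longlonglongrightarrow> G x \<and>
       norm (G x) \<le> H x \<and> (\<forall>n. norm (grad (\<phi> n) x) \<le> H x)"
    using AEsum
  proof eventually_elim
    case (elim x)
    have Sx: "S x = (\<Sum>k. d k x)" using elim by (simp add: S_def suminf_nonneg d0)
    have dS: "d k x \<le> S x" for k
      using sum_le_suminf[OF elim, of "{k}"] d0 by (simp add: Sx)
    have d_lim: "(\<lambda>k. d k x powr (1 / p)) \<longlonglongrightarrow> 0"
      using tendsto_powr'[OF summable_LIMSEQ_zero[OF elim] tendsto_const[of "1/p"]] p d0 by (simp add: always_eventually)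
    have root: "y \<le> z powr (1 / p)" if "y powr p \<le> z" "0 \<le> y" for y z
    proof -
      have "(y powr p) powr (1 / p) \<le> z powr (1 / p)"
        using that p by (intro powr_mono2) auto
      then show ?thesis using that p by (simp add: powr_powr)
    qed
    have b: "norm (\<phi> k x - u x) \<le> d k x powr (1 / p)" "norm (grad (\<phi> k) x - G x) \<le> d k x powr (1 / p)" for k
      by (rule root; simp add: d_def)+
    have l1: "(\<lambda>n. \<phi> n x) \<longlonglongrightarrow> u x"
      by (rule Lim_null_comparison[OF _ d_lim, THEN LIM_zero_cancel]) (use b in auto)
    have l2: "(\<lambda>n. grad (\<phi> n) x) \<longlonglongrightarrow> G x"
      by (rule Lim_null_comparison[OF _ d_lim, THEN LIM_zero_cancel]) (use b in auto)
    have bS: "norm (grad (\<phi> k) x - G x) \<le> S x powr (1 / p)" for k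
      using b(2)[of k] powr_mono2[OF _ d0 dS[of k], of "1 / p"] p by simp
    have GS: "norm (G x) \<le> S x powr (1 / p) + M"
      using norm_triangle_ineq4[of "grad (\<phi> 0) x" "grad (\<phi> 0) x - G x"] bS[of 0] M(1)[of x] by simp
    have "norm (grad (\<phi> k) x) \<le> H x" for k
      using norm_triangle_ineq[of "grad (\<phi> k) x - G x" "G x"] bS[of k] GS by (simp add: H_def)
    moreover have "norm (G x) \<le> H x" using GS powr_ge_zero[of "S x" "1 / p"] unfolding H_def by linarith
    ultimately show ?case using l1 l2 by simp
  qed
  show ?thesis by (rule that[OF \<phi>t Hm H1 Hint AEmain])
qed

section \<open>Comparison on an annulus\<close>

definition pvec :: "real \<Rightarrow> 'a::real_inner \<Rightarrow> 'a" where
  "pvec p X = norm X powr (p - 2) *\<^sub>R X"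

lemma powr_minus_2_mult: "0 \<le> (A::real) \<Longrightarrow> A powr (p - 2) * A = A powr (p - 1)"
  using powr_mult_base[of A "p - 2"] by (simp add: mult.commute)

lemma norm_pvec: "norm (pvec p X) = norm X powr (p - 1)"
  by (simp add: pvec_def powr_minus_2_mult)

lemma pvec_measurable [measurable]:
  "pvec p \<in> borel_measurable (borel :: 'a::euclidean_space measure)"
  unfolding pvec_def[abs_def] by measurable

text \<open>Splitting off the Cauchy--Schwarz defect \<open>\<bar>a\<bar> \<bar>b\<bar> - a \<bullet> b\<close> leaves the scalar monotonicity of
  \<open>t \<mapsto> t\<^sup>p\<^sup>-\<^sup>1\<close>; both parts are nonnegative, and they vanish together only for \<open>a = b\<close>.\<close>

lemma pvec_strict_mono:
  fixes a b :: "'a::real_inner"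
  assumes p: "1 < p"
  shows "0 \<le> (pvec p a - pvec p b) \<bullet> (a - b)"
    and "(pvec p a - pvec p b) \<bullet> (a - b) = 0 \<Longrightarrow> a = b"
proof -
  define A B where "A = norm a" and "B = norm b"
  have AB: "A \<ge> 0" "B \<ge> 0" by (simp_all add: A_def B_def)
  have aa: "a \<bullet> a = A * A" "b \<bullet> b = B * B"
    by (simp_all add: A_def B_def dot_square_norm power2_eq_square)
  have eq: "(pvec p a - pvec p b) \<bullet> (a - b)
      = (A powr (p - 1) - B powr (p - 1)) * (A - B) + (A powr (p - 2) + B powr (p - 2)) * (A * B - a \<bullet> b)"
    using powr_minus_2_mult[OF AB(1), of p] powr_minus_2_mult[OF AB(2), of p]
    by (simp add: pvec_def A_def[symmetric] B_def[symmetric] inner_diff_left inner_diff_right aa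
        inner_commute[of b a] algebra_simps flip: powr_minus_2_mult)
  have t1: "0 \<le> (A powr (p - 1) - B powr (p - 1)) * (A - B)"
    and t1': "(A powr (p - 1) - B powr (p - 1)) * (A - B) = 0 \<Longrightarrow> A = B"
  proof -
    consider "A < B" | "A = B" | "A > B" by linarith
    then have "0 \<le> (A powr (p - 1) - B powr (p - 1)) * (A - B) \<and>
       ((A powr (p - 1) - B powr (p - 1)) * (A - B) = 0 \<longrightarrow> A = B)"
    proof cases
      case 1
      then have "A powr (p - 1) < B powr (p - 1)" using AB p by (intro powr_less_mono2) auto
      with 1 show ?thesis by (auto intro: mult_nonpos_nonpos)
    next
      case 3
      then have "B powr (p - 1) < A powr (p - 1)" using AB p by (intro powr_less_mono2) auto
      with 3 show ?thesis by auto
    qed auto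
    then show "0 \<le> (A powr (p - 1) - B powr (p - 1)) * (A - B)"
      "(A powr (p - 1) - B powr (p - 1)) * (A - B) = 0 \<Longrightarrow> A = B" by auto
  qed
  have cs: "0 \<le> A * B - a \<bullet> b" using norm_cauchy_schwarz[of a b] by (simp add: A_def B_def)
  have t2: "0 \<le> (A powr (p - 2) + B powr (p - 2)) * (A * B - a \<bullet> b)"
    using cs by simp
  show "0 \<le> (pvec p a - pvec p b) \<bullet> (a - b)" using eq t1 t2 by simp
  assume "(pvec p a - pvec p b) \<bullet> (a - b) = 0"
  then have z: "(A powr (p - 1) - B powr (p - 1)) * (A - B) = 0"
      "(A powr (p - 2) + B powr (p - 2)) * (A * B - a \<bullet> b) = 0"
    using eq t1 t2 by linarith+
  have "A = B" using t1' z(1) by blast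
  show "a = b"
  proof (cases "A = 0")
    case True
    then show ?thesis using \<open>A = B\<close> by (simp add: A_def B_def)
  next
    case False
    then have "a \<bullet> b = A * B" using z(2) \<open>A = B\<close> by simp
    then have "(a - b) \<bullet> (a - b) = 0"
      using aa \<open>A = B\<close> by (simp add: inner_diff_left inner_diff_right inner_commute[of b a])
    then show ?thesis by simp
  qed
qed

lemma C_k_ident: "C_k k (\<lambda>t::real. t)"
  using C_k_inner[of k "1::real"] by simp

lemma C_k_power: "C_k k (\<lambda>t::real. t ^ n)"
  by (induction n) (simp_all add: C_k_const C_k_mult C_k_ident)

lemma C_k_sum: "finite I \<Longrightarrow> (\<And>i. i \<in> I \<Longrightarrow> C_k k (f i)) \<Longrightarrow> C_k k (\<lambda>x. \<Sum>i\<in>I. f i x)"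
  by (induction I rule: finite_induct) (simp_all add: C_k_const C_k_add)

lemma smooth_real_deriv:
  fixes f :: "real \<Rightarrow> real"
  assumes "\<And>k. C_k k f"
  shows "(f has_real_derivative grad f t) (at t)"
  using smooth_grad(1)[OF assms, of t] by (simp add: has_field_derivative_def)

text \<open>A radial function becomes a smooth function on the whole space when it is written as \<open>Q(\<bar>x\<bar>\<^sup>2)\<close> with a
  polynomial \<open>Q\<close>. This makes differences of a test function and a radial \<open>C\<^sup>1\<close> function approximable by
  smooth functions without any mollification.\<close>

lemma smooth_C1_approximation:
  fixes V V' :: "real \<Rightarrow> real"
  assumes ab: "0 < a" "a < b"
    and der: "\<And>r. r \<in> {a..b} \<Longrightarrow> (V has_real_derivative V' r) (at r within {a..b})"
    and cont: "continuous_on {a..b} V'"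
  obtains Q Q' M where "\<And>n k. C_k k (Q n)"
    "\<And>n t. (Q n has_real_derivative Q' n t) (at t)"
    "\<And>r. r \<in> {a..b} \<Longrightarrow> (\<lambda>n. Q n (r\<^sup>2)) \<longlonglongrightarrow> V r"
    "\<And>r. r \<in> {a..b} \<Longrightarrow> (\<lambda>n. Q' n (r\<^sup>2)) \<longlonglongrightarrow> V' r / (2 * r)"
    "\<And>n r. r \<in> {a..b} \<Longrightarrow> \<bar>Q' n (r\<^sup>2)\<bar> \<le> M" "0 \<le> M"
proof -
  \<comment> \<open>With \<open>Q' = m\<close> the derivative \<open>2 r Q'(r\<^sup>2)\<close> of \<open>Q(r\<^sup>2)\<close> would be \<open>V'(r)\<close>,
     so \<open>Q'\<close> is chosen close to \<open>m\<close> and then integrated.\<close>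
  define m where "m \<sigma> = V' (sqrt \<sigma>) / (2 * sqrt \<sigma>)" for \<sigma>
  have sq: "sqrt \<sigma> \<in> {a..b}" if "\<sigma> \<in> {a\<^sup>2..b\<^sup>2}" for \<sigma>
    using that ab by (auto intro: real_le_rsqrt real_le_lsqrt)
  have sq': "r\<^sup>2 \<in> {a\<^sup>2..b\<^sup>2}" if "r \<in> {a..b}" for r
    using that ab by (auto intro: power_mono)
  have mc: "continuous_on {a\<^sup>2..b\<^sup>2} m"
    unfolding m_def
    by (intro continuous_on_divide continuous_on_compose2[OF cont] continuous_intros)
      (use sq ab in \<open>force+\<close>)
  have "\<exists>P. real_polynomial_function P \<and> (\<forall>\<sigma>\<in>{a\<^sup>2..b\<^sup>2}. \<bar>m \<sigma> - P \<sigma>\<bar> < 1 / real (Suc n))" for n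
    using Stone_Weierstrass_real_polynomial_function[OF compact_Icc mc, of "1 / real (Suc n)"]
    by (metis of_nat_0_less_iff zero_less_Suc zero_less_divide_1_iff)
  then have "\<exists>c d. \<forall>\<sigma>\<in>{a\<^sup>2..b\<^sup>2}. \<bar>m \<sigma> - (\<Sum>i\<le>d. c i * \<sigma> ^ i)\<bar> < 1 / real (Suc n)" for n
    unfolding real_polynomial_function_iff_sum by fastforce
  then obtain c d where cd:
    "\<And>n \<sigma>. \<sigma> \<in> {a\<^sup>2..b\<^sup>2} \<Longrightarrow> \<bar>m \<sigma> - (\<Sum>i\<le>d n. c n i * \<sigma> ^ i)\<bar> < 1 / real (Suc n)" by metis
  define Q' where "Q' n t = (\<Sum>i\<le>d n. c n i * t ^ i)" for n t
  define Q0 where "Q0 n t = (\<Sum>i\<le>d n. c n i / real (Suc i) * t ^ Suc i)" for n t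
  define Q where "Q n t = Q0 n t + (V a - Q0 n (a\<^sup>2))" for n t
  have Qs: "C_k k (Q n)" for k n
    unfolding Q_def[abs_def] Q0_def
    by (intro C_k_add C_k_sum C_k_mult C_k_const C_k_power) auto
  have Qd: "(Q n has_real_derivative Q' n t) (at t)" for n t
  proof -
    have "((\<lambda>t. c n i / real (Suc i) * t ^ Suc i) has_real_derivative c n i * t ^ i) (at t)" for i
      by (auto intro!: derivative_eq_intros simp del: of_nat_Suc power_Suc) 
    then have "(Q0 n has_real_derivative Q' n t) (at t)"
      unfolding Q0_def[abs_def] Q'_def by (intro DERIV_sum)
    then show ?thesis unfolding Q_def[abs_def] by (auto intro!: derivative_eq_intros)
  qed
  have mr: "m (r\<^sup>2) = V' r / (2 * r)" if "r \<in> {a..b}" for r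
    using that ab by (simp add: m_def)
  have close: "\<bar>V' r / (2 * r) - Q' n (r\<^sup>2)\<bar> < 1 / real (Suc n)" if "r \<in> {a..b}" for r n
    using cd[OF sq'[OF that], of n] by (simp add: mr[OF that] Q'_def)
  have inv0: "(\<lambda>n. 1 / real (Suc n)) \<longlonglongrightarrow> 0"
    using LIMSEQ_inverse_real_of_nat by (simp add: inverse_eq_divide)
  have lim': "(\<lambda>n. Q' n (r\<^sup>2)) \<longlonglongrightarrow> V' r / (2 * r)" if r: "r \<in> {a..b}" for r
  proof (rule LIM_zero_cancel, rule Lim_null_comparison[OF _ inv0])
    show "\<forall>\<^sub>F n in sequentially. norm (Q' n (r\<^sup>2) - V' r / (2 * r)) \<le> 1 / real (Suc n)"
      using close[OF r] by (intro always_eventually) (auto simp: abs_minus_commute less_imp_le)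
  qed
  have lim: "(\<lambda>n. Q n (r\<^sup>2)) \<longlonglongrightarrow> V r" if r: "r \<in> {a..b}" for r
  proof (rule LIM_zero_cancel, rule Lim_null_comparison)
    have D: "((\<lambda>r. Q n (r\<^sup>2) - V r) has_real_derivative Q' n (s\<^sup>2) * (2 * s) - V' s) (at s within {a..b})"
      if "s \<in> {a..b}" for s n
      using that
      by (auto intro!: derivative_eq_intros der DERIV_chain'[where g = "Q n", OF _ Qd, THEN DERIV_cong])
    have B: "norm (Q' n (s\<^sup>2) * (2 * s) - V' s) \<le> 2 * b / real (Suc n)" if "s \<in> {a..b}" for s n
    proof -
      have "Q' n (s\<^sup>2) * (2 * s) - V' s = - ((V' s / (2 * s) - Q' n (s\<^sup>2)) * (2 * s))"
        using that ab by (simp add: field_simps)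
      then have "norm (Q' n (s\<^sup>2) * (2 * s) - V' s) = \<bar>V' s / (2 * s) - Q' n (s\<^sup>2)\<bar> * (2 * s)"
        using that ab by (simp add: abs_mult)
      also have "\<dots> \<le> 1 / real (Suc n) * (2 * b)"
        using close[OF that, of n] that ab by (intro mult_mono) auto
      finally show ?thesis by simp
    qed
    have "norm ((Q n (r\<^sup>2) - V r) - (Q n (a\<^sup>2) - V a)) \<le> 2 * b / real (Suc n) * norm (r - a)" for n
      by (rule field_differentiable_bound[OF convex_real_interval(5) D B]) (use r ab in auto)
    then have "norm (Q n (r\<^sup>2) - V r) \<le> 2 * b * norm (r - a) * (1 / real (Suc n))" for n
      by (simp add: Q_def)
    then show "\<forall>\<^sub>F n in sequentially. norm (Q n (r\<^sup>2) - V r) \<le> 2 * b * norm (r - a) * (1 / real (Suc n))"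
      by (intro always_eventually allI)
    show "(\<lambda>n. 2 * b * norm (r - a) * (1 / real (Suc n))) \<longlonglongrightarrow> 0"
      using tendsto_mult_right_zero[OF inv0] by blast
  qed
  have "bounded (m ` {a\<^sup>2..b\<^sup>2})"
    by (intro compact_imp_bounded compact_continuous_image mc) auto
  then obtain M where M: "\<forall>\<sigma>\<in>{a\<^sup>2..b\<^sup>2}. norm (m \<sigma>) \<le> M" unfolding bounded_iff by (metis imageI)
  have "\<bar>Q' n (r\<^sup>2)\<bar> \<le> \<bar>M\<bar> + 1" if r: "r \<in> {a..b}" for n r
  proof -
    have "1 / real (Suc n) \<le> 1" by simp
    moreover have "\<bar>m (r\<^sup>2)\<bar> \<le> \<bar>M\<bar>" using M sq'[OF r] by fastforce
    ultimately show ?thesis using close[OF r, of n] mr[OF r] by linarith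
  qed
  then show ?thesis by (intro that[OF Qs Qd lim lim']) auto
qed

lemma measurable_on_open_extension:
  fixes f :: "'a::euclidean_space \<Rightarrow> 'b::euclidean_space"
  assumes "open \<Omega>" "continuous_on \<Omega> f"
  shows "(\<lambda>x. indicat_real \<Omega> x *\<^sub>R f x) \<in> borel_measurable (lebesgue_on B)"
proof -
  have "(\<lambda>x. indicat_real \<Omega> x *\<^sub>R f x) \<in> borel_measurable borel"
    using assms by (intro borel_measurable_continuous_on_indicator) auto
  then have "(\<lambda>x. indicat_real \<Omega> x *\<^sub>R f x) \<in> borel_measurable lebesgue"
    by (intro measurable_completion) simp
  then show ?thesis by (rule measurable_restrict_space1)
qed

text \<open>A comparison principle for two solutions \<open>u\<close> and \<open>V(\<bar>x\<bar>)\<close> of one equation with equal boundary values; the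
  two signs \<open>\<sigma>\<close> give both inequalities. Testing with a function of \<open>\<sigma> (u - V)\<close> that vanishes below \<open>\<epsilon>\<close>
  shows, by strict monotonicity, that the gradients agree where \<open>\<sigma> (u - V) > \<epsilon>\<close>. The truncated difference
  then has vanishing gradient, and the Euler identity shows that its integral is zero.
  Since \<open>u - V\<close> is not smooth, all this is carried out for the smooth functions
  \<open>\<phi>\<^sub>n - Q\<^sub>n(\<bar>x\<bar>\<^sup>2)\<close> and passed to the limit.\<close>

lemma annulus_one_sided_comparison:
  fixes u :: "'a::euclidean_space \<Rightarrow> real" and G :: "'a \<Rightarrow> 'a" and V V' :: "real \<Rightarrow> real"
  defines "Vg \<equiv> \<lambda>x::'a. (V' (norm x) / norm x) *\<^sub>R x"
  assumes p: "1 < p" and ab: "0 < a" "a < b" "b < R"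
    and \<phi>: "\<And>n. test_function (ball 0 R) (\<phi> n)"
    and G: "G \<in> borel_measurable (lebesgue_on (ball 0 R))"
    and H: "H \<in> borel_measurable (lebesgue_on (ball 0 R))" "\<And>x. 1 \<le> H x"
      "integrable (lebesgue_on (ball 0 R)) (\<lambda>x. H x powr p)"
    and lim: "AE x in lebesgue_on (ball 0 R). (\<lambda>n. \<phi> n x) \<longlonglongrightarrow> u x \<and> (\<lambda>n. grad (\<phi> n) x) \<longlonglongrightarrow> G x \<and>
       norm (G x) \<le> H x \<and> (\<forall>n. norm (grad (\<phi> n) x) \<le> H x)"
    and u: "continuous_on (ball 0 R - {0}) u"
    and V: "\<And>r. r \<in> {a..b} \<Longrightarrow> (V has_real_derivative V' r) (at r within {a..b})"
      "continuous_on {a..b} V'"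
    and bdry: "\<And>x. norm x = a \<Longrightarrow> u x = V a" "\<And>x. norm x = b \<Longrightarrow> u x = V b"
    and weak: "\<And>\<Theta>. test_function {x. a < norm x \<and> norm x < b} \<Theta> \<Longrightarrow>
      (\<integral>x. (pvec p (G x) - pvec p (Vg x)) \<bullet> grad \<Theta> x \<partial>lebesgue_on (ball 0 R)) = 0"
    and \<sigma>: "\<sigma> = 1 \<or> \<sigma> = - 1" and \<epsilon>: "\<epsilon> > 0" and x0: "a < norm x0" "norm x0 < b"
  shows "\<sigma> * (u x0 - V (norm x0)) \<le> \<epsilon>"
proof (rule ccontr)
  let ?M = "lebesgue_on (ball 0 R :: 'a set)"
  let ?N = "DIM('a)"
  define \<Omega> where "\<Omega> = {x::'a. a < norm x \<and> norm x < b}"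
  define C where "C = {x::'a. a \<le> norm x \<and> norm x \<le> b}"
  assume neg: "\<not> \<sigma> * (u x0 - V (norm x0)) \<le> \<epsilon>"
  have \<Omega>o: "open \<Omega>" unfolding \<Omega>_def by (intro open_Collect_conj open_Collect_less continuous_intros)
  have \<Omega>C: "\<Omega> \<subseteq> C" and CB: "C \<subseteq> ball 0 R - {0}" using ab by (auto simp: \<Omega>_def C_def)
  have Cc: "compact C"
  proof -
    have "C = cball 0 b - ball 0 a" by (auto simp: C_def)
    then show ?thesis by (simp add: compact_diff)
  qed
  have Vc: "continuous_on {a..b} V" using V(1) DERIV_continuous_on by blast
  define w where "w x = u x - V (norm x)" for x
  have wc: "continuous_on C w"
    unfolding w_def using CB
    by (intro continuous_intros continuous_on_subset[OF u] continuous_on_compose2[OF Vc])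
      (auto simp: C_def)
  \<comment> \<open>By the boundary values this set keeps a positive distance from the boundary of the annulus,
     so there is room for a cutoff that equals one near it.\<close>
  define K where "K = {x\<in>C. \<epsilon> \<le> \<sigma> * w x}"
  have Kc: "compact K"
  proof -
    have "closedin (top_of_set C) K"
      using continuous_closedin_preimage[OF continuous_on_mult[OF continuous_on_const wc], of "{\<epsilon>..}" \<sigma>]
      by (simp add: K_def vimage_def Int_def conj_commute)
    then show ?thesis using Cc closedin_compact by blast
  qed
  have K\<Omega>: "K \<subseteq> \<Omega>"
  proof
    fix x assume x: "x \<in> K"
    have "norm x \<noteq> a" "norm x \<noteq> b" using x bdry[of x] \<epsilon> by (auto simp: K_def w_def)
    then show "x \<in> \<Omega>" using x by (auto simp: K_def C_def \<Omega>_def)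
  qed
  have x0K: "x0 \<in> K" using x0 neg by (auto simp: K_def C_def w_def)
  have "compact (norm ` K)" "norm ` K \<noteq> {}"
    using Kc x0K by (auto intro!: compact_continuous_image continuous_intros)
  then obtain a' b' where a'b': "a' \<in> norm ` K" "b' \<in> norm ` K" "\<And>x. x \<in> K \<Longrightarrow> a' \<le> norm x \<and> norm x \<le> b'"
    by (metis compact_attains_inf compact_attains_sup imageI)
  have aa': "a < a'" "b' < b" using a'b' K\<Omega> by (auto simp: \<Omega>_def)
  \<comment> \<open>Two intermediate radii on each side: the cutoff vanishes outside \<open>(a1, b1)\<close> and equals one on
     \<open>[a2, b2]\<close>, which contains a neighbourhood of all radii of points of \<open>K\<close>.\<close>
  define a1 a2 b1 b2 where "a1 = (2 * a + a') / 3" and "a2 = (a + 2 * a') / 3"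
    and "b1 = (2 * b + b') / 3" and "b2 = (b + 2 * b') / 3"
  have ord: "0 < a1" "a < a1" "a1 < a2" "a2 < a'" "b' < b2" "b2 < b1" "b1 < b" "a2 < b2"
    using aa' ab(1) a'b'(3)[OF x0K] by (auto simp: a1_def a2_def b1_def b2_def)
  obtain \<eta> where \<eta>: "\<And>k. C_k k \<eta>" "\<And>t. 0 \<le> \<eta> t" "\<And>t. \<eta> t \<le> 1" "\<And>t. t \<in> {a2\<^sup>2..b2\<^sup>2} \<Longrightarrow> \<eta> t = 1"
      "\<And>t. t \<le> a1\<^sup>2 \<or> b1\<^sup>2 \<le> t \<Longrightarrow> \<eta> t = 0"
  proof -
    have "a1\<^sup>2 < a2\<^sup>2" "b2\<^sup>2 < b1\<^sup>2" using ord ab by (auto intro!: power_strict_mono)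
    from smooth_cutoff[OF this] show ?thesis using that by blast
  qed
  define \<eta>' where "\<eta>' = (grad \<eta> :: real \<Rightarrow> real)"
  have \<eta>d: "(\<eta> has_real_derivative \<eta>' t) (at t)" for t
    unfolding \<eta>'_def by (rule smooth_real_deriv[OF \<eta>(1)])
  have \<eta>'0: "\<eta>' t = 0" if "t < a1\<^sup>2 \<or> b1\<^sup>2 < t \<or> (a2\<^sup>2 < t \<and> t < b2\<^sup>2)" for t
  proof -
    let ?S = "{..<a1\<^sup>2} \<union> {b1\<^sup>2<..}"
    have "\<exists>S c. open S \<and> t \<in> S \<and> (\<forall>s\<in>S. \<eta> s = c)"
    proof (cases "a2\<^sup>2 < t \<and> t < b2\<^sup>2")
      case True
      then show ?thesis using \<eta>(4) by (intro exI[of _ "{a2\<^sup>2<..<b2\<^sup>2}"] exI[of _ 1]) auto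
    next
      case False
      then show ?thesis using that \<eta>(5) by (intro exI[of _ ?S] exI[of _ 0]) auto
    qed
    then obtain S c where S: "open S" "t \<in> S" "\<And>s. s \<in> S \<Longrightarrow> \<eta> s = c" by blast
    have "((\<lambda>_. c) has_real_derivative 0) (at t)" by simp
    then have "(\<eta> has_real_derivative 0) (at t)"
      by (rule has_field_derivative_transform_within_open[OF _ S(1,2)]) (simp add: S(3))
    then show ?thesis using DERIV_unique \<eta>d by blast
  qed
  have "bounded (\<eta>' ` {a1\<^sup>2..b1\<^sup>2})"
    unfolding \<eta>'_def by (intro compact_imp_bounded compact_continuous_image smooth_grad(2)[OF \<eta>(1)]) auto
  then obtain M1 where "\<forall>t\<in>{a1\<^sup>2..b1\<^sup>2}. norm (\<eta>' t) \<le> M1" unfolding bounded_iff by (metis imageI)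
  then have M1: "\<bar>\<eta>' t\<bar> \<le> \<bar>M1\<bar>" for t
    using \<eta>'0[of t] by (cases "t \<in> {a1\<^sup>2..b1\<^sup>2}") force+
  obtain Q Q' M2 where Q: "\<And>n k. C_k k (Q n)"
    "\<And>n t. (Q n has_real_derivative Q' n t) (at t)"
    "\<And>r. r \<in> {a..b} \<Longrightarrow> (\<lambda>n. Q n (r\<^sup>2)) \<longlonglongrightarrow> V r"
    "\<And>r. r \<in> {a..b} \<Longrightarrow> (\<lambda>n. Q' n (r\<^sup>2)) \<longlonglongrightarrow> V' r / (2 * r)"
    "\<And>n r. r \<in> {a..b} \<Longrightarrow> \<bar>Q' n (r\<^sup>2)\<bar> \<le> M2" "0 \<le> M2"
    using smooth_C1_approximation[OF ab(1,2) V] by metis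
  define T where "T t = flat_exp 0 (\<sigma> * t - \<epsilon>)" for t
  define T' where "T' t = \<sigma> * flat_exp 2 (\<sigma> * t - \<epsilon>)" for t
  have Td: "(T has_real_derivative T' t) (at t)" for t
    unfolding T_def[abs_def] T'_def
    by (auto intro!: derivative_eq_intros DERIV_chain'[where g = "flat_exp 0", OF _ flat_exp_deriv, THEN DERIV_cong]
        simp: numeral_2_eq_2)
  have Tsm: "C_k k T" for k
  proof -
    have "C_k k (\<lambda>t. flat_exp 0 (\<sigma> * t + (- \<epsilon>)))"
      by (intro C_k_compose[OF C_k_flat_exp] C_k_add C_k_mult C_k_const C_k_ident)
    then show ?thesis by (simp add: T_def[abs_def])
  qed
  have T'c: "isCont T' t" for t
    unfolding T'_def[abs_def] by (intro continuous_intros isCont_o2[OF _ flat_exp_cont])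
  have Tb: "\<bar>T t\<bar> \<le> 1" "\<bar>T' t\<bar> \<le> 2" for t
    using flat_exp_le[of 0] flat_exp_le[of 2] flat_exp_nonneg \<sigma>
    by (auto simp: T_def T'_def abs_mult fact_2)
  have T0: "T t = 0" if "\<sigma> * t < \<epsilon>" for t using that by (simp add: T_def flat_exp_eq_0)
  have T'sgn: "0 \<le> \<sigma> * T' t" for t
    using \<sigma> flat_exp_nonneg[of 2] by (auto simp: T'_def)
  define d where "d n x = \<phi> n x - Q n (x \<bullet> x)" for n x
  define \<Theta> where "\<Theta> n x = T (d n x) * \<eta> (x \<bullet> x)" for n x
  define D\<Theta> where "D\<Theta> n x = (T' (d n x) * \<eta> (x \<bullet> x)) *\<^sub>R (grad (\<phi> n) x - (2 * Q' n (x \<bullet> x)) *\<^sub>R x)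
      + (2 * T (d n x) * \<eta>' (x \<bullet> x)) *\<^sub>R x" for n x
  have \<Theta>d: "(\<Theta> n has_derivative (\<lambda>h. D\<Theta> n x \<bullet> h)) (at x)" for n x
  proof -
    have xx: "((\<lambda>x. x \<bullet> x) has_derivative (\<lambda>h. 2 * (x \<bullet> h))) (at x)"
      by (auto intro!: derivative_eq_intros simp: inner_commute)
    have "(d n has_derivative (\<lambda>h. grad (\<phi> n) x \<bullet> h - 2 * (x \<bullet> h) * Q' n (x \<bullet> x))) (at x)"
      unfolding d_def[abs_def]
      by (intro has_derivative_diff test_functionD(4)[OF \<phi>] DERIV_compose_FDERIV[OF Q(2) xx])
    from has_derivative_mult[OF DERIV_compose_FDERIV[OF Td this] DERIV_compose_FDERIV[OF \<eta>d xx]]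
    show ?thesis unfolding \<Theta>_def[abs_def]
      by (rule has_derivative_eq_rhs)
        (auto simp: D\<Theta>_def inner_add_left inner_diff_left algebra_simps)
  qed
  have grad\<Theta>: "grad (\<Theta> n) x = D\<Theta> n x" for n x by (rule grad_eqI[OF \<Theta>d])
  define C1 where "C1 = {x::'a. a1 \<le> norm x \<and> norm x \<le> b1}"
  have C1: "compact C1" "C1 \<subseteq> \<Omega>"
  proof -
    have "C1 = cball 0 b1 - ball 0 a1" by (auto simp: C1_def)
    then show "compact C1" by (simp add: compact_diff)
    show "C1 \<subseteq> \<Omega>" using ord by (auto simp: C1_def \<Omega>_def)
  qed
  have \<eta>out: "\<eta> (x \<bullet> x) = 0" if "x \<notin> C1" for x
  proof -
    have "norm x \<le> a1 \<or> b1 \<le> norm x" using that by (auto simp: C1_def)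
    then have "x \<bullet> x \<le> a1\<^sup>2 \<or> b1\<^sup>2 \<le> x \<bullet> x"
      using ord ab by (auto simp: dot_square_norm power_mono)
    then show ?thesis using \<eta>(5) by blast
  qed
  have \<Theta>out: "\<Theta> n x = 0" if "x \<notin> C1" for n x using \<eta>out[OF that] by (simp add: \<Theta>_def)
  have \<Theta>cl: "closure {x. \<Theta> n x \<noteq> 0} \<subseteq> C1" for n
    using \<Theta>out C1(1) by (intro closure_minimal) (auto simp: compact_imp_closed)
  have \<Theta>t: "test_function \<Omega> (\<Theta> n)" for n
    unfolding test_function_def
  proof (intro conjI allI)
    show "C_k k (\<Theta> n)" for k
    proof -
      have "C_k k (\<lambda>x. T (\<phi> n x + (-1) * Q n (x \<bullet> x)) * \<eta> (x \<bullet> x))"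
        by (intro C_k_mult C_k_compose[OF Tsm] C_k_compose[OF \<eta>(1)] C_k_add C_k_const
            C_k_compose[OF Q(1)] C_k_inner_self test_functionD(1)[OF \<phi>])
      then show ?thesis by (simp add: \<Theta>_def[abs_def] d_def)
    qed
    show "compact (closure {x. \<Theta> n x \<noteq> 0})"
      using \<Theta>cl C1(1) by (meson closed_closure compact_Int_closed compact_eq_bounded_closed bounded_subset)
    show "closure {x. \<Theta> n x \<noteq> 0} \<subseteq> \<Omega>" using \<Theta>cl C1(2) by blast
  qed
  have D\<Theta>out: "D\<Theta> n x = 0" if "x \<notin> \<Omega>" for n x
    using grad_eq_0_outside(2)[of x "\<Theta> n"] \<Theta>cl[of n] C1(2) that grad\<Theta> by auto
  \<comment> \<open>The limits of \<open>D\<Theta> n\<close> and \<open>\<Theta> n\<close> are \<open>Z\<close> and \<open>P\<close>; the difference of the two fluxes is \<open>Y\<close>.\<close>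
  define Z where "Z x = (if x \<in> \<Omega> then (T' (w x) * \<eta> (x \<bullet> x)) *\<^sub>R (G x - Vg x) else 0)" for x
  define Y where "Y x = pvec p (indicat_real \<Omega> x *\<^sub>R G x) - pvec p (indicat_real \<Omega> x *\<^sub>R Vg x)" for x
  define P where "P x = (if x \<in> \<Omega> then T (w x) * \<eta> (x \<bullet> x) else 0)" for x
  have Vgc: "continuous_on \<Omega> Vg"
    unfolding Vg_def using ab
    by (intro continuous_intros continuous_on_compose2[OF V(2)]) (auto simp: \<Omega>_def)
  have Vgm: "(\<lambda>x. indicat_real \<Omega> x *\<^sub>R Vg x) \<in> borel_measurable ?M"
    by (rule measurable_on_open_extension[OF \<Omega>o Vgc])
  have \<Omega>ind: "indicat_real \<Omega> \<in> borel_measurable ?M"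
    using measurable_on_open_extension[OF \<Omega>o continuous_on_const[of _ "1::real"], of "ball 0 R"] by simp
  have wc\<Omega>: "continuous_on \<Omega> w" using wc \<Omega>C continuous_on_subset by blast
  have [measurable]: "Y \<in> borel_measurable ?M"
    unfolding Y_def[abs_def] using G \<Omega>ind Vgm by measurable
  have [measurable]: "D\<Theta> n \<in> borel_measurable ?M" for n
  proof -
    have "grad (\<Theta> n) \<in> borel_measurable ?M"
      by (intro continuous_imp_measurable_on_sets_lebesgue test_functionD(5)[OF \<Theta>t]) auto
    moreover have "grad (\<Theta> n) = D\<Theta> n" using grad\<Theta> by blast
    ultimately show ?thesis by simp
  qed
  have [measurable]: "\<Theta> n \<in> borel_measurable ?M" for n
    by (intro continuous_imp_measurable_on_sets_lebesgue test_functionD(6)[OF \<Theta>t]) auto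
  have sm: "continuous_on S (\<lambda>x::'a. \<eta> (x \<bullet> x))" for S
    by (intro smooth_grad(3) C_k_compose[OF \<eta>(1)] C_k_inner_self)
  have Zm[measurable]: "Z \<in> borel_measurable ?M"
  proof -
    have "continuous_on \<Omega> (\<lambda>x. T' (w x) * \<eta> (x \<bullet> x))"
      by (intro continuous_on_mult sm continuous_on_compose2[OF _ wc\<Omega>, of UNIV])
        (auto intro: continuous_at_imp_continuous_on T'c)
    from measurable_on_open_extension[OF \<Omega>o this, of "ball 0 R"]
    have m1: "(\<lambda>x. indicat_real \<Omega> x *\<^sub>R (T' (w x) * \<eta> (x \<bullet> x))) \<in> borel_measurable ?M" .
    have "Z = (\<lambda>x. (indicat_real \<Omega> x *\<^sub>R (T' (w x) * \<eta> (x \<bullet> x))) *\<^sub>R (G x - indicat_real \<Omega> x *\<^sub>R Vg x))"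
      by (auto simp: Z_def fun_eq_iff)
    then show ?thesis using m1 G Vgm by simp
  qed
  have Pm[measurable]: "P \<in> borel_measurable ?M"
  proof -
    have c: "continuous_on \<Omega> (\<lambda>x. T (w x) * \<eta> (x \<bullet> x))"
      by (intro continuous_on_mult sm continuous_on_compose2[OF _ wc\<Omega>, of UNIV])
        (auto intro: smooth_grad(3)[OF Tsm])
    have "(\<lambda>x. indicat_real \<Omega> x *\<^sub>R (T (w x) * \<eta> (x \<bullet> x))) \<in> borel_measurable ?M"
      by (rule measurable_on_open_extension[OF \<Omega>o c])
    moreover have "(\<lambda>x. indicat_real \<Omega> x *\<^sub>R (T (w x) * \<eta> (x \<bullet> x))) = P"
      by (auto simp: P_def fun_eq_iff)
    ultimately show ?thesis by simp
  qed
  have rng: "norm x \<in> {a..b}" if "x \<in> \<Omega>" for x using that by (auto simp: \<Omega>_def)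
  have xx2: "x \<bullet> x = (norm x)\<^sup>2" for x :: 'a by (simp add: dot_square_norm)
  have lims: "AE x in ?M. (\<lambda>n. D\<Theta> n x) \<longlonglongrightarrow> Z x \<and> (\<lambda>n. \<Theta> n x) \<longlonglongrightarrow> P x \<and> norm (G x) \<le> H x \<and>
      (\<forall>n. norm (D\<Theta> n x) \<le> (2 * (1 + 2 * M2 * b) + 2 * \<bar>M1\<bar> * b) * H x)"
    using lim
  proof eventually_elim
    case (elim x)
    show ?case
    proof (cases "x \<in> \<Omega>")
      case False
      then have "x \<notin> C1" using C1(2) by blast
      moreover have "0 \<le> (2 * (1 + 2 * M2 * b) + 2 * \<bar>M1\<bar> * b) * H x"
        using H(2)[of x] Q(6) ab by simp
      ultimately show ?thesis
        using False elim by (simp add: D\<Theta>out \<Theta>out Z_def P_def)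
    next
      case True
      have dl: "(\<lambda>n. d n x) \<longlonglongrightarrow> w x"
        unfolding d_def w_def xx2 using elim Q(3)[OF rng[OF True]] by (intro tendsto_diff) auto
      have Tl: "(\<lambda>n. T (d n x)) \<longlonglongrightarrow> T (w x)" "(\<lambda>n. T' (d n x)) \<longlonglongrightarrow> T' (w x)"
        using isCont_tendsto_compose[OF DERIV_isCont[OF Td] dl] isCont_tendsto_compose[OF T'c dl] by auto
      have Q'l: "(\<lambda>n. Q' n (x \<bullet> x)) \<longlonglongrightarrow> V' (norm x) / (2 * norm x)"
        unfolding xx2 by (rule Q(4)[OF rng[OF True]])
      have "(\<lambda>n. D\<Theta> n x) \<longlonglongrightarrow> (T' (w x) * \<eta> (x \<bullet> x)) *\<^sub>R (G x - (2 * (V' (norm x) / (2 * norm x))) *\<^sub>R x)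
          + (2 * T (w x) * \<eta>' (x \<bullet> x)) *\<^sub>R x"
        unfolding D\<Theta>_def using elim Tl Q'l by (intro tendsto_intros) auto
      \<comment> \<open>The derivative of the cutoff lives where the truncated difference is zero.\<close>
      moreover have "T (w x) * \<eta>' (x \<bullet> x) = 0"
      proof (cases "x \<in> K")
        case True
        then have "a' \<le> norm x" "norm x \<le> b'" using a'b'(3) by auto
        then have "a2\<^sup>2 < x \<bullet> x" "x \<bullet> x < b2\<^sup>2"
          using ord ab unfolding xx2 by (auto intro!: power_strict_mono)
        then show ?thesis using \<eta>'0 by simp
      next
        case False
        then have "\<sigma> * w x < \<epsilon>" using True \<Omega>C by (auto simp: K_def)
        then show ?thesis by (simp add: T0)
      qed
      ultimately have l1: "(\<lambda>n. D\<Theta> n x) \<longlonglongrightarrow> Z x" using True by (auto simp: Z_def Vg_def)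
      have l2: "(\<lambda>n. \<Theta> n x) \<longlonglongrightarrow> P x"
        using True Tl by (auto simp: \<Theta>_def P_def intro!: tendsto_intros)
      have nx: "norm x \<le> b" using True by (auto simp: \<Omega>_def)
      have "norm (D\<Theta> n x) \<le> (2 * (1 + 2 * M2 * b) + 2 * \<bar>M1\<bar> * b) * H x" for n
      proof -
        have Q'b: "\<bar>Q' n (x \<bullet> x)\<bar> \<le> M2" unfolding xx2 by (rule Q(5)[OF rng[OF True]])
        have "norm (grad (\<phi> n) x - (2 * Q' n (x \<bullet> x)) *\<^sub>R x) \<le> H x + 2 * M2 * b"
        proof -
          have "norm ((2 * Q' n (x \<bullet> x)) *\<^sub>R x) \<le> 2 * M2 * b"
            using Q'b nx Q(6) by (auto simp: abs_mult intro!: mult_mono)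
          then show ?thesis using elim norm_triangle_ineq4[of "grad (\<phi> n) x" "(2 * Q' n (x \<bullet> x)) *\<^sub>R x"]
            by (smt (verit))
        qed
        then have "norm ((T' (d n x) * \<eta> (x \<bullet> x)) *\<^sub>R (grad (\<phi> n) x - (2 * Q' n (x \<bullet> x)) *\<^sub>R x))
            \<le> (2 * 1) * (H x + 2 * M2 * b)"
          using Tb(2)[of "d n x"] \<eta>(2,3)[of "x \<bullet> x"]
          unfolding norm_scaleR abs_mult by (intro mult_mono) auto
        moreover have "norm ((2 * T (d n x) * \<eta>' (x \<bullet> x)) *\<^sub>R x) \<le> (2 * 1 * \<bar>M1\<bar>) * b"
          using Tb(1)[of "d n x"] M1 nx unfolding norm_scaleR abs_mult by (intro mult_mono) auto
        ultimately have "norm (D\<Theta> n x) \<le> 2 * (H x + 2 * M2 * b) + 2 * \<bar>M1\<bar> * b"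
          unfolding D\<Theta>_def by (intro order_trans[OF norm_triangle_ineq]) simp
        also have "\<dots> \<le> 2 * (H x + 2 * M2 * b * H x) + 2 * \<bar>M1\<bar> * b * H x"
          using mult_left_mono[OF H(2)[of x], of "2 * M2 * b"] mult_left_mono[OF H(2)[of x], of "2 * \<bar>M1\<bar> * b"]
            Q(6) ab by simp
        finally show ?thesis by (simp add: algebra_simps)
      qed
      then show ?thesis using l1 l2 elim by blast
    qed
  qed
  define B where "B = 2 * (1 + 2 * M2 * b) + 2 * \<bar>M1\<bar> * b"
  have B0: "B \<ge> 0" using Q(6) ab by (simp add: B_def)
  have "bounded (V' ` {a..b})" by (intro compact_imp_bounded compact_continuous_image V(2)) auto
  then obtain M3 where M3: "\<forall>r\<in>{a..b}. norm (V' r) \<le> M3" unfolding bounded_iff by (metis imageI)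
  have Vgb: "norm (Vg x) \<le> \<bar>M3\<bar>" if "x \<in> \<Omega>" for x
  proof -
    have "norm (Vg x) = \<bar>V' (norm x)\<bar>" using that ab by (auto simp: Vg_def \<Omega>_def)
    then show ?thesis using M3 rng[OF that] by force
  qed
  have Hp: "1 \<le> H x powr (p - 1)" "H x powr (p - 1) * H x = H x powr p" "1 \<le> H x powr p" "H x \<le> H x powr p" for x
    using H(2)[of x] p powr_mult_base[of "H x" "p - 1"] powr_mono[of 1 p "H x"]
    by (auto simp: ge_one_powr_ge_zero mult.commute)
  define B2 where "B2 = 1 + \<bar>M3\<bar> powr (p - 1)"
  have Yb: "norm (Y x) \<le> B2 * H x powr (p - 1)" if "norm (G x) \<le> H x" for x
  proof (cases "x \<in> \<Omega>")
    case True
    have "norm (Y x) \<le> norm (G x) powr (p - 1) + norm (Vg x) powr (p - 1)"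
      using norm_triangle_ineq4[of "pvec p (G x)" "pvec p (Vg x)"] True by (simp add: Y_def norm_pvec)
    also have "\<dots> \<le> H x powr (p - 1) + \<bar>M3\<bar> powr (p - 1)"
      using that Vgb[OF True] p by (intro add_mono powr_mono2) auto
    also have "\<dots> \<le> B2 * H x powr (p - 1)"
      using mult_left_mono[OF Hp(1)[of x], of "\<bar>M3\<bar> powr (p - 1)"] by (simp add: B2_def algebra_simps)
    finally show ?thesis .
  qed (simp add: Y_def pvec_def B2_def)
  have I1: "(\<lambda>n. \<integral>x. Y x \<bullet> D\<Theta> n x \<partial>?M) \<longlonglongrightarrow> (\<integral>x. Y x \<bullet> Z x \<partial>?M)"
    and I1': "integrable ?M (\<lambda>x. Y x \<bullet> Z x)"
  proof -
    have w: "integrable ?M (\<lambda>x. B2 * B * H x powr p)" using H(3) by (rule integrable_mult_right)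
    have l: "AE x in ?M. (\<lambda>n. Y x \<bullet> D\<Theta> n x) \<longlonglongrightarrow> Y x \<bullet> Z x"
      using lims by eventually_elim (auto intro!: tendsto_intros)
    have bd: "AE x in ?M. norm (Y x \<bullet> D\<Theta> n x) \<le> B2 * B * H x powr p" for n
      using lims
    proof eventually_elim
      case (elim x)
      have "norm (Y x \<bullet> D\<Theta> n x) \<le> norm (Y x) * norm (D\<Theta> n x)" by (simp add: Cauchy_Schwarz_ineq2)
      also have "\<dots> \<le> (B2 * H x powr (p - 1)) * (B * H x)"
        using elim Yb[of x] B0 H(2)[of x] by (intro mult_mono) (auto simp: B_def B2_def)
      also have "\<dots> = B2 * B * (H x powr (p - 1) * H x)" by (simp only: ac_simps)
      finally show ?case by (simp add: Hp(2))
    qed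
    have m1: "(\<lambda>x. Y x \<bullet> Z x) \<in> borel_measurable ?M" and m2: "(\<lambda>x. Y x \<bullet> D\<Theta> n x) \<in> borel_measurable ?M" for n
      by measurable
    show "(\<lambda>n. \<integral>x. Y x \<bullet> D\<Theta> n x \<partial>?M) \<longlonglongrightarrow> (\<integral>x. Y x \<bullet> Z x \<partial>?M)"
      by (rule integral_dominated_convergence[OF m1 m2 w l bd])
    show "integrable ?M (\<lambda>x. Y x \<bullet> Z x)"
      by (rule integrable_dominated_convergence[OF m1 m2 w l bd])
  qed
  have "(\<integral>x. Y x \<bullet> D\<Theta> n x \<partial>?M) = 0" for n
  proof -
    have "Y x \<bullet> D\<Theta> n x = (pvec p (G x) - pvec p (Vg x)) \<bullet> grad (\<Theta> n) x" for x
      using D\<Theta>out[of x n] grad\<Theta>[of n x] by (cases "x \<in> \<Omega>") (auto simp: Y_def)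
    then show ?thesis using weak[OF \<Theta>t[unfolded \<Omega>_def]] by simp
  qed
  then have I2: "(\<integral>x. Y x \<bullet> Z x \<partial>?M) = 0" using I1 by (simp add: LIMSEQ_const_iff)
  have YZ: "\<sigma> * (Y x \<bullet> Z x) = (if x \<in> \<Omega> then \<sigma> * T' (w x) * \<eta> (x \<bullet> x) * ((pvec p (G x) - pvec p (Vg x)) \<bullet> (G x - Vg x)) else 0)" for x
    by (auto simp: Y_def Z_def)
  \<comment> \<open>The limit of the weak equation is the integral of a nonnegative function.\<close>
  have AEZ: "AE x in ?M. Z x = 0"
  proof -
    have nn: "0 \<le> \<sigma> * (Y x \<bullet> Z x)" for x
      unfolding YZ using T'sgn[of "w x"] \<eta>(2)[of "x \<bullet> x"] pvec_strict_mono(1)[OF p]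
      by (auto intro!: mult_nonneg_nonneg)
    have "AE x in ?M. \<sigma> * (Y x \<bullet> Z x) = 0"
      using I1' I2 nn by (subst integral_nonneg_eq_0_iff_AE[symmetric]) auto
    then show ?thesis
    proof eventually_elim
      case (elim x)
      show "Z x = 0"
      proof (cases "x \<in> \<Omega>")
        case True
        then have "T' (w x) * \<eta> (x \<bullet> x) = 0 \<or> (pvec p (G x) - pvec p (Vg x)) \<bullet> (G x - Vg x) = 0"
          using elim \<sigma> unfolding YZ by auto
        then show ?thesis using pvec_strict_mono(2)[OF p] True by (auto simp: Z_def)
      qed (simp add: Z_def)
    qed
  qed
  have E0: "(\<integral>x. real ?N * \<Theta> n x + D\<Theta> n x \<bullet> x \<partial>?M) = 0" for n
  proof (rule euler_identity_on(2)[where \<Omega> = \<Omega> and K = C1])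
    show "continuous_on \<Omega> (D\<Theta> n)"
      using test_functionD(5)[OF \<Theta>t, of \<Omega> n] grad\<Theta> by (simp cong: continuous_on_cong)
    show "\<Omega> \<subseteq> ball 0 R" using \<Omega>C CB by blast
  qed (use \<Omega>o C1 \<Theta>d \<Theta>out D\<Theta>out in auto)
  have l: "AE x in ?M. (\<lambda>n. real ?N * \<Theta> n x + D\<Theta> n x \<bullet> x) \<longlonglongrightarrow> real ?N * P x + Z x \<bullet> x"
    using lims by eventually_elim (auto intro!: tendsto_intros)
  have w: "integrable ?M (\<lambda>x. (real ?N + B * R) * H x powr p)" using H(3) by (rule integrable_mult_right)
  have bd: "AE x in ?M. norm (real ?N * \<Theta> n x + D\<Theta> n x \<bullet> x) \<le> (real ?N + B * R) * H x powr p" for n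
  proof -
    have "AE x in ?M. x \<in> ball 0 R" using AE_space[of ?M] by simp
    with lims show ?thesis
    proof eventually_elim
      case (elim x)
      have "\<bar>\<Theta> n x\<bar> \<le> 1"
        using Tb(1)[of "d n x"] \<eta>(2,3)[of "x \<bullet> x"] unfolding \<Theta>_def abs_mult by (intro mult_le_one) auto
      then have "\<bar>real ?N * \<Theta> n x\<bar> \<le> real ?N * H x powr p"
        using Hp(3)[of x] unfolding abs_mult by (intro mult_mono) auto
      moreover have "\<bar>D\<Theta> n x \<bullet> x\<bar> \<le> (B * H x powr p) * R"
      proof -
        have "\<bar>D\<Theta> n x \<bullet> x\<bar> \<le> norm (D\<Theta> n x) * norm x" by (rule Cauchy_Schwarz_ineq2)
        also have "\<dots> \<le> (B * H x powr p) * R"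
          using elim B0 order_trans[OF _ mult_left_mono[OF Hp(4)[of x] B0]] H(2)[of x]
          by (intro mult_mono) (auto simp: B_def)
        finally show ?thesis .
      qed
      ultimately show ?case by (simp add: algebra_simps)
    qed
  qed
  have m1: "(\<lambda>x. real ?N * P x + Z x \<bullet> x) \<in> borel_measurable ?M"
    and m2: "(\<lambda>x. real ?N * \<Theta> n x + D\<Theta> n x \<bullet> x) \<in> borel_measurable ?M" for n
  proof -
    have [measurable]: "(\<lambda>x::'a. x) \<in> borel_measurable ?M" by (rule id_borel_measurable_lebesgue_on[unfolded id_def])
    show "(\<lambda>x. real ?N * P x + Z x \<bullet> x) \<in> borel_measurable ?M"
      "(\<lambda>x. real ?N * \<Theta> n x + D\<Theta> n x \<bullet> x) \<in> borel_measurable ?M" by measurable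
  qed
  have "(\<lambda>n. \<integral>x. real ?N * \<Theta> n x + D\<Theta> n x \<bullet> x \<partial>?M) \<longlonglongrightarrow> (\<integral>x. real ?N * P x + Z x \<bullet> x \<partial>?M)"
    by (rule integral_dominated_convergence[OF m1 m2 w l bd])
  then have E1: "(\<integral>x. real ?N * P x + Z x \<bullet> x \<partial>?M) = 0" unfolding E0 by (simp add: LIMSEQ_const_iff)
  have E1': "integrable ?M (\<lambda>x. real ?N * P x + Z x \<bullet> x)"
    by (rule integrable_dominated_convergence[OF m1 m2 w l bd])
  have P0: "0 \<le> P x" for x using \<eta>(2) by (auto simp: P_def T_def flat_exp_nonneg)
  have AEP: "AE x in ?M. P x = 0"
  proof -
    have "AE x in ?M. real ?N * P x + Z x \<bullet> x \<ge> 0"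
      using AEZ by eventually_elim (use P0 in auto)
    then have "AE x in ?M. real ?N * P x + Z x \<bullet> x = 0"
      using integral_nonneg_eq_0_iff_AE[OF E1'] E1 by blast
    then show ?thesis using AEZ by eventually_elim auto
  qed
  \<comment> \<open>A null set that is open is empty.\<close>
  define W where "W = {x\<in>\<Omega>. \<epsilon> < \<sigma> * w x}"
  have Wo: "open W"
  proof -
    have "open ((\<lambda>x. \<sigma> * w x) -` {\<epsilon><..} \<inter> \<Omega>)"
      using continuous_on_open_vimage[OF \<Omega>o, of "\<lambda>x. \<sigma> * w x"] wc\<Omega>
      by (auto intro!: continuous_intros)
    then show ?thesis by (simp add: W_def vimage_def Int_def conj_commute)
  qed
  have posW: "P x > 0" if "x \<in> W" for x
  proof -
    have "x \<in> K" using that \<Omega>C by (auto simp: W_def K_def)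
    then have "a' \<le> norm x" "norm x \<le> b'" using a'b'(3) by auto
    then have "a2\<^sup>2 \<le> x \<bullet> x" "x \<bullet> x \<le> b2\<^sup>2"
      using ord ab unfolding xx2 by (auto intro!: power_mono)
    then have "\<eta> (x \<bullet> x) = 1" using \<eta>(4) by simp
    then show ?thesis using that flat_exp_pos by (auto simp: P_def W_def T_def)
  qed
  have "AE x in ?M. x \<notin> W" using AEP by eventually_elim (use posW in force)
  then have "AE x in lebesgue. x \<in> ball 0 R \<longrightarrow> x \<notin> W"
    by (subst (asm) AE_restrict_space_iff) auto
  then have "AE x in lebesgue. x \<notin> W"
    by eventually_elim (use \<Omega>C CB in \<open>auto simp: W_def\<close>)
  then have "W \<in> null_sets lebesgue"
    using Wo by (subst (asm) AE_iff_null_sets[symmetric]) auto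
  then have "negligible W" by (simp add: negligible_iff_null_sets)
  moreover have "x0 \<in> W" using neg x0 by (auto simp: W_def \<Omega>_def w_def)
  ultimately show False using open_not_negligible[OF Wo] by blast
qed

section \<open>Signed powers\<close>

definition spow :: "real \<Rightarrow> real \<Rightarrow> real" where
  "spow a z = sgn z * \<bar>z\<bar> powr a"

lemma abs_spow: "\<bar>spow a z\<bar> = \<bar>z\<bar> powr a"
  by (auto simp: spow_def abs_mult sgn_if)

lemma spow_0 [simp]: "spow a 0 = 0" by (simp add: spow_def)

lemma spow_nonneg: "0 \<le> z \<Longrightarrow> spow a z = z powr a"
  by (cases "z = 0") (auto simp: spow_def)

lemma spow_minus: "spow a (- z) = - spow a z"
  by (simp add: spow_def sgn_minus)

lemma spow_1 [simp]: "spow 1 z = z"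
  by (auto simp: spow_def sgn_if)

lemma spow_spow: "spow a (spow b z) = spow (a * b) z"
  by (auto simp: spow_def sgn_if powr_powr abs_mult mult.commute)

lemma spow_mult_nonneg: "0 \<le> c \<Longrightarrow> spow a (c * z) = c powr a * spow a z"
  by (cases "c = 0") (auto simp: spow_def sgn_mult abs_mult powr_mult)

lemma powr_mult_eq_spow: "\<bar>z\<bar> powr (p - 2) * z = spow (p - 1) z"
proof -
  have "\<bar>z\<bar> powr (p - 2) * z = sgn z * (\<bar>z\<bar> powr (p - 2) * \<bar>z\<bar>)"
    by (metis mult.assoc mult.commute sgn_mult_abs)
  then show ?thesis by (simp add: powr_minus_2_mult spow_def)
qed

lemma spow_strict_mono: "0 < a \<Longrightarrow> x < y \<Longrightarrow> spow a x < spow a y"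
proof -
  assume a: "0 < a" "x < y"
  consider "0 \<le> x" | "x < 0" "0 \<le> y" | "y < 0" using a by linarith
  then show ?thesis
  proof cases
    case 1 then show ?thesis using a by (simp add: spow_nonneg powr_less_mono2)
  next
    case 2
    then have "spow a x < 0" by (simp add: spow_def)
    moreover have "0 \<le> spow a y" using 2 by (simp add: spow_nonneg)
    ultimately show ?thesis by simp
  next
    case 3
    then have "spow a (- y) < spow a (- x)" using a by (simp add: spow_nonneg powr_less_mono2)
    then show ?thesis by (simp add: spow_minus)
  qed
qed

lemma spow_mono: "0 < a \<Longrightarrow> x \<le> y \<Longrightarrow> spow a x \<le> spow a y"
  using spow_strict_mono[of a x y] by (cases "x = y") auto

lemma isCont_spow:
  assumes "0 < a"
  shows "isCont (spow a) z"
proof (cases "z = 0")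
  case True
  have "((\<lambda>z. \<bar>z\<bar> powr a) \<longlongrightarrow> 0) (at (0::real))"
    using tendsto_powr'[of "\<lambda>z::real. \<bar>z\<bar>" 0 "at 0" "\<lambda>_. a" a] assms
    by (auto intro!: tendsto_eq_intros)
  then have "(spow a \<longlongrightarrow> 0) (at 0)"
    by (rule Lim_null_comparison[rotated]) (simp add: abs_spow)
  then show ?thesis using True by (simp add: isCont_def)
next
  case False
  then have "isCont (\<lambda>z. sgn z * \<bar>z\<bar> powr a) z" by (intro continuous_intros) auto
  then show ?thesis by (simp add: spow_def[abs_def])
qed

lemma continuous_on_spow:
  "0 < a \<Longrightarrow> continuous_on S f \<Longrightarrow> continuous_on S (\<lambda>x. spow a (f x))"
  by (rule continuous_on_compose2[where t = UNIV and g = "spow a" and f = f])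
    (simp_all add: continuous_at_imp_continuous_on isCont_spow)

lemma has_derivative_abs_powr:
  assumes q: "1 < q"
  shows "((\<lambda>z. \<bar>z\<bar> powr q) has_real_derivative q * spow (q - 1) z) (at z)"
proof -
  consider "z > 0" | "z = 0" | "z < 0" by linarith
  then show ?thesis
  proof cases
    case 1
    then have "((\<lambda>z. z powr q) has_real_derivative q * spow (q - 1) z) (at z)"
      using has_real_derivative_powr[of z q] by (simp add: spow_nonneg)
    then show ?thesis
      by (rule has_field_derivative_transform_within_open[of _ _ _ "{0<..}"]) (use 1 in auto)
  next
    case 2
    have "((\<lambda>h. (\<bar>0 + h\<bar> powr q - \<bar>0\<bar> powr q) / h) \<longlongrightarrow> spow (q - 1) 0) (at 0)"
    proof (rule Lim_transform_eventually)
      show "(spow (q - 1) \<longlongrightarrow> spow (q - 1) 0) (at 0)"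
        using isCont_spow[of "q - 1" 0] q by (simp add: isCont_def)
      have "spow (q - 1) h = \<bar>h\<bar> powr q / h" if "h \<noteq> 0" for h
        using that by (auto simp: spow_def powr_diff sgn_if abs_if)
      then show "\<forall>\<^sub>F h in at 0. spow (q - 1) h = (\<bar>0 + h\<bar> powr q - \<bar>0\<bar> powr q) / h"
        by (auto simp: eventually_at_filter)
    qed
    then show ?thesis using 2 by (simp add: DERIV_def)
  next
    case 3
    have "((\<lambda>z. (- z) powr q) has_real_derivative q * spow (q - 1) z) (at z)"
      using 3 by (auto intro!: derivative_eq_intros simp: spow_def powr_diff)
    then show ?thesis
      by (rule has_field_derivative_transform_within_open[of _ _ _ "{..<0}"]) (use 3 in auto)
  qed
qed

section \<open>Radial solutions satisfy an ordinary differential equation\<close>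

text \<open>Integrating the equation once gives \<open>r\<^sup>n \<bar>V'\<bar>\<^sup>p\<^sup>-\<^sup>2 V' = c - \<integral> s\<^sup>n k\<close>, which is solved for \<open>V'\<close> by a signed
  power. The total increment of \<open>V\<close> depends continuously on \<open>c\<close> and takes arbitrarily large values of both
  signs, so the constant \<open>c\<close> can be adjusted to the boundary values.\<close>

lemma radial_dirichlet_problem:
  fixes k :: "real \<Rightarrow> real" and n :: nat
  assumes p: "1 < p" and ab: "0 < a" "a < b" and k: "continuous_on {a..b} k"
  obtains A V where "V a = \<alpha>" "V b = \<beta>"
    "\<And>r. r \<in> {a..b} \<Longrightarrow> (V has_real_derivative spow (1 / (p - 1)) (A r / r ^ n)) (at r within {a..b})"
    "\<And>r. r \<in> {a..b} \<Longrightarrow> (A has_real_derivative - (r ^ n * k r)) (at r within {a..b})"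
proof -
  define e where "e = 1 / (p - 1)"
  have e: "0 < e" using p by (simp add: e_def)
  define \<kappa> where "\<kappa> r = integral {a..r} (\<lambda>s. s ^ n * k s)" for r
  have \<kappa>d: "(\<kappa> has_real_derivative r ^ n * k r) (at r within {a..b})" if "r \<in> {a..b}" for r
    unfolding \<kappa>_def by (rule integral_has_real_derivative[OF _ that]) (intro continuous_intros k)
  have \<kappa>c: "continuous_on {a..b} \<kappa>" by (rule DERIV_continuous_on[OF \<kappa>d])
  then have "bounded (\<kappa> ` {a..b})" by (intro compact_imp_bounded compact_continuous_image) auto
  then obtain M where M: "\<And>r. r \<in> {a..b} \<Longrightarrow> \<bar>\<kappa> r\<bar> \<le> M"
    unfolding bounded_iff by (metis imageI real_norm_def)
  define g where "g c r = spow e ((c - \<kappa> r) / r ^ n)" for c r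
  have gc: "continuous_on {a..b} (g c)" for c
    unfolding g_def using ab by (intro continuous_on_spow e continuous_intros \<kappa>c) auto
  define \<Phi> where "\<Phi> c = integral {a..b} (g c)" for c
  have \<Phi>c: "continuous_on S \<Phi>" for S
  proof -
    have "continuous_on (S \<times> cbox a b) (\<lambda>(c, r). g c r)"
      unfolding g_def split_beta using ab
      by (intro continuous_on_spow e continuous_intros continuous_on_compose2[OF \<kappa>c]) auto
    from integral_continuous_on_param[OF this] show ?thesis by (simp add: \<Phi>_def[abs_def])
  qed
  \<comment> \<open>The constants \<open>\<plusminus> c0\<close> are so large that \<open>\<plusminus> V' \<ge> z\<close>, the mean slope to be reached.\<close>
  define z where "z = \<bar>\<beta> - \<alpha>\<bar> / (b - a)"
  have z: "0 \<le> z" using ab by (simp add: z_def)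
  define c0 where "c0 = M + b ^ n * z powr (p - 1)"
  have ez: "spow e (z powr (p - 1)) = z"
    using z p by (simp add: spow_nonneg powr_powr e_def)
  have *: "z powr (p - 1) \<le> (c0 - \<kappa> r) / r ^ n" "(- c0 - \<kappa> r) / r ^ n \<le> - (z powr (p - 1))"
    if r: "r \<in> {a..b}" for r
  proof -
    have "z powr (p - 1) * r ^ n \<le> z powr (p - 1) * b ^ n"
      using r ab by (intro mult_left_mono power_mono) auto
    then have "z powr (p - 1) * r ^ n \<le> c0 - M" by (simp add: c0_def mult.commute)
    then show "z powr (p - 1) \<le> (c0 - \<kappa> r) / r ^ n" "(- c0 - \<kappa> r) / r ^ n \<le> - (z powr (p - 1))"
      using M[OF r] r ab by (auto simp: le_divide_eq divide_le_eq)
  qed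
  have lo: "\<Phi> (- c0) \<le> \<beta> - \<alpha>"
  proof -
    have "\<Phi> (- c0) \<le> integral {a..b} (\<lambda>_. - z)"
      unfolding \<Phi>_def
    proof (rule integral_le)
      fix r assume "r \<in> {a..b}"
      from spow_mono[OF e *(2)[OF this]] show "g (- c0) r \<le> - z" by (simp add: g_def spow_minus ez)
    qed (auto intro: integrable_continuous_interval gc)
    also have "\<dots> = - \<bar>\<beta> - \<alpha>\<bar>" using ab by (simp add: z_def)
    finally show ?thesis by linarith
  qed
  have hi: "\<beta> - \<alpha> \<le> \<Phi> c0"
  proof -
    have "integral {a..b} (\<lambda>_. z) \<le> \<Phi> c0"
      unfolding \<Phi>_def
    proof (rule integral_le)
      fix r assume "r \<in> {a..b}"
      from spow_mono[OF e *(1)[OF this]] show "z \<le> g c0 r" by (simp add: g_def ez)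
    qed (auto intro: integrable_continuous_interval gc)
    moreover have "integral {a..b} (\<lambda>_. z) = \<bar>\<beta> - \<alpha>\<bar>" using ab by (simp add: z_def)
    ultimately show ?thesis by linarith
  qed
  have "- c0 \<le> c0"
  proof -
    have "0 \<le> M" using M[of a] ab by fastforce
    then show ?thesis using ab by (simp add: c0_def)
  qed
  then obtain c where c: "\<Phi> c = \<beta> - \<alpha>" using IVT'[OF lo hi _ \<Phi>c] by blast
  show ?thesis
  proof (rule that[of "\<lambda>r. \<alpha> + integral {a..r} (g c)" "\<lambda>r. c - \<kappa> r"])
    show "\<alpha> + integral {a..b} (g c) = \<beta>" using c by (simp add: \<Phi>_def)
    fix r assume r: "r \<in> {a..b}"
    show "((\<lambda>r. \<alpha> + integral {a..r} (g c)) has_real_derivative spow (1 / (p - 1)) ((c - \<kappa> r) / r ^ n)) (at r within {a..b})"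
      using integral_has_real_derivative[OF gc r, of c]
      by (auto intro!: derivative_eq_intros simp: g_def e_def)
    show "((\<lambda>r. c - \<kappa> r) has_real_derivative - (r ^ n * k r)) (at r within {a..b})"
      using \<kappa>d[OF r] by (auto intro!: derivative_eq_intros)
  qed simp
qed

lemma integrable_continuous_times_test:
  fixes f :: "'a::euclidean_space \<Rightarrow> real"
  assumes "open \<Omega>" "\<Omega> \<subseteq> B" "open B" "bounded B" "continuous_on \<Omega> f" "test_function \<Omega> \<Theta>"
  shows "integrable (lebesgue_on B) (\<lambda>x. f x * \<Theta> x)"
proof -
  let ?K = "closure {x. \<Theta> x \<noteq> 0}"
  note t = test_functionD[OF assms(6)]
  have c: "continuous_on \<Omega> (\<lambda>x. f x * \<Theta> x)" by (intro continuous_on_mult assms t)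
  have z: "f x * \<Theta> x = 0" if "x \<notin> ?K" for x using grad_eq_0_outside[OF that] by simp
  have "bounded ((\<lambda>x. f x * \<Theta> x) ` ?K)"
    by (intro compact_imp_bounded compact_continuous_image continuous_on_subset[OF c] t)
  then obtain M where "\<forall>y\<in>(\<lambda>x. f x * \<Theta> x) ` ?K. norm y \<le> M"
    unfolding bounded_iff by blast
  then have M: "norm (f x * \<Theta> x) \<le> M" if "x \<in> ?K" for x
    using that by blast
  have Mb: "norm (f x * \<Theta> x) \<le> \<bar>M\<bar>" for x
  proof (cases "x \<in> ?K")
    case True
    show ?thesis by (rule order_trans[OF M[OF True] abs_ge_self])
  next
    case False
    show ?thesis unfolding z[OF False] by simp
  qed
  have ind: "indicat_real \<Omega> x *\<^sub>R (f x * \<Theta> x) = f x * \<Theta> x" for x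
  proof (cases "x \<in> \<Omega>")
    case False
    then have "x \<notin> ?K" using t(3) by blast
    then show ?thesis unfolding z[OF \<open>x \<notin> ?K\<close>] by simp
  qed simp
  have m: "(\<lambda>x. f x * \<Theta> x) \<in> borel_measurable (lebesgue_on B)"
    using measurable_on_open_extension[OF assms(1) c, of B] unfolding ind .
  have "emeasure (lebesgue_on B) (space (lebesgue_on B)) < \<infinity>"
    using emeasure_bounded_finite[OF assms(4)] assms(3)
    by (simp add: emeasure_restrict_space main_part_sets)
  then have i: "integrable (lebesgue_on B) (\<lambda>x. \<bar>M\<bar>)"
    by (auto intro!: finite_measure.integrable_const finite_measureI)
  show ?thesis by (rule Bochner_Integration.integrable_bound[OF i m]) (use Mb in auto)
qed

text \<open>The flux of \<open>V\<close> is the field \<open>(A(r) / r\<^sup>N) x\<close>, so this is the Euler identity for \<open>(A(r) / r\<^sup>N) \<Theta>\<close>.\<close>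

lemma radial_weak_form:
  fixes A k :: "real \<Rightarrow> real" and a b p R :: real and \<Theta> :: "'a::euclidean_space \<Rightarrow> real"
  defines "\<Omega> \<equiv> {x::'a. a < norm x \<and> norm x < b}"
    and "V' \<equiv> \<lambda>r. spow (1 / (p - 1)) (A r / r ^ (DIM('a) - 1))"
  assumes p: "1 < p" and ab: "0 < a" "b < R"
    and A: "\<And>r. a < r \<Longrightarrow> r < b \<Longrightarrow> (A has_real_derivative - (r ^ (DIM('a) - 1) * k r)) (at r)"
    and k: "continuous_on {a<..<b} k"
    and \<Theta>: "test_function \<Omega> \<Theta>"
  shows "integrable (lebesgue_on (ball 0 R)) (\<lambda>x. pvec p ((V' (norm x) / norm x) *\<^sub>R x) \<bullet> grad \<Theta> x)"
    and "(\<integral>x. pvec p ((V' (norm x) / norm x) *\<^sub>R x) \<bullet> grad \<Theta> x \<partial>lebesgue_on (ball 0 R))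
       = (\<integral>x. k (norm x) * \<Theta> x \<partial>lebesgue_on (ball 0 R))"
proof -
  let ?N = "DIM('a)" and ?M = "lebesgue_on (ball 0 R :: 'a set)"
  note t = test_functionD[OF \<Theta>]
  have N: "Suc (?N - 1) = ?N" by simp
  have \<Omega>o: "open \<Omega>" unfolding \<Omega>_def by (intro open_Collect_conj open_Collect_less continuous_intros)
  have \<Omega>B: "\<Omega> \<subseteq> ball 0 R" using ab by (auto simp: \<Omega>_def)
  have z: "\<Theta> x = 0" "grad \<Theta> x = 0" if "x \<notin> \<Omega>" for x
    using grad_eq_0_outside[of x \<Theta>] t(3) that by auto
  define a0 where "a0 r = A r / r ^ ?N" for r
  define a1 where "a1 r = - k r / r - real ?N * A r / r ^ Suc ?N" for r
  have a0d: "(a0 has_real_derivative a1 r) (at r)" if "a < r" "r < b" for r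
  proof -
    have r: "r > 0" using that ab by simp
    have "((\<lambda>r. A r / r ^ ?N) has_real_derivative
        (- (r ^ (?N - 1) * k r) * r ^ ?N - A r * (real ?N * r ^ (?N - 1))) / (r ^ ?N * r ^ ?N)) (at r)"
      using A[OF that] r by (auto intro!: derivative_eq_intros)
    also have "(- (r ^ (?N - 1) * k r) * r ^ ?N - A r * (real ?N * r ^ (?N - 1))) / (r ^ ?N * r ^ ?N) = a1 r"
      using r power_Suc[of r "?N - 1"] unfolding N a1_def by (simp add: field_simps)
    finally show ?thesis unfolding a0_def[abs_def] .
  qed
  have Ac: "continuous_on {a<..<b} A" using A by (intro continuous_at_imp_continuous_on ballI) (auto intro: DERIV_isCont)
  have a0c: "continuous_on {a<..<b} a0" "continuous_on {a<..<b} a1"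
    unfolding a0_def[abs_def] a1_def[abs_def] using ab by (auto intro!: continuous_intros Ac k)
  have nc: "continuous_on \<Omega> norm" "norm ` \<Omega> \<subseteq> {a<..<b}" by (auto simp: \<Omega>_def intro: continuous_intros)
  define g where "g x = a0 (norm x) * \<Theta> x" for x
  define Dg where "Dg x = a0 (norm x) *\<^sub>R grad \<Theta> x + (\<Theta> x * a1 (norm x) / norm x) *\<^sub>R x" for x
  have pv: "pvec p ((V' (norm x) / norm x) *\<^sub>R x) = a0 (norm x) *\<^sub>R x" if "x \<in> \<Omega>" for x
  proof -
    have nx: "norm x > 0" using that ab by (auto simp: \<Omega>_def)
    have "pvec p ((V' (norm x) / norm x) *\<^sub>R x) = (\<bar>V' (norm x)\<bar> powr (p - 2) * V' (norm x) / norm x) *\<^sub>R x"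
      using nx by (auto simp: pvec_def)
    also have "\<bar>V' (norm x)\<bar> powr (p - 2) * V' (norm x) = A (norm x) / norm x ^ (?N - 1)"
      unfolding powr_mult_eq_spow V'_def spow_spow using p by simp
    also have "A (norm x) / norm x ^ (?N - 1) / norm x = a0 (norm x)"
      using nx power_Suc[of "norm x" "?N - 1"] unfolding N a0_def by (simp add: mult.commute)
    finally show ?thesis .
  qed
  have gd: "(g has_derivative (\<lambda>h. Dg x \<bullet> h)) (at x)" if x: "x \<in> \<Omega>" for x
  proof -
    have nx: "x \<noteq> 0" "a < norm x" "norm x < b" using x ab by (auto simp: \<Omega>_def)
    have "(norm has_derivative (\<lambda>h. (1 / norm x) * (x \<bullet> h))) (at x)"
      using has_derivative_norm[OF nx(1)] by (simp add: sgn_div_norm inner_commute divide_inverse)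
    from has_derivative_mult[OF DERIV_compose_FDERIV[OF a0d[OF nx(2,3)] this] t(4)]
    show ?thesis unfolding g_def[abs_def]
      by (rule has_derivative_eq_rhs) (auto simp: Dg_def inner_add_left field_simps)
  qed
  have Dgc: "continuous_on \<Omega> Dg"
    unfolding Dg_def[abs_def] using ab
    by (intro continuous_intros continuous_on_compose2[OF a0c(1) nc] continuous_on_compose2[OF a0c(2) nc] t)
      (auto simp: \<Omega>_def)
  have K: "compact (closure {x. \<Theta> x \<noteq> 0})" by (rule t)
  have z1: "g x = 0" if "x \<notin> closure {x. \<Theta> x \<noteq> 0}" for x
    unfolding g_def grad_eq_0_outside(1)[OF that] by simp
  have z2: "Dg x = 0" if "x \<notin> \<Omega>" for x
    unfolding Dg_def z[OF that] by simp
  have Bm: "ball 0 R \<in> sets (lebesgue :: 'a measure)" by simp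
  have E: "integrable ?M (\<lambda>x. real ?N * g x + Dg x \<bullet> x)" "(\<integral>x. real ?N * g x + Dg x \<bullet> x \<partial>?M) = 0"
    by (rule euler_identity_on[OF \<Omega>o \<Omega>B Bm K t(3) gd Dgc z1 z2]; assumption)+
  have eq: "real ?N * g x + Dg x \<bullet> x = pvec p ((V' (norm x) / norm x) *\<^sub>R x) \<bullet> grad \<Theta> x - k (norm x) * \<Theta> x" for x
  proof (cases "x \<in> \<Omega>")
    case True
    have nx: "norm x > 0" using True ab by (auto simp: \<Omega>_def)
    have "real ?N * a0 (norm x) + a1 (norm x) * norm x = - k (norm x)"
      using nx by (simp add: a0_def a1_def field_simps)
    then have e: "(real ?N * a0 (norm x) + a1 (norm x) * norm x) * \<Theta> x = - k (norm x) * \<Theta> x" by simp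
    have "Dg x \<bullet> x = a0 (norm x) * (x \<bullet> grad \<Theta> x) + \<Theta> x * a1 (norm x) * norm x"
      using nx unfolding Dg_def inner_add_left inner_scaleR_left dot_square_norm power2_eq_square
      by (simp add: inner_commute[of "grad \<Theta> x" x])
    moreover have "real ?N * (a0 (norm x) * \<Theta> x) + \<Theta> x * a1 (norm x) * norm x = - (k (norm x) * \<Theta> x)"
      using e by (simp add: algebra_simps)
    ultimately have "real ?N * g x + Dg x \<bullet> x = a0 (norm x) * (x \<bullet> grad \<Theta> x) - k (norm x) * \<Theta> x"
      unfolding g_def by linarith
    then show ?thesis by (simp add: pv[OF True])
  qed (simp add: g_def Dg_def z)
  have ki: "integrable ?M (\<lambda>x. k (norm x) * \<Theta> x)"
    by (rule integrable_continuous_times_test[OF \<Omega>o \<Omega>B _ _ _ \<Theta>])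
      (auto intro!: continuous_on_compose2[OF k nc])
  have "integrable ?M (\<lambda>x. (real ?N * g x + Dg x \<bullet> x) + k (norm x) * \<Theta> x)"
    using E(1) ki by (rule Bochner_Integration.integrable_add)
  then show "integrable ?M (\<lambda>x. pvec p ((V' (norm x) / norm x) *\<^sub>R x) \<bullet> grad \<Theta> x)" unfolding eq by simp
  have "(\<integral>x. (real ?N * g x + Dg x \<bullet> x) + k (norm x) * \<Theta> x \<partial>?M)
      = (\<integral>x. k (norm x) * \<Theta> x \<partial>?M)"
    using Bochner_Integration.integral_add[OF E(1) ki] E(2) by simp
  then show "(\<integral>x. pvec p ((V' (norm x) / norm x) *\<^sub>R x) \<bullet> grad \<Theta> x \<partial>?M)
       = (\<integral>x. k (norm x) * \<Theta> x \<partial>?M)" unfolding eq by simp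
qed

lemma test_function_mono: "test_function A \<phi> \<Longrightarrow> A \<subseteq> B \<Longrightarrow> test_function B \<phi>"
  unfolding test_function_def by blast

text \<open>For test functions that vanish near the origin every term of the weak equation is integrable on its own,
  so the two integrals can be rearranged.\<close>

lemma weak_solution_away_from_origin:
  fixes u :: "'a::euclidean_space \<Rightarrow> real" and R :: real
  defines "\<Omega> \<equiv> ball 0 R - {0 :: 'a}"
  assumes p: "1 < p"
    and G: "G \<in> borel_measurable (lebesgue_on (ball 0 R))"
    and H: "H \<in> borel_measurable (lebesgue_on (ball 0 R))" "\<And>x. 1 \<le> H x"
      "integrable (lebesgue_on (ball 0 R)) (\<lambda>x. H x powr p)"
    and GH: "AE x in lebesgue_on (ball 0 R). norm (G x) \<le> H x"
    and u: "continuous_on \<Omega> u" "\<And>x. x \<in> \<Omega> \<Longrightarrow> 0 < u x"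
    and weak: "\<And>\<phi>. test_function (ball 0 R) \<phi> \<Longrightarrow>
         (\<integral>x. norm (G x) powr (p - 2) * (G x \<bullet> grad \<phi> x)
               - \<mu> / norm x powr p * (\<bar>u x\<bar> powr (p - 2) * u x) * \<phi> x
               - lam * (\<bar>u x\<bar> powr (p - 2) * u x) * \<phi> x \<partial>(lebesgue_on (ball 0 R)))
         = (\<integral>x. \<bar>u x\<bar> powr (P - 2) * u x / norm x powr s * \<phi> x
               \<partial>(lebesgue_on (ball 0 R)))"
    and \<Theta>: "test_function \<Omega> \<Theta>"
  shows "integrable (lebesgue_on (ball 0 R)) (\<lambda>x. pvec p (G x) \<bullet> grad \<Theta> x)"
    and "(\<integral>x. pvec p (G x) \<bullet> grad \<Theta> x \<partial>lebesgue_on (ball 0 R))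
       = (\<integral>x. ((\<mu> / norm x powr p + lam) * u x powr (p - 1) + u x powr (P - 1) / norm x powr s) * \<Theta> x
            \<partial>lebesgue_on (ball 0 R))"
proof -
  let ?M = "lebesgue_on (ball 0 R :: 'a set)"
  define f1 where "f1 x = (\<mu> / norm x powr p + lam) * u x powr (p - 1)" for x
  define f2 where "f2 x = u x powr (P - 1) / norm x powr s" for x
  have \<Omega>o: "open \<Omega>" unfolding \<Omega>_def by auto
  have \<Omega>B: "\<Omega> \<subseteq> ball 0 R" by (auto simp: \<Omega>_def)
  have upos: "u x \<noteq> 0" "x \<noteq> 0" if "x \<in> \<Omega>" for x using u(2)[OF that] that by (auto simp: \<Omega>_def)
  have c: "continuous_on \<Omega> f1" "continuous_on \<Omega> f2"
    unfolding f1_def f2_def by (intro continuous_intros u; use upos in auto)+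
  note i = integrable_continuous_times_test[OF \<Omega>o \<Omega>B open_ball bounded_ball _ \<Theta>]
  note i1 = i[OF c(1)] and i2 = i[OF c(2)]
  obtain M where M: "\<And>x. norm (grad \<Theta> x) \<le> M" "M \<ge> 0"
    using test_function_bounded[OF \<Theta>] by metis
  have [measurable]: "grad \<Theta> \<in> borel_measurable ?M"
    by (intro continuous_imp_measurable_on_sets_lebesgue test_functionD(5)[OF \<Theta>]) auto
  note [measurable] = G
  show i0: "integrable ?M (\<lambda>x. pvec p (G x) \<bullet> grad \<Theta> x)"
  proof (rule Bochner_Integration.integrable_bound)
    show "integrable ?M (\<lambda>x. M * H x powr p)" using H(3) by (rule integrable_mult_right)
    show "AE x in ?M. norm (pvec p (G x) \<bullet> grad \<Theta> x) \<le> norm (M * H x powr p)"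
      using GH
    proof eventually_elim
      case (elim x)
      have "norm (pvec p (G x) \<bullet> grad \<Theta> x) \<le> norm (G x) powr (p - 1) * norm (grad \<Theta> x)"
        using Cauchy_Schwarz_ineq2[of "pvec p (G x)" "grad \<Theta> x"] by (simp add: norm_pvec)
      also have "\<dots> \<le> H x powr (p - 1) * M"
        using elim M p by (intro mult_mono powr_mono2) auto
      also have "\<dots> \<le> H x powr p * M"
        using H(2)[of x] M(2) by (intro mult_right_mono powr_mono) auto
      finally show ?case using M(2) by (simp add: mult.commute)
    qed
  qed measurable
  have z: "\<Theta> x = 0" if "x \<notin> \<Omega>" for x
    using grad_eq_0_outside(1)[of x \<Theta>] test_functionD(3)[OF \<Theta>] that by blast
  have pw: "\<bar>u x\<bar> powr (e - 2) * u x = u x powr (e - 1)" if "x \<in> \<Omega>" for e x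
    using powr_minus_2_mult[of "u x" e] u(2)[OF that] by simp
  have e1: "norm (G x) powr (p - 2) * (G x \<bullet> grad \<Theta> x)
               - \<mu> / norm x powr p * (\<bar>u x\<bar> powr (p - 2) * u x) * \<Theta> x
               - lam * (\<bar>u x\<bar> powr (p - 2) * u x) * \<Theta> x
     = pvec p (G x) \<bullet> grad \<Theta> x - f1 x * \<Theta> x" for x
  proof (cases "x \<in> \<Omega>")
    case True
    show ?thesis unfolding pw[OF True] pvec_def f1_def by (simp add: algebra_simps)
  next
    case False
    show ?thesis unfolding z[OF False] by (simp add: pvec_def)
  qed
  have e2: "\<bar>u x\<bar> powr (P - 2) * u x / norm x powr s * \<Theta> x = f2 x * \<Theta> x" for x
  proof (cases "x \<in> \<Omega>")
    case True
    show ?thesis unfolding pw[OF True] f2_def ..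
  next
    case False
    show ?thesis unfolding z[OF False] by simp
  qed
  have "(\<integral>x. pvec p (G x) \<bullet> grad \<Theta> x - f1 x * \<Theta> x \<partial>?M) = (\<integral>x. f2 x * \<Theta> x \<partial>?M)"
    using weak[OF test_function_mono[OF \<Theta> \<Omega>B]] unfolding e1 e2 .
  moreover have "(\<integral>x. pvec p (G x) \<bullet> grad \<Theta> x - f1 x * \<Theta> x \<partial>?M)
      = (\<integral>x. pvec p (G x) \<bullet> grad \<Theta> x \<partial>?M) - (\<integral>x. f1 x * \<Theta> x \<partial>?M)"
    by (rule Bochner_Integration.integral_diff[OF i0 i1])
  moreover have "(\<integral>x. (f1 x + f2 x) * \<Theta> x \<partial>?M) = (\<integral>x. f1 x * \<Theta> x \<partial>?M) + (\<integral>x. f2 x * \<Theta> x \<partial>?M)"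
    unfolding distrib_right by (rule Bochner_Integration.integral_add[OF i1 i2])
  ultimately show "(\<integral>x. pvec p (G x) \<bullet> grad \<Theta> x \<partial>?M)
       = (\<integral>x. ((\<mu> / norm x powr p + lam) * u x powr (p - 1) + u x powr (P - 1) / norm x powr s) * \<Theta> x \<partial>?M)"
    unfolding f1_def f2_def by linarith
qed

text \<open>The function \<open>A\<close> is \<open>r\<^sup>N\<^sup>-\<^sup>1 \<bar>U'\<bar>\<^sup>p\<^sup>-\<^sup>2 U'\<close>. On each compact subinterval \<open>U\<close> coincides with the solution of the
  radial Dirichlet problem, by the comparison with both signs.\<close>

lemma radial_solution_ode:
  fixes u :: "'a::euclidean_space \<Rightarrow> real" and e :: 'a
  defines "U \<equiv> \<lambda>r. u (r *\<^sub>R e)"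
  assumes p: "1 < p" and e: "norm e = 1"
    and sol: "weak_solution p s \<mu> lam (ball 0 R) u"
    and uc: "continuous_on (ball 0 R - {0}) u"
    and rad: "radial_on (ball 0 R - {0}) u"
    and pos: "\<And>x. x \<in> ball 0 R - {0} \<Longrightarrow> u x > 0"
  obtains A where
    "\<And>r. 0 < r \<Longrightarrow> r < R \<Longrightarrow> (U has_real_derivative spow (1 / (p - 1)) (A r / r ^ (DIM('a) - 1))) (at r)"
    "\<And>r. 0 < r \<Longrightarrow> r < R \<Longrightarrow> (A has_real_derivative
       - (r ^ (DIM('a) - 1) * ((\<mu> / r powr p + lam) * U r powr (p - 1)
          + U r powr (crit_exp DIM('a) p s - 1) / r powr s))) (at r)"
proof -
  let ?M = "lebesgue_on (ball 0 R :: 'a set)" and ?n = "DIM('a) - 1"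
  define P where "P = crit_exp DIM('a) p s"
  define k where "k r = (\<mu> / r powr p + lam) * U r powr (p - 1) + U r powr (P - 1) / r powr s" for r
  obtain G where W: "W0_gradient p (ball 0 R) u G"
    and weak: "\<And>\<phi>. test_function (ball 0 R) \<phi> \<Longrightarrow>
         (\<integral>x. norm (G x) powr (p - 2) * (G x \<bullet> grad \<phi> x)
               - \<mu> / norm x powr p * (\<bar>u x\<bar> powr (p - 2) * u x) * \<phi> x
               - lam * (\<bar>u x\<bar> powr (p - 2) * u x) * \<phi> x \<partial>?M)
         = (\<integral>x. \<bar>u x\<bar> powr (P - 2) * u x / norm x powr s * \<phi> x \<partial>?M)"
    using sol unfolding weak_solution_def P_def by blast
  have Gm: "G \<in> borel_measurable ?M" using W by (simp add: W0_gradient_def)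
  have p1: "1 \<le> p" using p by simp
  obtain \<phi> H where \<phi>: "\<And>n. test_function (ball 0 R) (\<phi> n)"
    and H: "H \<in> borel_measurable ?M" "\<And>x. 1 \<le> H x" "integrable ?M (\<lambda>x. H x powr p)"
    and lim: "AE x in ?M. (\<lambda>n. \<phi> n x) \<longlonglongrightarrow> u x \<and> (\<lambda>n. grad (\<phi> n) x) \<longlonglongrightarrow> G x \<and>
       norm (G x) \<le> H x \<and> (\<forall>n. norm (grad (\<phi> n) x) \<le> H x)"
    by (rule W0_dominated_sequence[OF W p1 bounded_ball open_ball]) (rule that)
  have GH: "AE x in ?M. norm (G x) \<le> H x" using lim by eventually_elim auto
  have uU: "u x = U (norm x)" if "x \<in> ball 0 R - {0}" for x
  proof -
    have "norm x *\<^sub>R e \<in> ball 0 R - {0}" "norm (norm x *\<^sub>R e) = norm x"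
      using that e by auto
    then show ?thesis using rad that unfolding radial_on_def U_def by metis
  qed
  have Upos: "U r > 0" if "0 < r" "r < R" for r
  proof -
    have "e \<noteq> 0" using e by auto
    then show ?thesis using pos[of "r *\<^sub>R e"] that e by (simp add: U_def)
  qed
  have Uc: "continuous_on {0<..<R} U"
    unfolding U_def using e by (intro continuous_on_compose2[OF uc] continuous_intros) auto
  have kc: "continuous_on {0<..<R} k"
    unfolding k_def using Upos by (intro continuous_intros Uc) (auto simp: less_imp_neq[symmetric])
  have local: "\<exists>A. \<forall>r. a < r \<and> r < b \<longrightarrow>
      (U has_real_derivative spow (1 / (p - 1)) (A r / r ^ ?n)) (at r) \<and>
      (A has_real_derivative - (r ^ ?n * k r)) (at r)" if ab: "0 < a" "a < b" "b < R" for a b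
  proof -
    have kc': "continuous_on {a..b} k" by (rule continuous_on_subset[OF kc]) (use ab in auto)
    obtain A V where V: "V a = U a" "V b = U b"
      "\<And>r. r \<in> {a..b} \<Longrightarrow> (V has_real_derivative spow (1 / (p - 1)) (A r / r ^ ?n)) (at r within {a..b})"
      "\<And>r. r \<in> {a..b} \<Longrightarrow> (A has_real_derivative - (r ^ ?n * k r)) (at r within {a..b})"
      by (rule radial_dirichlet_problem[OF p ab(1,2) kc', where \<alpha> = "U a" and \<beta> = "U b" and n = ?n]) (rule that)
    define V' where "V' r = spow (1 / (p - 1)) (A r / r ^ ?n)" for r
    define Vg where "Vg x = (V' (norm x) / norm x) *\<^sub>R x" for x :: 'a
    let ?\<Omega> = "{x::'a. a < norm x \<and> norm x < b}"
    have at: "at r within {a..b} = at r" if "a < r" "r < b" for r :: real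
      using that by (intro at_within_interior) auto
    have Ad: "(A has_real_derivative - (r ^ ?n * k r)) (at r)"
      and Vd: "(V has_real_derivative V' r) (at r)" if "a < r" "r < b" for r
      using V(3,4)[of r] that at[OF that] by (auto simp: V'_def)
    have Ac: "continuous_on {a..b} A" by (rule DERIV_continuous_on[OF V(4)])
    have V'c: "continuous_on {a..b} V'"
      unfolding V'_def using p ab by (intro continuous_on_spow continuous_intros Ac) auto
    have weak0: "(\<integral>x. (pvec p (G x) - pvec p (Vg x)) \<bullet> grad \<Theta> x \<partial>?M) = 0"
      if \<Theta>: "test_function ?\<Omega> \<Theta>" for \<Theta>
    proof -
      have sub: "?\<Omega> \<subseteq> ball 0 R - {0}" using ab by auto
      note w = weak_solution_away_from_origin[OF p Gm H GH uc pos weak test_function_mono[OF \<Theta> sub]]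
      have z: "\<Theta> x = 0" if "x \<notin> ?\<Omega>" for x
        using grad_eq_0_outside(1)[of x \<Theta>] test_functionD(3)[OF \<Theta>] that by blast
      have kk: "((\<mu> / norm x powr p + lam) * u x powr (p - 1) + u x powr (P - 1) / norm x powr s) * \<Theta> x
          = k (norm x) * \<Theta> x" for x
      proof (cases "x \<in> ?\<Omega>")
        case True
        then have "x \<in> ball 0 R - {0}" using sub by blast
        then show ?thesis by (simp add: k_def uU)
      next
        case False
        show ?thesis unfolding z[OF False] by simp
      qed
      note v = radial_weak_form[OF p ab(1,3) Ad continuous_on_subset[OF kc'] \<Theta>, folded V'_def Vg_def]
      have v': "integrable ?M (\<lambda>x. pvec p (Vg x) \<bullet> grad \<Theta> x)"
        "(\<integral>x. pvec p (Vg x) \<bullet> grad \<Theta> x \<partial>?M) = (\<integral>x. k (norm x) * \<Theta> x \<partial>?M)"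
        using v by (auto simp: subset_iff)
      show ?thesis
        using w v' unfolding inner_diff_left kk by (subst Bochner_Integration.integral_diff) auto
    qed
    have Vder: "(V has_real_derivative V' r) (at r within {a..b})" if "r \<in> {a..b}" for r
      using V(3)[OF that] by (simp add: V'_def)
    have bd: "u x = V a" if "norm x = a" for x :: 'a
      using uU[of x] that ab V(1) by (cases "x = 0") auto
    have bd': "u x = V b" if "norm x = b" for x :: 'a
      using uU[of x] that ab V(2) by (cases "x = 0") auto
    have cmp: "\<sigma> * (U r - V r) \<le> \<epsilon>"
      if "a < r" "r < b" "\<sigma> = 1 \<or> \<sigma> = - 1" "\<epsilon> > 0" for r \<sigma> \<epsilon>
    proof -
      have n: "norm (r *\<^sub>R e) = r" using that ab e by simp
      have "\<sigma> * (u (r *\<^sub>R e) - V (norm (r *\<^sub>R e))) \<le> \<epsilon>"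
        by (rule annulus_one_sided_comparison[OF p ab \<phi> Gm H lim uc Vder V'c bd bd' weak0[unfolded Vg_def] that(3,4)])
          (use n that in auto)
      then show ?thesis by (simp only: n U_def)
    qed
    have UV: "U r = V r" if "a < r" "r < b" for r
    proof (rule antisym; rule field_le_epsilon)
      fix d :: real assume d: "0 < d"
      show "U r \<le> V r + d" using cmp[OF that, where \<sigma> = 1 and \<epsilon> = d] d by simp
      show "V r \<le> U r + d" using cmp[OF that, where \<sigma> = "- 1" and \<epsilon> = d] d by simp
    qed
    have "(U has_real_derivative V' r) (at r)" if "a < r" "r < b" for r
      by (rule has_field_derivative_transform_within_open[OF Vd[OF that], of "{a<..<b}"])
        (use that UV in auto)
    then show ?thesis using Ad by (intro exI[of _ A]) (auto simp: V'_def)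
  qed
  \<comment> \<open>The functions obtained on the subintervals agree with this expression, hence with each other.\<close>
  define A where "A r = r ^ ?n * spow (p - 1) (deriv U r)" for r
  show ?thesis
  proof (rule that[of A])
    fix r assume r: "0 < r" "r < R"
    define a b where "a = r / 2" and "b = (r + R) / 2"
    have ab: "0 < a" "a < r" "r < b" "a < b" "b < R" using r by (auto simp: a_def b_def)
    obtain A' where A': "\<And>\<rho>. a < \<rho> \<Longrightarrow> \<rho> < b \<Longrightarrow>
       (U has_real_derivative spow (1 / (p - 1)) (A' \<rho> / \<rho> ^ ?n)) (at \<rho>)"
       "\<And>\<rho>. a < \<rho> \<Longrightarrow> \<rho> < b \<Longrightarrow> (A' has_real_derivative - (\<rho> ^ ?n * k \<rho>)) (at \<rho>)"
      using local[OF ab(1,4,5)] by blast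
    have AA: "A \<rho> = A' \<rho>" if "a < \<rho>" "\<rho> < b" for \<rho>
    proof -
      have "\<rho> > 0" using that ab by simp
      then show ?thesis using p
        by (simp add: A_def DERIV_imp_deriv[OF A'(1)[OF that]] spow_spow)
    qed
    show "(U has_real_derivative spow (1 / (p - 1)) (A r / r ^ (DIM('a) - 1))) (at r)"
      using A'(1)[OF ab(2,3)] AA[OF ab(2,3)] by simp
    have "(A has_real_derivative - (r ^ ?n * k r)) (at r)"
      by (rule has_field_derivative_transform_within_open[OF A'(2)[OF ab(2,3)], of "{a<..<b}"])
        (use ab AA in auto)
    then show "(A has_real_derivative - (r ^ (DIM('a) - 1) * ((\<mu> / r powr p + lam) * U r powr (p - 1)
          + U r powr (crit_exp DIM('a) p s - 1) / r powr s))) (at r)"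
      by (simp add: k_def P_def)
  qed
qed

section \<open>Hardy inequality and decay on shells\<close>

lemma young_absorb:
  fixes x y c p :: real
  assumes "1 < p" "0 < c" "0 \<le> x" "0 \<le> y"
  shows "p * x powr (p - 1) * y \<le> c * x powr p + p * (p / c) powr (p - 1) * y powr p"
proof (cases "y \<le> c / p * x")
  case True
  have "p * x powr (p - 1) * y \<le> p * x powr (p - 1) * (c / p * x)"
    using True assms by (intro mult_left_mono) auto
  also have "\<dots> = c * x powr p"
    using assms powr_mult_base[of x "p - 1"] by (simp add: mult_ac)
  finally show ?thesis using assms by (smt (verit) mult_nonneg_nonneg powr_ge_zero)
next
  case False
  then have "x \<le> p / c * y" using assms by (simp add: field_simps)
  then have "x powr (p - 1) \<le> (p / c * y) powr (p - 1)" using assms by (intro powr_mono2) auto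
  then have "p * x powr (p - 1) * y \<le> p * (p / c * y) powr (p - 1) * y"
    using assms by (intro mult_right_mono mult_left_mono) auto
  also have "(p / c * y) powr (p - 1) = (p / c) powr (p - 1) * y powr (p - 1)"
    by (rule powr_mult)
  also have "p * ((p / c) powr (p - 1) * y powr (p - 1)) * y = p * (p / c) powr (p - 1) * y powr p"
    using assms powr_mult_base[of y "p - 1"] by (simp add: mult_ac)
  finally show ?thesis using assms by (smt (verit) mult_nonneg_nonneg powr_ge_zero)
qed

text \<open>The Euler identity for \<open>(\<bar>x\<bar>\<^sup>2 + \<epsilon>)\<^sup>-\<^sup>p\<^sup>/\<^sup>2 \<bar>\<phi>\<bar>\<^sup>p\<close>. The regularization removes the singularity at the origin
  and costs nothing: \<open>x \<bullet> \<nabla>\<close> of the weight is at least \<open>- p\<close> times the weight, as for \<open>\<bar>x\<bar>\<^sup>-\<^sup>p\<close>, and the constant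
  \<open>C\<close> does not depend on \<open>\<epsilon>\<close>.\<close>

lemma hardy_inequality_regularized:
  fixes \<phi> :: "'a::euclidean_space \<Rightarrow> real"
  assumes p: "1 < p" "p < real DIM('a)" and \<phi>: "test_function (ball 0 R) \<phi>" and \<epsilon>: "0 < \<epsilon>"
  defines "C \<equiv> 2 / (real DIM('a) - p) * (p * (p / ((real DIM('a) - p) / 2)) powr (p - 1))"
  shows "integrable (lebesgue_on (ball 0 R)) (\<lambda>x. (x \<bullet> x + \<epsilon>) powr (- p / 2) * \<bar>\<phi> x\<bar> powr p)" (is ?A)
    and "integrable (lebesgue_on (ball 0 R)) (\<lambda>x. norm (grad \<phi> x) powr p)" (is ?B)
    and "(\<integral>x. (x \<bullet> x + \<epsilon>) powr (- p / 2) * \<bar>\<phi> x\<bar> powr p \<partial>lebesgue_on (ball 0 R))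
      \<le> C * (\<integral>x. norm (grad \<phi> x) powr p \<partial>lebesgue_on (ball 0 R))" (is ?C)
proof -
  let ?N = "DIM('a)" and ?M = "lebesgue_on (ball 0 R :: 'a set)" and ?K = "closure {x. \<phi> x \<noteq> 0}"
  note t = test_functionD[OF \<phi>]
  \<comment> \<open>Half of the coefficient \<open>N - p\<close> is used to absorb the mixed term.\<close>
  define c where "c = (real ?N - p) / 2"
  have c: "c > 0" using p by (simp add: c_def)
  define W where "W x = x \<bullet> x + \<epsilon>" for x :: 'a
  have W0: "W x > 0" for x using \<epsilon> by (simp add: W_def add_nonneg_pos)
  define g where "g x = W x powr (- p / 2) * \<bar>\<phi> x\<bar> powr p" for x
  define Dg where "Dg x = (W x powr (- p / 2) * (p * spow (p - 1) (\<phi> x))) *\<^sub>R grad \<phi> x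
      + (\<bar>\<phi> x\<bar> powr p * (- p * W x powr (- p / 2 - 1))) *\<^sub>R x" for x
  have gd: "(g has_derivative (\<lambda>h. Dg x \<bullet> h)) (at x)" for x
  proof -
    have "(W has_derivative (\<lambda>h. 2 * (x \<bullet> h))) (at x)"
      unfolding W_def[abs_def] by (auto intro!: derivative_eq_intros simp: inner_commute)
    from DERIV_compose_FDERIV[OF has_real_derivative_powr[where r = "- p / 2", OF W0] this]
    have d1: "((\<lambda>x. W x powr (- p / 2)) has_derivative (\<lambda>h. 2 * (x \<bullet> h) * (- p / 2 * W x powr (- p / 2 - 1)))) (at x)" .
    from has_derivative_mult[OF d1 DERIV_compose_FDERIV[OF has_derivative_abs_powr[OF p(1)] t(4)]]
    show ?thesis unfolding g_def[abs_def]
      by (rule has_derivative_eq_rhs) (auto simp: Dg_def inner_add_left algebra_simps)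
  qed
  have Wc: "continuous_on S (\<lambda>x. W x powr e)" for e S
    using W0 unfolding W_def by (intro continuous_intros) (auto simp: less_imp_neq[symmetric])
  have ac: "continuous_on S (\<lambda>x. \<bar>\<phi> x\<bar> powr p)" for S
    using p by (intro continuous_on_powr' continuous_intros t) auto
  have sc: "continuous_on S (\<lambda>x. spow (p - 1) (\<phi> x))" for S
    using p by (intro continuous_on_spow t) auto
  have Dgc: "continuous_on S Dg" for S
    unfolding Dg_def[abs_def] by (intro continuous_intros Wc ac sc t)
  have out: "\<phi> x = 0" "grad \<phi> x = 0" if "x \<notin> ?K" for x
    by (rule grad_eq_0_outside[OF that])+
  have g0: "g x = 0" if "x \<notin> ?K" for x unfolding g_def out[OF that] by simp
  have Dg0: "Dg x = 0" if "x \<notin> ball 0 R" for x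
  proof -
    have "x \<notin> ?K" using that t(3) by blast
    then show ?thesis unfolding Dg_def out[OF \<open>x \<notin> ?K\<close>] by simp
  qed
  have Bm: "ball 0 R \<in> sets (lebesgue :: 'a measure)" by simp
  have E: "integrable ?M (\<lambda>x. real ?N * g x + Dg x \<bullet> x)"
    "(\<integral>x. real ?N * g x + Dg x \<bullet> x \<partial>?M) = 0"
    by (rule euler_identity_on[OF open_ball subset_refl Bm t(2,3) gd Dgc g0 Dg0]; assumption)+
  have fin: "emeasure ?M (space ?M) < \<infinity>"
    using emeasure_bounded_finite[OF bounded_ball, of "0::'a" R]
    by (simp add: emeasure_restrict_space main_part_sets)
  obtain M where M: "\<And>x. norm (grad \<phi> x) \<le> M" "\<And>x. \<bar>\<phi> x\<bar> \<le> M" "M \<ge> 0"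
    using test_function_bounded[OF \<phi>] by metis
  have bi: "integrable ?M f" if "continuous_on UNIV f" "\<And>x. \<bar>f x\<bar> \<le> c" for f :: "'a \<Rightarrow> real" and c
  proof (rule Bochner_Integration.integrable_bound)
    show "integrable ?M (\<lambda>x. c)" using fin by (auto intro!: finite_measure.integrable_const finite_measureI)
    show "f \<in> borel_measurable ?M"
      using that(1) by (intro continuous_imp_measurable_on_sets_lebesgue) (auto intro: continuous_on_subset)
    show "AE x in ?M. norm (f x) \<le> norm c" using that(2) by (auto intro: order_trans[OF _ abs_ge_self])
  qed
  have gi: "integrable ?M g"
  proof (rule bi)
    show "continuous_on UNIV g" unfolding g_def[abs_def] by (intro continuous_intros Wc ac)
    have "W x powr (- p / 2) \<le> \<epsilon> powr (- p / 2)" for x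
      using \<epsilon> p by (intro powr_mono2') (auto simp: W_def)
    moreover have "\<bar>\<phi> x\<bar> powr p \<le> M powr p" for x
      by (rule powr_mono2) (use M p in auto)
    ultimately have "W x powr (- p / 2) * \<bar>\<phi> x\<bar> powr p \<le> \<epsilon> powr (- p / 2) * M powr p" for x
      by (intro mult_mono) auto
    then show "\<bar>g x\<bar> \<le> \<epsilon> powr (- p / 2) * M powr p" for x
      by (simp add: g_def abs_mult)
  qed
  then show ?A unfolding g_def[abs_def] W_def .
  have ni: "integrable ?M (\<lambda>x. norm (grad \<phi> x) powr p)"
  proof (rule bi)
    show "continuous_on UNIV (\<lambda>x. norm (grad \<phi> x) powr p)"
      using p by (intro continuous_on_powr' continuous_intros t) auto
    show "\<bar>norm (grad \<phi> x) powr p\<bar> \<le> M powr p" for x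
      using M p by (auto intro!: powr_mono2)
  qed
  then show ?B .
  have pw: "c * g x - p * (p / c) powr (p - 1) * norm (grad \<phi> x) powr p \<le> real ?N * g x + Dg x \<bullet> x" for x
  proof -
    define \<rho> where "\<rho> = sqrt (W x)"
    have \<rho>: "\<rho> > 0" "W x = \<rho>\<^sup>2" "norm x \<le> \<rho>"
      using W0[of x] \<epsilon> by (auto simp: \<rho>_def W_def norm_eq_sqrt_inner less_imp_le)
    have Wp: "W x powr e = \<rho> powr (2 * e)" for e
      using \<rho>(1) powr_powr[of \<rho> 2 e] by (simp add: \<rho>(2))
    have g\<rho>: "g x = (\<bar>\<phi> x\<bar> / \<rho>) powr p"
      using \<rho>(1) by (simp add: g_def Wp powr_divide powr_minus field_simps)
    have t1: "\<bar>\<phi> x\<bar> powr p * (- p * W x powr (- p / 2 - 1)) * (x \<bullet> x) \<ge> - p * g x"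
    proof -
      have "W x powr (- p / 2 - 1) * (x \<bullet> x) \<le> W x powr (- p / 2 - 1) * W x"
        using \<epsilon> by (intro mult_left_mono) (auto simp: W_def)
      also have "\<dots> = W x powr (- p / 2)"
        using W0[of x] powr_mult_base[of "W x" "- p / 2 - 1"] by (simp add: mult.commute)
      finally have "p * \<bar>\<phi> x\<bar> powr p * (W x powr (- p / 2 - 1) * (x \<bullet> x)) \<le> p * \<bar>\<phi> x\<bar> powr p * W x powr (- p / 2)"
        using p by (intro mult_left_mono) auto
      then show ?thesis by (simp add: g_def mult_ac)
    qed
    have t2: "\<bar>W x powr (- p / 2) * (p * spow (p - 1) (\<phi> x)) * (grad \<phi> x \<bullet> x)\<bar>
        \<le> p * (\<bar>\<phi> x\<bar> / \<rho>) powr (p - 1) * norm (grad \<phi> x)"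
    proof -
      have "\<bar>W x powr (- p / 2) * (p * spow (p - 1) (\<phi> x)) * (grad \<phi> x \<bullet> x)\<bar>
          \<le> \<rho> powr (- p) * (p * \<bar>\<phi> x\<bar> powr (p - 1)) * (norm (grad \<phi> x) * \<rho>)"
        unfolding abs_mult abs_spow Wp using p \<rho>
        by (intro mult_mono order_trans[OF Cauchy_Schwarz_ineq2]) auto
      also have "\<dots> = p * (\<rho> powr (- p) * \<rho> * \<bar>\<phi> x\<bar> powr (p - 1)) * norm (grad \<phi> x)"
        by (simp add: mult_ac)
      also have "\<rho> powr (- p) * \<rho> = \<rho> powr (- (p - 1))"
        using powr_mult_base[of \<rho> "- p"] \<rho>(1) by (simp add: mult.commute)
      also have "\<rho> powr (- (p - 1)) * \<bar>\<phi> x\<bar> powr (p - 1) = (\<bar>\<phi> x\<bar> / \<rho>) powr (p - 1)"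
        using \<rho>(1) by (simp only: powr_minus) (simp add: powr_divide field_simps)
      finally show ?thesis .
    qed
    have y: "p * (\<bar>\<phi> x\<bar> / \<rho>) powr (p - 1) * norm (grad \<phi> x)
        \<le> c * g x + p * (p / c) powr (p - 1) * norm (grad \<phi> x) powr p"
      unfolding g\<rho> using young_absorb[OF p(1) c] \<rho>(1) by simp
    have "Dg x \<bullet> x = W x powr (- p / 2) * (p * spow (p - 1) (\<phi> x)) * (grad \<phi> x \<bullet> x)
        + \<bar>\<phi> x\<bar> powr p * (- p * W x powr (- p / 2 - 1)) * (x \<bullet> x)"
      unfolding Dg_def inner_add_left inner_scaleR_left by (rule refl)
    moreover have "real ?N * g x = 2 * (c * g x) + p * g x" by (simp add: c_def field_simps)
    ultimately show ?thesis using t1 t2 y by linarith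
  qed
  have i2: "integrable ?M (\<lambda>x. p * (p / c) powr (p - 1) * norm (grad \<phi> x) powr p)"
    using ni by (rule integrable_mult_right)
  have i1: "integrable ?M (\<lambda>x. c * g x)" using gi by (rule integrable_mult_right)
  have "(\<integral>x. c * g x - p * (p / c) powr (p - 1) * norm (grad \<phi> x) powr p \<partial>?M)
      \<le> (\<integral>x. real ?N * g x + Dg x \<bullet> x \<partial>?M)"
    by (rule integral_mono[OF Bochner_Integration.integrable_diff[OF i1 i2] E(1) pw])
  then have "(\<integral>x. c * g x \<partial>?M) - (\<integral>x. p * (p / c) powr (p - 1) * norm (grad \<phi> x) powr p \<partial>?M) \<le> 0"
    unfolding E(2) Bochner_Integration.integral_diff[OF i1 i2] .
  then have "c * (\<integral>x. g x \<partial>?M) \<le> p * (p / c) powr (p - 1) * (\<integral>x. norm (grad \<phi> x) powr p \<partial>?M)"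
    by simp
  then have "(\<integral>x. g x \<partial>?M) \<le> C * (\<integral>x. norm (grad \<phi> x) powr p \<partial>?M)"
    using c by (simp add: C_def c_def field_simps)
  then show ?C unfolding g_def[abs_def] W_def .
qed

text \<open>Fatou's lemma along the approximating test functions, with the regularization tending to zero.\<close>

lemma hardy_finite:
  fixes u :: "'a::euclidean_space \<Rightarrow> real"
  assumes p: "1 < p" "p < real DIM('a)" and W: "W0_gradient p (ball 0 R) u G"
  shows "(\<integral>\<^sup>+x. ennreal (\<bar>u x\<bar> powr p / norm x powr p) \<partial>lebesgue_on (ball 0 R)) < \<infinity>"
proof -
  let ?M = "lebesgue_on (ball 0 R :: 'a set)"
  have p1: "1 \<le> p" using p by simp
  obtain \<phi> H where \<phi>: "\<And>n. test_function (ball 0 R) (\<phi> n)"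
    and H: "H \<in> borel_measurable ?M" "\<And>x. 1 \<le> H x" "integrable ?M (\<lambda>x. H x powr p)"
    and lim: "AE x in ?M. (\<lambda>n. \<phi> n x) \<longlonglongrightarrow> u x \<and> (\<lambda>n. grad (\<phi> n) x) \<longlonglongrightarrow> G x \<and>
       norm (G x) \<le> H x \<and> (\<forall>n. norm (grad (\<phi> n) x) \<le> H x)"
    by (rule W0_dominated_sequence[OF W p1 bounded_ball open_ball]) (rule that)
  define \<epsilon> where "\<epsilon> n = 1 / real (Suc n)" for n
  have \<epsilon>: "\<epsilon> n > 0" for n by (simp add: \<epsilon>_def)
  have \<epsilon>0: "\<epsilon> \<longlonglongrightarrow> 0"
    using LIMSEQ_inverse_real_of_nat by (simp add: \<epsilon>_def[abs_def] inverse_eq_divide)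
  define g where "g n x = (x \<bullet> x + \<epsilon> n) powr (- p / 2) * \<bar>\<phi> n x\<bar> powr p" for n and x :: 'a
  define C where "C = 2 / (real DIM('a) - p) * (p * (p / ((real DIM('a) - p) / 2)) powr (p - 1))"
  have C0: "C \<ge> 0" using p by (simp add: C_def)
  note h = hardy_inequality_regularized[OF p \<phi> \<epsilon>]
  have C: "(\<integral>x. g n x \<partial>?M) \<le> C * (\<integral>x. norm (grad (\<phi> n) x) powr p \<partial>?M)" for n
    unfolding C_def g_def by (rule h(3))
  have gi: "integrable ?M (g n)" for n unfolding g_def[abs_def] by (rule h(1))
  have ni: "integrable ?M (\<lambda>x. norm (grad (\<phi> n) x) powr p)" for n by (rule h(2))
  define B where "B = C * (\<integral>x. H x powr p \<partial>?M)"
  have gB: "(\<integral>\<^sup>+x. ennreal (g n x) \<partial>?M) \<le> ennreal B" for n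
  proof -
    have "(\<integral>x. norm (grad (\<phi> n) x) powr p \<partial>?M) \<le> (\<integral>x. H x powr p \<partial>?M)"
    proof (rule integral_mono_AE[OF ni H(3)])
      show "AE x in ?M. norm (grad (\<phi> n) x) powr p \<le> H x powr p"
        using lim by eventually_elim (use p in \<open>auto intro: powr_mono2\<close>)
    qed
    then have "(\<integral>x. g n x \<partial>?M) \<le> B"
      unfolding B_def using C[of n] C0 by (meson mult_left_mono order_trans)
    moreover have "(\<integral>\<^sup>+x. ennreal (g n x) \<partial>?M) = ennreal (\<integral>x. g n x \<partial>?M)"
      by (rule nn_integral_eq_integral[OF gi]) (auto simp: g_def)
    ultimately show ?thesis by (simp add: ennreal_leI)
  qed
  have ne0: "AE x in ?M. x \<noteq> 0"
  proof -
    have "AE x in lebesgue. x \<noteq> (0::'a)" 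
      by (rule AE_I'[of "{0}"]) (auto simp: negligible_iff_null_sets[symmetric])
    then show ?thesis by (subst AE_restrict_space_iff) auto
  qed
  have "AE x in ?M. ennreal (\<bar>u x\<bar> powr p / norm x powr p) = liminf (\<lambda>n. ennreal (g n x))"
    using lim ne0
  proof eventually_elim
    case (elim x)
    have "(\<lambda>n. g n x) \<longlonglongrightarrow> (x \<bullet> x + 0) powr (- p / 2) * \<bar>u x\<bar> powr p"
      unfolding g_def using elim p
      by (intro tendsto_mult tendsto_powr' tendsto_add tendsto_const \<epsilon>0 tendsto_rabs) auto
    also have "(x \<bullet> x + 0) powr (- p / 2) = (norm x powr 2) powr (- p / 2)"
      using elim by (simp add: dot_square_norm)
    also have "\<dots> = 1 / norm x powr p"
      unfolding powr_powr by (simp add: powr_minus_divide)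
    finally have "(\<lambda>n. g n x) \<longlonglongrightarrow> \<bar>u x\<bar> powr p / norm x powr p" by simp
    then have "(\<lambda>n. ennreal (g n x)) \<longlonglongrightarrow> ennreal (\<bar>u x\<bar> powr p / norm x powr p)"
      by (rule tendsto_ennrealI)
    from lim_imp_Liminf[OF _ this] show ?case by simp
  qed
  then have "(\<integral>\<^sup>+x. ennreal (\<bar>u x\<bar> powr p / norm x powr p) \<partial>?M) = (\<integral>\<^sup>+x. liminf (\<lambda>n. ennreal (g n x)) \<partial>?M)"
    by (rule nn_integral_cong_AE)
  also have "\<dots> \<le> liminf (\<lambda>n. \<integral>\<^sup>+x. ennreal (g n x) \<partial>?M)"
    by (rule nn_integral_liminf) (use gi in \<open>auto dest: borel_measurable_integrable\<close>)
  also have "\<dots> \<le> ennreal B"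
    by (rule Liminf_le) (use gB in auto)
  finally show ?thesis by (auto simp: le_less_trans)
qed

text \<open>Put \<open>y(r) = U(r) r\<^sup>\<delta>\<close>. The integrand equals \<open>y\<^sup>p \<bar>x\<bar>\<^sup>-\<^sup>N\<close>, and \<open>y\<close> does not drop by more than the factor \<open>c\<close> on the
  shell between \<open>r / 2\<close> and \<open>r\<close>. So the integral over the shell is at least a constant times \<open>y(r)\<^sup>p\<close>, while it
  tends to zero with \<open>r\<close>.\<close>

lemma hardy_shell_decay:
  fixes u :: "'a::euclidean_space \<Rightarrow> real" and U :: "real \<Rightarrow> real" and p R :: real
  defines "\<delta> \<equiv> (real DIM('a) - p) / p"
  assumes p: "1 < p" and R: "0 < R"
    and um: "u \<in> borel_measurable (lebesgue_on (ball 0 R))"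
    and fin: "(\<integral>\<^sup>+x. ennreal (\<bar>u x\<bar> powr p / norm x powr p) \<partial>lebesgue_on (ball 0 R)) < \<infinity>"
    and uU: "\<And>x. x \<in> ball 0 R - {0} \<Longrightarrow> u x = U (norm x)"
    and U: "\<And>r. 0 < r \<Longrightarrow> r < R \<Longrightarrow> 0 < U r"
    and low: "0 < c" "0 < r0"
      "\<And>r \<rho>. 0 < r \<Longrightarrow> r < r0 \<Longrightarrow> r / 2 \<le> \<rho> \<Longrightarrow> \<rho> \<le> r \<Longrightarrow>
         c * (U r * r powr \<delta>) \<le> U \<rho> * \<rho> powr \<delta>"
  shows "((\<lambda>r. U r * r powr \<delta>) \<longlongrightarrow> 0) (at_right 0)"
proof -
  let ?M = "lebesgue_on (ball 0 R :: 'a set)" and ?N = "DIM('a)"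
  define f where "f x = \<bar>u x\<bar> powr p / norm x powr p" for x :: 'a
  have idm: "(\<lambda>x::'a. x) \<in> borel_measurable ?M" by (rule id_borel_measurable_lebesgue_on[unfolded id_def])
  have fm[measurable]: "f \<in> borel_measurable ?M"
    unfolding f_def[abs_def] using um idm by measurable
  have indm[measurable]: "indicator A \<in> borel_measurable ?M" if "A \<in> sets borel" for A :: "'a set" 
    using that by (intro measurable_restrict_space1 measurable_completion) auto
  define v where "v = unit_ball_vol (real ?N) / 4 ^ ?N"
  have v: "v > 0" by (simp add: v_def)
  have small: "\<exists>\<rho>0>0. (\<integral>\<^sup>+x. ennreal (f x) * indicator (ball 0 \<rho>0) x \<partial>?M) < ennreal \<eta>" if "\<eta> > 0" for \<eta>
  proof -
    have "(\<lambda>n. \<integral>\<^sup>+x. ennreal (f x) * indicator (ball 0 (1 / real (Suc n))) x \<partial>?M) \<longlonglongrightarrow> (\<integral>\<^sup>+x. 0 \<partial>?M)"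
    proof (rule nn_integral_dominated_convergence[where w = "\<lambda>x. ennreal (f x)"])
      show "AE x in ?M. (\<lambda>n. ennreal (f x) * indicator (ball 0 (1 / real (Suc n))) x) \<longlonglongrightarrow> 0"
      proof -
        have "(\<lambda>n. ennreal (f x) * indicator (ball 0 (1 / real (Suc n))) x) \<longlonglongrightarrow> 0" for x
        proof (cases "x = 0")
          case False
          have "(\<lambda>n. 1 / real (Suc n)) \<longlonglongrightarrow> 0"
            using LIMSEQ_inverse_real_of_nat by (simp add: inverse_eq_divide)
          then have "\<forall>\<^sub>F n in sequentially. 1 / real (Suc n) < norm x"
            using False by (intro order_tendstoD(2)) auto
          then have "\<forall>\<^sub>F n in sequentially. ennreal (f x) * indicator (ball 0 (1 / real (Suc n))) x = 0"
            by eventually_elim (auto simp: indicator_def)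
          then show ?thesis by (rule tendsto_eventually)
        qed (simp add: f_def)
        then show ?thesis by simp
      qed
      show "\<And>n. AE x in ?M. ennreal (f x) * indicator (ball 0 (1 / real (Suc n))) x \<le> ennreal (f x)"
        by (auto simp: indicator_def)
      show "(\<integral>\<^sup>+x. ennreal (f x) \<partial>?M) < \<infinity>" using fin by (simp add: f_def)
    qed (use fm indm in measurable)
    then have "\<forall>\<^sub>F n in sequentially. (\<integral>\<^sup>+x. ennreal (f x) * indicator (ball 0 (1 / real (Suc n))) x \<partial>?M) < ennreal \<eta>"
      using that by (intro order_tendstoD(2)) auto
    then obtain n where "(\<integral>\<^sup>+x. ennreal (f x) * indicator (ball 0 (1 / real (Suc n))) x \<partial>?M) < ennreal \<eta>"
      by (auto simp: eventually_sequentially)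
    then show ?thesis by (intro exI[of _ "1 / real (Suc n)"]) auto
  qed
  have shell: "ennreal ((c * (U r * r powr \<delta>)) powr p * v) \<le> (\<integral>\<^sup>+x. ennreal (f x) * indicator (ball 0 \<rho>0) x \<partial>?M)"
    if r: "0 < r" "r < r0" "r < R" "r < \<rho>0" for r \<rho>0
  proof -
    obtain e :: 'a where e: "e \<in> Basis" using nonempty_Basis by blast
    \<comment> \<open>A ball inside the shell suffices for the lower bound of its volume.\<close>
    define B where "B = ball ((3 * r / 4) *\<^sub>R e) (r / 4)"
    have nB: "r / 2 < norm x \<and> norm x < r" if "x \<in> B" for x
    proof -
      have d: "norm ((3 * r / 4) *\<^sub>R e - x) < r / 4" using that by (simp add: B_def dist_norm)
      have n: "norm ((3 * r / 4) *\<^sub>R e) = 3 * r / 4" using r e by simp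
      show ?thesis using norm_triangle_ineq2[of "(3 * r / 4) *\<^sub>R e" x]
          norm_triangle_ineq2[of x "(3 * r / 4) *\<^sub>R e"] d n norm_minus_commute[of x "(3 * r / 4) *\<^sub>R e"] by linarith
    qed
    have BR: "B \<subseteq> ball 0 R" using nB r by force
    have fB: "(c * (U r * r powr \<delta>)) powr p * r powr (- real ?N) \<le> f x" if x: "x \<in> B" for x
    proof -
      let ?\<rho> = "norm x"
      have \<rho>: "r / 2 < ?\<rho>" "?\<rho> < r" "0 < ?\<rho>" using nB[OF x] r by auto
      have ux: "u x = U ?\<rho>" "0 < U ?\<rho>" using uU[of x] U[of ?\<rho>] \<rho> r by auto
      have "(c * (U r * r powr \<delta>)) powr p \<le> (U ?\<rho> * ?\<rho> powr \<delta>) powr p"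
        using low(1) low(3)[OF r(1,2), of ?\<rho>] \<rho> p U[of r] r by (intro powr_mono2) auto
      moreover have "r powr (- real ?N) \<le> ?\<rho> powr (- real ?N)"
        using \<rho> by (intro powr_mono2') auto
      ultimately have "(c * (U r * r powr \<delta>)) powr p * r powr (- real ?N)
          \<le> (U ?\<rho> * ?\<rho> powr \<delta>) powr p * ?\<rho> powr (- real ?N)" by (intro mult_mono) auto
      also have "\<dots> = U ?\<rho> powr p * (?\<rho> powr (\<delta> * p) * ?\<rho> powr (- real ?N))"
        by (simp add: powr_mult powr_powr)
      also have "?\<rho> powr (\<delta> * p) * ?\<rho> powr (- real ?N) = ?\<rho> powr (- p)"
        using p by (simp add: \<delta>_def flip: powr_add)
      also have "U ?\<rho> powr p * ?\<rho> powr (- p) = f x"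
        using ux \<rho> by (simp add: f_def powr_minus_divide)
      finally show ?thesis .
    qed
    have "r powr (- real ?N) * (unit_ball_vol (real ?N) * (r / 4) ^ ?N) = v"
      using r by (simp add: v_def powr_minus powr_realpow power_divide)
    then have "(c * (U r * r powr \<delta>)) powr p * v
        = (c * (U r * r powr \<delta>)) powr p * r powr (- real ?N) * (unit_ball_vol (real ?N) * (r / 4) ^ ?N)"
      by (simp add: mult.assoc)
    then have "ennreal ((c * (U r * r powr \<delta>)) powr p * v)
        = ennreal ((c * (U r * r powr \<delta>)) powr p * r powr (- real ?N)) * emeasure lborel B"
      using r unfolding B_def by (subst emeasure_ball) (auto simp: ennreal_mult'[symmetric])
    also have "emeasure lborel B = emeasure ?M B"
      using BR by (simp add: emeasure_restrict_space B_def main_part_sets)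
    also have "ennreal ((c * (U r * r powr \<delta>)) powr p * r powr (- real ?N)) * emeasure ?M B
        = (\<integral>\<^sup>+x. ennreal ((c * (U r * r powr \<delta>)) powr p * r powr (- real ?N)) * indicator B x \<partial>?M)"
      using BR by (intro nn_integral_cmult_indicator[symmetric]) (auto simp: B_def sets_restrict_space_iff)
    also have "\<dots> \<le> (\<integral>\<^sup>+x. ennreal (f x) * indicator (ball 0 \<rho>0) x \<partial>?M)"
      using fB nB r by (intro nn_integral_mono) (force simp: indicator_def intro: ennreal_leI)
    finally show ?thesis .
  qed
  show ?thesis
  proof (rule order_tendstoI)
    fix a :: real assume "a < 0"
    have "\<forall>\<^sub>F r in at_right 0. r < R" using R by (simp add: eventually_at_right_field) (use R in blast)
    moreover have "\<forall>\<^sub>F r in at_right (0::real). 0 < r" by (simp add: eventually_at_right_less)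
    ultimately show "\<forall>\<^sub>F r in at_right 0. a < U r * r powr \<delta>"
      by eventually_elim (use U \<open>a < 0\<close> in \<open>smt (verit) mult_nonneg_nonneg powr_ge_zero\<close>)
  next
    fix a :: real assume a: "0 < a"
    define \<eta> where "\<eta> = (c * a) powr p * v"
    have "\<eta> > 0" using a low(1) v by (simp add: \<eta>_def)
    then obtain \<rho>0 where \<rho>0: "\<rho>0 > 0" "(\<integral>\<^sup>+x. ennreal (f x) * indicator (ball 0 \<rho>0) x \<partial>?M) < ennreal \<eta>"
      using small by blast
    define m where "m = min \<rho>0 (min r0 R)"
    have m: "m > 0" using \<rho>0 low(2) R by (simp add: m_def)
    have "U r * r powr \<delta> < a" if r: "0 < r" "r < m" for r
    proof (rule ccontr)
      assume "\<not> U r * r powr \<delta> < a"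
      then have "(c * a) powr p \<le> (c * (U r * r powr \<delta>)) powr p"
        using low(1) a p by (intro powr_mono2) auto
      then have "ennreal \<eta> \<le> ennreal ((c * (U r * r powr \<delta>)) powr p * v)"
        unfolding \<eta>_def using v by (intro ennreal_leI mult_right_mono) auto
      also have "\<dots> \<le> (\<integral>\<^sup>+x. ennreal (f x) * indicator (ball 0 \<rho>0) x \<partial>?M)"
        using r by (intro shell) (auto simp: m_def)
      also have "\<dots> < ennreal \<eta>" by (rule \<rho>0)
      finally show False by simp
    qed
    then show "\<forall>\<^sub>F r in at_right 0. U r * r powr \<delta> < a"
      using m by (intro eventually_at_rightI[of 0 m]) auto
  qed
qed

section \<open>A perturbed Riccati equation on the phase line\<close>

text \<open>At the first time at which the level \<open>c\<close> is reached the derivative could not be negative.\<close>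

lemma stays_below:
  fixes f f' :: "real \<Rightarrow> real"
  assumes der: "\<And>t. t1 \<le> t \<Longrightarrow> (f has_real_derivative f' t) (at t)"
    and start: "f t1 < c" and cross: "\<And>t. t1 \<le> t \<Longrightarrow> f t = c \<Longrightarrow> f' t < 0"
    and t: "t1 \<le> t"
  shows "f t < c"
proof (rule ccontr)
  assume neg: "\<not> f t < c"
  have cont: "continuous_on {t1..t} f"
    using der by (auto intro!: continuous_at_imp_continuous_on DERIV_isCont)
  define S where "S = {t1..t} \<inter> f -` {c..}"
  have Sc: "compact S"
    unfolding S_def using continuous_closed_preimage[OF cont closed_atLeastAtMost, of "{c..}"]
    by (intro compact_Int_closed[of "{t1..t}" "{t1..t} \<inter> f -` {c..}", simplified]) 
       (auto simp: Int_absorb)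
  have "t \<in> S" using neg t by (auto simp: S_def)
  then obtain s where s: "s \<in> S" "\<And>x. x \<in> S \<Longrightarrow> s \<le> x"
    using compact_attains_inf[OF Sc] by blast
  have st: "t1 < s" using s(1) start by (cases "s = t1") (auto simp: S_def)
  have below: "f x < c" if "t1 \<le> x" "x < s" for x
    using s(2)[of x] that s(1) by (force simp: S_def)
  have "f s = c"
  proof (rule ccontr)
    assume "f s \<noteq> c"
    then have "c \<le> f s" "f s > c" using s(1) by (auto simp: S_def)
    moreover have "continuous_on {t1..s} f" using s(1) by (intro continuous_on_subset[OF cont]) (auto simp: S_def)
    ultimately obtain x where "t1 \<le> x" "x \<le> s" "f x = c"
      using IVT'[of f t1 c s] start st by fastforce
    then show False using below[of x] \<open>f s > c\<close> by (cases "x = s") auto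
  qed
  then have "f' s < 0" using cross st by simp
  then obtain d where d: "d > 0" "\<And>h. 0 < h \<Longrightarrow> h < d \<Longrightarrow> f s < f (s - h)"
    using DERIV_neg_dec_left[OF der[of s]] st by auto
  define h where "h = min (d / 2) (s - t1)"
  have "0 < h" "h < d" "t1 \<le> s - h" "s - h < s" using d st by (auto simp: h_def min_def)
  then show False using d(2)[of h] below[of "s - h"] \<open>f s = c\<close> by auto
qed

lemma stays_above:
  fixes f f' :: "real \<Rightarrow> real"
  assumes "\<And>t. t1 \<le> t \<Longrightarrow> (f has_real_derivative f' t) (at t)"
    and "c < f t1" and "\<And>t. t1 \<le> t \<Longrightarrow> f t = c \<Longrightarrow> 0 < f' t" and "t1 \<le> t"
  shows "c < f t"
  using stays_below[of t1 "\<lambda>t. - f t" "\<lambda>t. - f' t" "- c" t] assms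
  by (auto intro: DERIV_minus)

lemma linear_upper_bound:
  fixes f f' :: "real \<Rightarrow> real"
  assumes "\<And>t. t1 \<le> t \<Longrightarrow> (f has_real_derivative f' t) (at t)"
    and "\<And>t. t1 \<le> t \<Longrightarrow> f' t \<le> - m" and "t1 \<le> t"
  shows "f t \<le> f t1 - m * (t - t1)"
proof -
  have "f t + m * t \<le> f t1 + m * t1"
  proof (rule DERIV_nonpos_imp_nonincreasing[OF assms(3)])
    fix x assume "t1 \<le> x" "x \<le> t"
    then show "\<exists>y. ((\<lambda>t. f t + m * t) has_real_derivative y) (at x) \<and> y \<le> 0"
      using assms(1,2)[of x] by (intro exI[of _ "f' x + m"]) (auto intro!: derivative_eq_intros)
  qed
  then show ?thesis by (simp add: algebra_simps)
qed

text \<open>The function \<open>\<Gamma>\<^sub>\<mu>\<close> in the variable \<open>w = \<bar>\<gamma>\<bar>\<^sup>p\<^sup>-\<^sup>2 \<gamma>\<close>, in which it is strictly convex and continuously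
  differentiable also where \<open>\<gamma> = 0\<close>.\<close>

definition riccati :: "real \<Rightarrow> real \<Rightarrow> real \<Rightarrow> real \<Rightarrow> real" where
  "riccati N p \<mu> w = (p - 1) * \<bar>w\<bar> powr (p / (p - 1)) - (N - p) * w + \<mu>"

lemma Gamma_fun_eq_riccati:
  assumes "1 < p"
  shows "Gamma_fun n p \<mu> \<gamma> = riccati (real n) p \<mu> (spow (p - 1) \<gamma>)"
  using assms by (simp add: Gamma_fun_def riccati_def powr_mult_eq_spow abs_spow powr_powr)

lemma riccati_deriv:
  assumes "1 < p"
  shows "(riccati N p \<mu> has_real_derivative p * spow (1 / (p - 1)) w - (N - p)) (at w)"
proof -
  have q: "1 < p / (p - 1)" "p / (p - 1) - 1 = 1 / (p - 1)" using assms by (auto simp: field_simps)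
  have "(riccati N p \<mu> has_real_derivative
      (p - 1) * (p / (p - 1) * spow (p / (p - 1) - 1) w) - (N - p) * 1 + 0) (at w)"
    unfolding riccati_def[abs_def]
    by (intro DERIV_add DERIV_diff DERIV_cmult has_derivative_abs_powr[OF q(1)] DERIV_ident DERIV_const)
  also have "(p - 1) * (p / (p - 1) * spow (p / (p - 1) - 1) w) - (N - p) * 1 + 0
      = p * spow (1 / (p - 1)) w - (N - p)"
    unfolding q(2) using assms by simp
  finally show ?thesis .
qed

text \<open>The derivative \<open>p \<bar>w\<bar>\<^sup>1\<^sup>/\<^sup>(\<^sup>p\<^sup>-\<^sup>1\<^sup>) sgn w - (N - p)\<close> is strictly increasing with its only zero at \<open>w0\<close>.\<close>

lemma riccati_shape:
  fixes N p \<mu> w1 w2 :: real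
  assumes p: "1 < p" "p < N" and roots: "riccati N p \<mu> w1 = 0" "riccati N p \<mu> w2 = 0" "w1 < w2"
  defines "w0 \<equiv> ((N - p) / p) powr (p - 1)"
  shows "spow (1 / (p - 1)) w0 = (N - p) / p" "w1 < w0" "w0 < w2"
    "\<And>x y. x < y \<Longrightarrow> y \<le> w0 \<Longrightarrow> riccati N p \<mu> y < riccati N p \<mu> x"
    "\<And>x y. w0 \<le> x \<Longrightarrow> x < y \<Longrightarrow> riccati N p \<mu> x < riccati N p \<mu> y"
proof -
  let ?F = "riccati N p \<mu>" and ?a = "1 / (p - 1)"
  have a: "?a > 0" using p by simp
  show s0: "spow ?a w0 = (N - p) / p"
    using p by (simp add: w0_def spow_nonneg powr_powr)
  have sl: "p * spow ?a x - (N - p) < 0" if "x < w0" for x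
    using spow_strict_mono[OF a that] p s0 by (simp add: field_simps)
  have sg: "p * spow ?a x - (N - p) > 0" if "w0 < x" for x
    using spow_strict_mono[OF a that] p s0 by (simp add: field_simps)
  have cont: "continuous_on S ?F" for S
    using riccati_deriv[OF p(1)] by (auto intro!: continuous_at_imp_continuous_on DERIV_isCont)
  show dec: "?F y < ?F x" if "x < y" "y \<le> w0" for x y
    by (rule DERIV_neg_imp_decreasing_open[OF that(1)])
      (use riccati_deriv[OF p(1)] sl that cont in \<open>auto intro!: exI\<close>)
  show inc: "?F x < ?F y" if "w0 \<le> x" "x < y" for x y
    by (rule DERIV_pos_imp_increasing_open[OF that(2)])
      (use riccati_deriv[OF p(1)] sg that cont in \<open>auto intro!: exI\<close>)
  show "w1 < w0" using inc[of w1 w2] roots by force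
  show "w0 < w2" using dec[of w1 w2] roots by force
qed

text \<open>Once, at a late time, \<open>W\<close> is below \<open>w1 - d\<close> it decreases at a positive rate, and when it is very negative it satisfies
  \<open>(- W)' \<ge> const (- W)\<^sup>q\<close> with \<open>q = p / (p - 1) > 1\<close>, so it would blow up in finite time. Only a lower bound
  of \<open>h\<close> enters; it is available before anything is known about the decay of the solution.\<close>

lemma riccati_eventually_above:
  fixes W h :: "real \<Rightarrow> real"
  assumes p: "1 < p" "p < N" and roots: "riccati N p \<mu> w1 = 0" "riccati N p \<mu> w2 = 0" "w1 < w2"
    and der: "\<And>t. t0 < t \<Longrightarrow> (W has_real_derivative - (riccati N p \<mu> (W t) + h t)) (at t)"
    and h: "\<And>e. 0 < e \<Longrightarrow> \<forall>\<^sub>F t in at_top. - e \<le> h t" and d: "0 < d"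
  shows "\<forall>\<^sub>F t in at_top. w1 - d \<le> W t"
proof -
  let ?F = "riccati N p \<mu>"
  note sh = riccati_shape[OF p roots]
  define m where "m = ?F (w1 - d)"
  have m: "m > 0" using sh(4)[of "w1 - d" w1] sh(2) d roots by (simp add: m_def)
  have mF: "m \<le> ?F w" if "w \<le> w1 - d" for w
    using sh(4)[of w "w1 - d"] sh(2) d that by (cases "w = w1 - d") (auto simp: m_def)
  define k where "k = min (m / 2) 1"
  have k: "0 < k" "k \<le> m / 2" "k \<le> 1" using m by (auto simp: k_def)
  obtain T where T: "\<And>t. T \<le> t \<Longrightarrow> - k \<le> h t" using h[OF k(1)] by (auto simp: eventually_at_top_linorder)
  define T' where "T' = max T (t0 + 1)"
  show ?thesis unfolding eventually_at_top_linorder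
  proof (intro exI[of _ T'] allI impI, rule ccontr)
    fix t1 assume t1: "T' \<le> t1" and "\<not> w1 - d \<le> W t1"
    then have W1: "W t1 < w1 - d" by simp
    have D: "(W has_real_derivative - (?F (W t) + h t)) (at t)" if "t1 \<le> t" for t
      using der that t1 by (simp add: T'_def)
    have hk: "- k \<le> h t" if "t1 \<le> t" for t using T that t1 by (simp add: T'_def)
    have bel: "W t < w1 - d" if "t1 \<le> t" for t
    proof (rule stays_below[OF D W1 _ that])
      fix t assume "t1 \<le> t" "W t = w1 - d"
      then show "- (?F (W t) + h t) < 0" using hk[of t] mF[of "W t"] k m by simp
    qed
    have lin: "W t \<le> W t1 - m / 2 * (t - t1)" if "t1 \<le> t" for t
    proof (rule linear_upper_bound[OF D _ that])
      fix t assume t: "t1 \<le> t"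
      show "- (?F (W t) + h t) \<le> - (m / 2)" using hk[OF t] mF[of "W t"] bel[OF t] k by simp
    qed
    define q where "q = p / (p - 1)"
    have q: "q > 1" using p by (simp add: q_def field_simps)
    \<comment> \<open>Below \<open>- L\<close> half of the leading term of \<open>F\<close> dominates \<open>\<mu>\<close> and the perturbation.\<close>
    define L where "L = (2 * (\<bar>\<mu>\<bar> + 1) / (p - 1)) powr (1 / q) + 1"
    have L: "L > 0" by (simp add: L_def add_nonneg_pos)
    have LF: "(p - 1) / 2 * (- w) powr q \<le> ?F w - 1" if "w \<le> - L" for w
    proof -
      have "(2 * (\<bar>\<mu>\<bar> + 1) / (p - 1)) = ((2 * (\<bar>\<mu>\<bar> + 1) / (p - 1)) powr (1 / q)) powr q"
        using p q by (simp add: powr_powr)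
      also have "\<dots> \<le> (- w) powr q" using that q by (intro powr_mono2) (auto simp: L_def)
      finally have "\<bar>\<mu>\<bar> + 1 \<le> (p - 1) / 2 * (- w) powr q" using p by (simp add: field_simps)
      moreover have "?F w = (p - 1) * (- w) powr q + (N - p) * (- w) + \<mu>"
        using that L by (simp add: riccati_def q_def abs_if)
      moreover have "0 \<le> (N - p) * (- w)" using p that L by (intro mult_nonneg_nonneg) auto
      ultimately show ?thesis by (simp add: field_simps)
    qed
    define t2 where "t2 = t1 + 2 * \<bar>W t1 + L\<bar> / m"
    have t2: "t1 \<le> t2" using m by (simp add: t2_def)
    have WL: "W t \<le> - L" if "t2 \<le> t" for t
    proof -
      have "\<bar>W t1 + L\<bar> = m / 2 * (t2 - t1)" using m by (simp add: t2_def)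
      also have "\<dots> \<le> m / 2 * (t - t1)" using that m by (intro mult_left_mono) auto
      finally show ?thesis using lin[of t] that t2 by linarith
    qed
    \<comment> \<open>This positive quantity decreases at a fixed rate \<open>\<kappa>\<close>, which is the finite-time blow-up.\<close>
    define P where "P t = (- W t) powr (1 - q)" for t
    define \<kappa> where "\<kappa> = (q - 1) * ((p - 1) / 2)"
    have \<kappa>: "\<kappa> > 0" using q p by (simp add: \<kappa>_def)
    define P' where "P' t = (1 - q) * (- W t) powr (- q) * (?F (W t) + h t)" for t
    have Pd: "(P has_real_derivative P' t) (at t)" if "t2 \<le> t" for t
    proof -
      have pos: "0 < - W t" using WL[OF that] L by simp
      have D': "((\<lambda>t. - W t) has_real_derivative ?F (W t) + h t) (at t)"
        using DERIV_minus[OF D[of t]] that t2 by (simp add: add.commute)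
      have "1 - q - 1 = - q" by simp
      from DERIV_chain'[OF D' has_real_derivative_powr[where r = "1 - q", OF pos], unfolded this]
      show ?thesis unfolding P_def[abs_def] P'_def by simp
    qed
    have P'b: "P' t \<le> - \<kappa>" if "t2 \<le> t" for t
    proof -
      have pos: "0 < - W t" using WL[OF that] L by simp
      have "(p - 1) / 2 * (- W t) powr q \<le> ?F (W t) + h t"
        using LF[OF WL[OF that]] hk[of t] that t2 k by linarith
      then have "(- W t) powr (- q) * ((p - 1) / 2 * (- W t) powr q) \<le> (- W t) powr (- q) * (?F (W t) + h t)"
        by (intro mult_left_mono) auto
      moreover have "(- W t) powr (- q) * ((p - 1) / 2 * (- W t) powr q) = (p - 1) / 2"
        using pos by (simp add: powr_minus)
      ultimately have "(p - 1) / 2 \<le> (- W t) powr (- q) * (?F (W t) + h t)" by linarith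
      then have "(1 - q) * ((- W t) powr (- q) * (?F (W t) + h t)) \<le> (1 - q) * ((p - 1) / 2)"
        using q by (intro mult_left_mono_neg) auto
      moreover have "(1 - q) * ((p - 1) / 2) = - \<kappa>"
        unfolding \<kappa>_def by (simp only: minus_mult_left minus_diff_eq)
      ultimately show ?thesis by (simp only: P'_def mult.assoc)
    qed
    define t3 where "t3 = t2 + (P t2 + 1) / \<kappa>"
    have P0: "P t \<ge> 0" for t by (simp add: P_def)
    have "t2 \<le> t3" using \<kappa> P0[of t2] by (simp add: t3_def)
    from linear_upper_bound[OF Pd P'b this] have "P t3 \<le> P t2 - \<kappa> * ((P t2 + 1) / \<kappa>)"
      by (simp add: t3_def)
    then have "P t3 \<le> - 1" using \<kappa> by simp
    then show False using P0[of t3] by simp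
  qed
qed

text \<open>The logarithmic derivative of \<open>X e\<^sup>-\<^sup>\<delta>\<^sup>t\<close> is bounded below where \<open>W\<close> is. The length \<open>ln 2\<close> corresponds to
  halving \<open>r = e\<^sup>-\<^sup>t\<close>.\<close>

lemma slow_decay_of_scaled_solution:
  fixes X W :: "real \<Rightarrow> real"
  assumes p: "1 < p"
    and X: "\<And>t. t0 < t \<Longrightarrow> 0 < X t"
      "\<And>t. t0 < t \<Longrightarrow> (X has_real_derivative X t * spow (1 / (p - 1)) (W t)) (at t)"
    and W: "\<And>t. t0 < t \<Longrightarrow> m \<le> W t"
  shows "\<exists>c>0. \<forall>t s. t0 < t \<longrightarrow> t \<le> s \<longrightarrow> s \<le> t + ln 2 \<longrightarrow>
    c * (X t * exp (- \<delta> * t)) \<le> X s * exp (- \<delta> * s)"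
proof -
  define L where "L = \<bar>spow (1 / (p - 1)) m - \<delta>\<bar>"
  have a: "0 < 1 / (p - 1)" using p by simp
  define z where "z t = X t * exp ((L - \<delta>) * t)" for t
  have z: "z t \<le> z s" if "t0 < t" "t \<le> s" for t s
  proof (rule DERIV_nonneg_imp_nondecreasing[OF that(2)])
    fix x assume "t \<le> x" "x \<le> s"
    then have x: "t0 < x" using that by simp
    have "(z has_real_derivative X x * exp ((L - \<delta>) * x) * (spow (1 / (p - 1)) (W x) - \<delta> + L)) (at x)"
      unfolding z_def[abs_def] using X(2)[OF x] by (auto intro!: derivative_eq_intros simp: algebra_simps)
    moreover have "spow (1 / (p - 1)) m \<le> spow (1 / (p - 1)) (W x)" by (rule spow_mono[OF a W[OF x]])
    then have "0 \<le> spow (1 / (p - 1)) (W x) - \<delta> + L" by (simp add: L_def)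
    ultimately show "\<exists>y. (z has_real_derivative y) (at x) \<and> 0 \<le> y"
      using X(1)[OF x]
      by (intro exI[of _ "X x * exp ((L - \<delta>) * x) * (spow (1 / (p - 1)) (W x) - \<delta> + L)"]) simp
  qed
  show ?thesis
  proof (intro exI[of _ "exp (- L * ln 2)"] conjI allI impI)
    fix t s assume ts: "t0 < t" "t \<le> s" "s \<le> t + ln 2"
    have e: "X t * exp (- \<delta> * t) = z t * exp (- L * t)" "X s * exp (- \<delta> * s) = z s * exp (- L * s)"
      by (simp_all add: z_def mult.assoc mult_exp_exp algebra_simps)
    have "exp (- L * ln 2) * (X t * exp (- \<delta> * t)) = z t * exp (- L * (t + ln 2))"
      unfolding e by (simp add: mult_exp_exp algebra_simps)
    also have "\<dots> \<le> z s * exp (- L * s)"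
    proof (intro mult_mono z ts)
      show "exp (- L * (t + ln 2)) \<le> exp (- L * s)" using ts(3) by (simp add: L_def mult_left_mono)
      show "0 \<le> z s" using X(1)[of s] ts by (simp add: z_def)
    qed auto
    also have "\<dots> = X s * exp (- \<delta> * s)" unfolding e by (rule refl)
    finally show "exp (- L * ln 2) * (X t * exp (- \<delta> * t)) \<le> X s * exp (- \<delta> * s)" .
  qed simp
qed

lemma eventually_at_top_obtain:
  assumes "\<forall>\<^sub>F t in at_top. P t"
  shows "\<exists>t\<ge>(a::real). P t"
  using assms unfolding eventually_at_top_linorder by (meson linear order_trans)

lemma exp_neg_mult_tendsto_0:
  assumes "0 < (c::real)"
  shows "((\<lambda>t. exp (- c * t)) \<longlongrightarrow> 0) at_top"
proof -
  have "filterlim (\<lambda>t. c * t) at_top at_top"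
    by (rule filterlim_tendsto_pos_mult_at_top[OF tendsto_const assms filterlim_ident])
  then have "filterlim (\<lambda>t. - c * t) at_bot at_top"
    by (simp add: filterlim_uminus_at_top)
  then show ?thesis by (rule filterlim_compose[OF exp_at_bot])
qed

text \<open>If \<open>W\<close> exceeds \<open>wl > w1\<close> at a late time, it crosses the region where \<open>F \<le> - m < 0\<close> upwards until it stays
  beyond \<open>w3 > w0\<close>. There the logarithmic derivative of \<open>X e\<^sup>-\<^sup>\<delta>\<^sup>t\<close> is positive, which contradicts the decay.\<close>

lemma riccati_tendsto_small_root:
  fixes W X h :: "real \<Rightarrow> real"
  assumes p: "1 < p" "p < N" and roots: "riccati N p \<mu> w1 = 0" "riccati N p \<mu> w2 = 0" "w1 < w2"
    and W: "\<And>t. t0 < t \<Longrightarrow> (W has_real_derivative - (riccati N p \<mu> (W t) + h t)) (at t)"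
    and X: "\<And>t. t0 < t \<Longrightarrow> 0 < X t"
      "\<And>t. t0 < t \<Longrightarrow> (X has_real_derivative X t * spow (1 / (p - 1)) (W t)) (at t)"
    and h: "(h \<longlongrightarrow> 0) at_top"
    and y: "((\<lambda>t. X t * exp (- ((N - p) / p) * t)) \<longlongrightarrow> 0) at_top"
  shows "(W \<longlongrightarrow> w1) at_top"
proof (rule order_tendstoI)
  fix a assume a: "a < w1"
  have "\<forall>\<^sub>F t in at_top. - e \<le> h t" if "0 < e" for e
    using order_tendstoD(1)[OF h, of "- e"] that by (auto elim: eventually_mono)
  from riccati_eventually_above[OF p roots W this, where d = "(w1 - a) / 2"] a
  have "\<forall>\<^sub>F t in at_top. w1 - (w1 - a) / 2 \<le> W t" by simp
  then show "\<forall>\<^sub>F t in at_top. a < W t" by eventually_elim (use a in \<open>simp add: field_simps\<close>)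
next
  let ?F = "riccati N p \<mu>"
  define w0 where "w0 = ((N - p) / p) powr (p - 1)"
  note sh = riccati_shape[OF p roots, folded w0_def]
  have a1: "0 < 1 / (p - 1)" using p by simp
  fix a assume a: "w1 < a"
  define wl where "wl = (w1 + min a w0) / 2"
  define wh where "wh = (w0 + w2) / 2"
  define w3 where "w3 = (w0 + wh) / 2"
  have ord: "w1 < wl" "wl < w0" "wl < a" "w0 < w3" "w3 < wh" "wh < w2"
    using a sh(2,3) by (auto simp: wl_def wh_def w3_def)
  define m where "m = - max (?F wl) (?F wh)"
  have m: "m > 0"
    using sh(4)[of w1 wl] sh(5)[of wh w2] ord roots by (simp add: m_def)
  have Fm: "?F w \<le> - m" if "wl \<le> w" "w \<le> wh" for w
  proof (cases "w \<le> w0")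
    case True
    then have "?F w \<le> ?F wl" using sh(4)[of wl w] that by (cases "w = wl") auto
    then show ?thesis by (simp add: m_def)
  next
    case False
    then have "?F w \<le> ?F wh" using sh(5)[of w wh] that by (cases "w = wh") auto
    then show ?thesis by (simp add: m_def)
  qed
  have "\<forall>\<^sub>F t in at_top. h t < m / 2" by (rule order_tendstoD(2)[OF h]) (use m in simp)
  then obtain T where T: "\<And>t. T \<le> t \<Longrightarrow> h t < m / 2" by (auto simp: eventually_at_top_linorder)
  define T' where "T' = max T (t0 + 1)"
  show "\<forall>\<^sub>F t in at_top. W t < a" unfolding eventually_at_top_linorder
  proof (intro exI[of _ T'] allI impI, rule ccontr)
    fix t1 assume t1: "T' \<le> t1" and "\<not> W t1 < a"
    then have W1: "wl < W t1" using ord by simp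
    have D: "(W has_real_derivative - (?F (W t) + h t)) (at t)" if "t1 \<le> t" for t
      using W that t1 by (simp add: T'_def)
    have hk: "h t < m / 2" if "t1 \<le> t" for t using T that t1 by (simp add: T'_def)
    have up: "wl < W t" if "t1 \<le> t" for t
    proof (rule stays_above[OF D W1 _ that])
      fix t assume "t1 \<le> t" "W t = wl"
      then show "0 < - (?F (W t) + h t)" using hk[of t] Fm[of wl] ord m by simp
    qed
    have "\<exists>t2\<ge>t1. wh \<le> W t2"
    proof (rule ccontr)
      assume "\<not> ?thesis"
      then have lt: "W t < wh" if "t1 \<le> t" for t using that by force
      have D': "((\<lambda>t. - W t) has_real_derivative ?F (W t) + h t) (at t)" if "t1 \<le> t" for t
        using DERIV_minus[OF D[OF that]] by (simp add: add.commute)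
      have b: "?F (W t) + h t \<le> - (m / 2)" if "t1 \<le> t" for t
        using hk[OF that] Fm[of "W t"] up[OF that] lt[OF that] by simp
      define t2 where "t2 = t1 + 2 * (wh - W t1) / m"
      have "t1 \<le> t2" using lt[of t1] m by (simp add: t2_def)
      have "m / 2 * (t2 - t1) = wh - W t1" using m by (simp add: t2_def)
      with linear_upper_bound[OF D' b \<open>t1 \<le> t2\<close>] have "wh \<le> W t2" by linarith
      then show False using lt[OF \<open>t1 \<le> t2\<close>] by simp
    qed
    then obtain t2 where t2: "t1 \<le> t2" "wh \<le> W t2" by blast
    have up3: "w3 < W t" if "t2 \<le> t" for t
    proof (rule stays_above[OF _ _ _ that])
      show "(W has_real_derivative - (?F (W t) + h t)) (at t)" if "t2 \<le> t" for t
        using D that t2 by simp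
      show "w3 < W t2" using t2 ord by simp
      fix t assume "t2 \<le> t" "W t = w3"
      then show "0 < - (?F (W t) + h t)" using hk[of t] Fm[of w3] ord m t2 by simp
    qed
    define \<delta> where "\<delta> = (N - p) / p"
    define z where "z t = X t * exp (- \<delta> * t)" for t
    have tt: "t0 < t" if "t2 \<le> t" for t using that t1 t2 by (simp add: T'_def)
    have zm: "z t2 \<le> z t" if "t2 \<le> t" for t
    proof (rule DERIV_nonneg_imp_nondecreasing[OF that])
      fix x assume x: "t2 \<le> x" "x \<le> t"
      have "(z has_real_derivative z x * (spow (1 / (p - 1)) (W x) - \<delta>)) (at x)"
        unfolding z_def[abs_def] using X(2)[OF tt[OF x(1)]]
        by (auto intro!: derivative_eq_intros simp: algebra_simps)
      moreover have "0 \<le> spow (1 / (p - 1)) (W x) - \<delta>"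
        using spow_mono[OF a1, of w0 "W x"] up3[OF x(1)] ord sh(1) by (simp add: \<delta>_def)
      moreover have "0 < z x" using X(1)[OF tt[OF x(1)]] by (simp add: z_def)
      ultimately show "\<exists>y. (z has_real_derivative y) (at x) \<and> 0 \<le> y"
        by (intro exI[of _ "z x * (spow (1 / (p - 1)) (W x) - \<delta>)"]) simp
    qed
    have "0 < z t2" using X(1)[OF tt[of t2]] by (simp add: z_def)
    then have "\<forall>\<^sub>F t in at_top. z t < z t2"
      using order_tendstoD(2)[OF y[folded \<delta>_def]] unfolding z_def by blast
    then obtain t where "t2 \<le> t" "z t < z t2" using eventually_at_top_obtain by blast
    then show False using zm[of t] by simp
  qed
qed

lemma exponential_decay:
  fixes X W :: "real \<Rightarrow> real"
  assumes X: "\<And>t. t0 < t \<Longrightarrow> 0 < X t"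
      "\<And>t. t0 < t \<Longrightarrow> (X has_real_derivative X t * g t) (at t)"
    and g: "(g \<longlongrightarrow> \<gamma>) at_top" and \<gamma>: "\<gamma> < \<delta>"
  shows "\<exists>k>0. \<exists>C>0. \<forall>\<^sub>F t in at_top. X t * exp (- \<delta> * t) \<le> C * exp (- k * t)"
proof -
  define k where "k = (\<delta> - \<gamma>) / 2"
  have k: "k > 0" using \<gamma> by (simp add: k_def)
  have "\<forall>\<^sub>F t in at_top. g t < \<gamma> + k" using order_tendstoD(2)[OF g] k by simp
  then obtain T where T: "\<And>t. T \<le> t \<Longrightarrow> g t < \<gamma> + k" by (auto simp: eventually_at_top_linorder)
  define T' where "T' = max T (t0 + 1)"
  define z where "z t = X t * exp ((k - \<delta>) * t)" for t
  have z: "z t \<le> z T'" if "T' \<le> t" for t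
  proof (rule DERIV_nonpos_imp_nonincreasing[OF that])
    fix x assume x: "T' \<le> x" "x \<le> t"
    then have x0: "t0 < x" by (simp add: T'_def)
    have "(z has_real_derivative z x * (g x - \<delta> + k)) (at x)"
      unfolding z_def[abs_def] using X(2)[OF x0]
      by (auto intro!: derivative_eq_intros simp: algebra_simps)
    moreover have "g x - \<delta> + k \<le> 0" using T[of x] x by (simp add: T'_def k_def field_simps)
    moreover have "0 < z x" using X(1)[OF x0] by (simp add: z_def)
    ultimately show "\<exists>y. (z has_real_derivative y) (at x) \<and> y \<le> 0"
      by (intro exI[of _ "z x * (g x - \<delta> + k)"]) (simp add: mult_nonneg_nonpos)
  qed
  have "X t * exp (- \<delta> * t) \<le> z T' * exp (- k * t)" if "T' \<le> t" for t
  proof -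
    have "X t * exp (- \<delta> * t) = z t * exp (- k * t)"
      by (simp add: z_def mult.assoc mult_exp_exp algebra_simps)
    also have "\<dots> \<le> z T' * exp (- k * t)" using z[OF that] by (intro mult_right_mono) auto
    finally show ?thesis .
  qed
  moreover have "0 < z T'" using X(1)[of T'] by (simp add: z_def T'_def)
  ultimately show ?thesis using k by (auto simp: eventually_at_top_linorder)
qed

text \<open>Outside a tube of width proportional to \<open>e\<^sup>-\<^sup>k\<^sup>t\<close> the linear repulsion from \<open>w1\<close> beats \<open>h\<close>. A solution that leaves
  the tube at time \<open>t1\<close> would therefore keep at least its distance at that time, and could not converge.\<close>

lemma repelling_equilibrium_rate:
  fixes W F h :: "real \<Rightarrow> real"
  assumes W: "\<And>t. t0 < t \<Longrightarrow> (W has_real_derivative - (F (W t) + h t)) (at t)"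
    and F: "(F has_real_derivative - l) (at w1)" "F w1 = 0" "0 < l"
    and lim: "(W \<longlongrightarrow> w1) at_top"
    and h: "\<forall>\<^sub>F t in at_top. \<bar>h t\<bar> \<le> C * exp (- k * t)" and k: "0 < k" "0 < C"
  shows "\<forall>\<^sub>F t in at_top. \<bar>W t - w1\<bar> \<le> 4 * C / l * exp (- k * t)"
proof -
  have "((\<lambda>w. (F w - F w1) / (w - w1)) \<longlongrightarrow> - l) (at w1)"
    using F(1) by (simp add: has_field_derivative_iff)
  then have "\<forall>\<^sub>F w in at w1. (F w - F w1) / (w - w1) < - (l / 2)"
    using F(3) by (intro order_tendstoD(2)) auto
  then obtain d where d: "d > 0" "\<And>w. w \<noteq> w1 \<Longrightarrow> \<bar>w - w1\<bar> < d \<Longrightarrow> F w / (w - w1) < - (l / 2)"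
    unfolding eventually_at dist_real_def F(2) by auto
  have Fp: "F w < - (l / 2) * (w - w1)" if "w1 < w" "w < w1 + d" for w
    using d(2)[of w] that by (simp add: divide_less_eq)
  have Fn: "- (l / 2) * (w - w1) < F w" if "w < w1" "w1 - d < w" for w
    using d(2)[of w] that by (simp add: divide_less_eq)
  have "\<forall>\<^sub>F t in at_top. dist (W t) w1 < d" using tendstoD[OF lim d(1)] .
  with h have "\<forall>\<^sub>F t in at_top. \<bar>h t\<bar> \<le> C * exp (- k * t) \<and> dist (W t) w1 < d"
    by eventually_elim auto
  then obtain T where T: "\<And>t. T \<le> t \<Longrightarrow> \<bar>h t\<bar> \<le> C * exp (- k * t)" "\<And>t. T \<le> t \<Longrightarrow> \<bar>W t - w1\<bar> < d"
    unfolding eventually_at_top_linorder dist_real_def by blast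
  define T' where "T' = max T (t0 + 1)"
  show ?thesis unfolding eventually_at_top_linorder
  proof (intro exI[of _ T'] allI impI, rule ccontr)
    fix t1 assume t1: "T' \<le> t1" and neg: "\<not> \<bar>W t1 - w1\<bar> \<le> 4 * C / l * exp (- k * t1)"
    define c where "c = 4 * C / l * exp (- k * t1)"
    have c: "c > 0" using k F(3) by (simp add: c_def)
    have D: "(W has_real_derivative - (F (W t) + h t)) (at t)" if "t1 \<le> t" for t
      using W that t1 by (simp add: T'_def)
    have hc: "\<bar>h t\<bar> \<le> l / 4 * c" if "t1 \<le> t" for t
    proof -
      have "\<bar>h t\<bar> \<le> C * exp (- k * t)" using T(1) that t1 by (simp add: T'_def)
      also have "\<dots> \<le> C * exp (- k * t1)" using k that by (intro mult_left_mono) auto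
      finally show ?thesis using F(3) by (simp add: c_def)
    qed
    have dd: "\<bar>W t - w1\<bar> < d" if "t1 \<le> t" for t using T(2) that t1 by (simp add: T'_def)
    have lc: "0 < l * c" using F(3) c by simp
    consider "w1 + c < W t1" | "W t1 < w1 - c" using neg unfolding c_def[symmetric] by linarith
    then show False
    proof cases
      case 1
      have away: "w1 + c < W t" if "t1 \<le> t" for t
      proof (rule stays_above[OF D 1 _ that])
        fix t assume t: "t1 \<le> t" "W t = w1 + c"
        then have "F (W t) < - (l / 2) * c" using Fp[of "W t"] dd[OF t(1)] c by simp
        then show "0 < - (F (W t) + h t)" using hc[OF t(1)] lc by (simp add: abs_le_iff)
      qed
      have ev: "\<forall>\<^sub>F t in at_top. W t < w1 + c" using order_tendstoD(2)[OF lim] c by simp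
      from eventually_at_top_obtain[OF ev, of t1] show False using away by force
    next
      case 2
      have away: "W t < w1 - c" if "t1 \<le> t" for t
      proof (rule stays_below[OF D 2 _ that])
        fix t assume t: "t1 \<le> t" "W t = w1 - c"
        then have "l / 2 * c < F (W t)" using Fn[of "W t"] dd[OF t(1)] c by simp
        then show "- (F (W t) + h t) < 0" using hc[OF t(1)] lc by (simp add: abs_le_iff)
      qed
      have ev: "\<forall>\<^sub>F t in at_top. w1 - c < W t" using order_tendstoD(1)[OF lim] c by simp
      from eventually_at_top_obtain[OF ev, of t1] show False using away by force
    qed
  qed
qed

text \<open>At \<open>w1 \<noteq> 0\<close> the exponent is \<open>1\<close> by differentiability, at \<open>w1 = 0\<close> it is \<open>a\<close>. The second case occurs for \<open>\<mu> = 0\<close>,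
  when \<open>\<gamma>\<^sub>1 = 0\<close>.\<close>

lemma spow_locally_holder:
  assumes a: "0 < a"
  shows "\<exists>\<theta>>0. \<exists>L>0. \<forall>\<^sub>F w in nhds w1. \<bar>spow a w - spow a w1\<bar> \<le> L * \<bar>w - w1\<bar> powr \<theta>"
proof (cases "w1 = 0")
  case True
  then show ?thesis using a by (intro exI[of _ a] conjI exI[of _ 1]) (auto simp: abs_spow)
next
  case False
  have "\<exists>D. (spow a has_real_derivative D) (at w1)"
  proof (cases "w1 > 0")
    case True
    have "((\<lambda>w. w powr a) has_real_derivative a * w1 powr (a - 1)) (at w1)"
      using True by (rule has_real_derivative_powr)
    then have "(spow a has_real_derivative a * w1 powr (a - 1)) (at w1)"
      by (rule has_field_derivative_transform_within_open[of _ _ _ "{0<..}"]) (use True in \<open>auto simp: spow_nonneg\<close>)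
    then show ?thesis by blast
  next
    case F: False
    then have n: "w1 < 0" using False by simp
    have "((\<lambda>w. - ((- w) powr a)) has_real_derivative a * (- w1) powr (a - 1)) (at w1)"
      using n by (auto intro!: derivative_eq_intros simp: powr_diff)
    then have "(spow a has_real_derivative a * (- w1) powr (a - 1)) (at w1)"
      by (rule has_field_derivative_transform_within_open[of _ _ _ "{..<0}"]) (use n in \<open>auto simp: spow_def\<close>)
    then show ?thesis by blast
  qed
  then obtain D where "(spow a has_real_derivative D) (at w1)" by blast
  then have "((\<lambda>w. \<bar>(spow a w - spow a w1) / (w - w1)\<bar>) \<longlongrightarrow> \<bar>D\<bar>) (at w1)"
    unfolding has_field_derivative_iff by (rule tendsto_rabs)
  then have "\<forall>\<^sub>F w in at w1. \<bar>(spow a w - spow a w1) / (w - w1)\<bar> < \<bar>D\<bar> + 1"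
    by (rule order_tendstoD(2)) simp
  then have "\<forall>\<^sub>F w in nhds w1. w \<noteq> w1 \<longrightarrow> \<bar>(spow a w - spow a w1) / (w - w1)\<bar> < \<bar>D\<bar> + 1"
    by (simp add: eventually_at_filter)
  then have "\<forall>\<^sub>F w in nhds w1. \<bar>spow a w - spow a w1\<bar> \<le> (\<bar>D\<bar> + 1) * \<bar>w - w1\<bar> powr 1"
  proof eventually_elim
    case (elim w)
    then show ?case by (cases "w = w1") (auto simp: abs_divide divide_less_eq split: if_splits)
  qed
  then show ?thesis by (intro exI[of _ 1] conjI exI[of _ "\<bar>D\<bar> + 1"]) auto
qed

lemma tendsto_of_exponentially_small_derivative:
  fixes f g :: "real \<Rightarrow> real"
  assumes der: "\<And>t. t0 < t \<Longrightarrow> (f has_real_derivative g t) (at t)"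
    and g: "\<forall>\<^sub>F t in at_top. \<bar>g t\<bar> \<le> C * exp (- k * t)" and k: "0 < k" "0 < C"
  shows "\<exists>l. (f \<longlongrightarrow> l) at_top"
proof -
  obtain T where T: "\<And>t. T \<le> t \<Longrightarrow> \<bar>g t\<bar> \<le> C * exp (- k * t)"
    using g by (auto simp: eventually_at_top_linorder)
  define T' where "T' = max T (t0 + 1)"
  define E where "E t = C / k * exp (- k * t)" for t
  have Ed: "(E has_real_derivative - (C * exp (- k * t))) (at t)" for t
    unfolding E_def[abs_def] using k by (auto intro!: derivative_eq_intros)
  have E0: "E t > 0" for t using k by (simp add: E_def)
  have up: "f t - E t \<le> f s - E s" if "T' \<le> t" "t \<le> s" for t s
  proof (rule DERIV_nonneg_imp_nondecreasing[OF that(2)])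
    fix x assume "t \<le> x" "x \<le> s"
    then have x: "t0 < x" "T \<le> x" using that by (auto simp: T'_def)
    show "\<exists>y. ((\<lambda>t. f t - E t) has_real_derivative y) (at x) \<and> 0 \<le> y"
      using DERIV_diff[OF der[OF x(1)] Ed] T[OF x(2)]
      by (intro exI[of _ "g x - - (C * exp (- k * x))"]) auto
  qed
  have dn: "f s + E s \<le> f t + E t" if "T' \<le> t" "t \<le> s" for t s
  proof (rule DERIV_nonpos_imp_nonincreasing[OF that(2)])
    fix x assume "t \<le> x" "x \<le> s"
    then have x: "t0 < x" "T \<le> x" using that by (auto simp: T'_def)
    show "\<exists>y. ((\<lambda>t. f t + E t) has_real_derivative y) (at x) \<and> y \<le> 0"
      using DERIV_add[OF der[OF x(1)] Ed] T[OF x(2)]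
      by (intro exI[of _ "g x + - (C * exp (- k * x))"]) auto
  qed
  define S where "S = (\<lambda>t. f t - E t) ` {T'..}"
  have bdd: "bdd_above S"
  proof (rule bdd_aboveI)
    fix y assume "y \<in> S"
    then obtain t where "T' \<le> t" "y = f t - E t" by (auto simp: S_def)
    then show "y \<le> f T' + E T'" using dn[of T' t] E0[of t] by simp
  qed
  have "((\<lambda>t. f t - E t) \<longlongrightarrow> Sup S) at_top"
  proof (rule order_tendstoI)
    fix a assume "a < Sup S"
    then obtain t where t: "T' \<le> t" "a < f t - E t"
      using less_cSup_iff[of S a] bdd by (auto simp: S_def)
    then show "\<forall>\<^sub>F x in at_top. a < f x - E x"
      unfolding eventually_at_top_linorder using up[of t] by (intro exI[of _ t]) force
  next
    fix a assume a: "Sup S < a"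
    have "f x - E x < a" if "T' \<le> x" for x
      using cSup_upper[OF _ bdd, of "f x - E x"] that a by (auto simp: S_def)
    then show "\<forall>\<^sub>F x in at_top. f x - E x < a"
      unfolding eventually_at_top_linorder by blast
  qed
  moreover have "(E \<longlongrightarrow> C / k * 0) at_top"
    unfolding E_def[abs_def]
    by (intro tendsto_mult tendsto_const exp_neg_mult_tendsto_0 k)
  ultimately have "((\<lambda>t. (f t - E t) + E t) \<longlongrightarrow> Sup S + C / k * 0) at_top" by (rule tendsto_add)
  then show ?thesis by auto
qed

text \<open>Here \<open>X' / X - \<gamma>\<^sub>1 = spow (1 / (p - 1)) W - spow (1 / (p - 1)) w1\<close> is exponentially small, so
  \<open>ln X - \<gamma>\<^sub>1 t\<close> converges to a finite number.\<close>

lemma riccati_solution_asymptotics: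
  fixes W X :: "real \<Rightarrow> real"
  assumes p: "1 < p" "p < N" and roots: "riccati N p \<mu> w1 = 0" "riccati N p \<mu> w2 = 0" "w1 < w2"
    and \<kappa>: "0 < \<kappa>"
    and W: "\<And>t. t0 < t \<Longrightarrow> (W has_real_derivative - (riccati N p \<mu> (W t) +
        (lam * exp (- p * t) + (X t * exp (- ((N - p) / p) * t)) powr \<kappa>))) (at t)"
    and X: "\<And>t. t0 < t \<Longrightarrow> 0 < X t"
      "\<And>t. t0 < t \<Longrightarrow> (X has_real_derivative X t * spow (1 / (p - 1)) (W t)) (at t)"
    and y: "((\<lambda>t. X t * exp (- ((N - p) / p) * t)) \<longlongrightarrow> 0) at_top"
  shows "(W \<longlongrightarrow> w1) at_top"
    and "\<exists>C>0. ((\<lambda>t. X t * exp (- spow (1 / (p - 1)) w1 * t)) \<longlongrightarrow> C) at_top"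
proof -
  let ?F = "riccati N p \<mu>" and ?a = "1 / (p - 1)"
  define \<delta> where "\<delta> = (N - p) / p"
  define Y where "Y t = X t * exp (- \<delta> * t)" for t
  define h where "h t = lam * exp (- p * t) + Y t powr \<kappa>" for t
  note sh = riccati_shape[OF p roots]
  have a: "0 < ?a" using p by simp
  have Y0: "0 < Y t" if "t0 < t" for t using X(1)[OF that] by (simp add: Y_def)
  have Yl: "(Y \<longlongrightarrow> 0) at_top" using y by (simp add: Y_def[abs_def] \<delta>_def)
  have W': "(W has_real_derivative - (?F (W t) + h t)) (at t)" if "t0 < t" for t
    using W[OF that] by (simp add: h_def Y_def \<delta>_def)
  have "(h \<longlongrightarrow> lam * 0 + 0) at_top"
    unfolding h_def[abs_def]
  proof (intro tendsto_add tendsto_mult tendsto_const exp_neg_mult_tendsto_0)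
    have "\<forall>\<^sub>F t in at_top. 0 \<le> Y t"
      using eventually_gt_at_top[of t0] by eventually_elim (use Y0 in force)
    then show "((\<lambda>t. Y t powr \<kappa>) \<longlongrightarrow> 0) at_top"
      using tendsto_powr'[OF Yl tendsto_const[of \<kappa>]] \<kappa> by simp
  qed (use p in auto)
  then have hl: "(h \<longlongrightarrow> 0) at_top" by simp
  show Wl: "(W \<longlongrightarrow> w1) at_top"
    by (rule riccati_tendsto_small_root[OF p roots W' X hl y])
  have gl: "((\<lambda>t. spow ?a (W t)) \<longlongrightarrow> spow ?a w1) at_top"
    using isCont_spow[OF a] Wl by (rule isCont_tendsto_compose)
  define \<gamma> where "\<gamma> = spow ?a w1"
  have \<gamma>\<delta>: "\<gamma> < \<delta>" using spow_strict_mono[OF a sh(2)] sh(1) by (simp add: \<gamma>_def \<delta>_def)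
  obtain k1 C1 where k1: "0 < k1" "0 < C1" "\<forall>\<^sub>F t in at_top. Y t \<le> C1 * exp (- k1 * t)"
    using exponential_decay[OF X gl \<gamma>\<delta>[unfolded \<gamma>_def]] unfolding Y_def by blast
  define k where "k = min p (k1 * \<kappa>)"
  define C where "C = \<bar>lam\<bar> + C1 powr \<kappa>"
  have k: "0 < k" "0 < C" using p k1 \<kappa> by (auto simp: k_def C_def add_nonneg_pos)
  have hb: "\<forall>\<^sub>F t in at_top. \<bar>h t\<bar> \<le> C * exp (- k * t)"
    using k1(3) eventually_gt_at_top[of "max 0 t0"]
  proof eventually_elim
    case (elim t)
    then have t: "0 < t" "t0 < t" by auto
    have e: "exp (- c * t) \<le> exp (- k * t)" if "k \<le> c" for c using that t by simp
    have "Y t powr \<kappa> \<le> (C1 * exp (- k1 * t)) powr \<kappa>"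
      using elim Y0[OF t(2)] \<kappa> by (intro powr_mono2) auto
    also have "\<dots> = C1 powr \<kappa> * exp (- (k1 * \<kappa>) * t)"
      by (simp add: powr_mult exp_powr_real algebra_simps)
    also have "\<dots> \<le> C1 powr \<kappa> * exp (- k * t)" by (intro mult_left_mono e) (auto simp: k_def)
    finally have 1: "Y t powr \<kappa> \<le> C1 powr \<kappa> * exp (- k * t)" .
    have 2: "\<bar>lam * exp (- p * t)\<bar> \<le> \<bar>lam\<bar> * exp (- k * t)"
      unfolding abs_mult using e[of p] by (intro mult_mono) (auto simp: k_def)
    have "\<bar>h t\<bar> \<le> \<bar>lam * exp (- p * t)\<bar> + Y t powr \<kappa>"
      unfolding h_def using abs_triangle_ineq[of "lam * exp (- p * t)" "Y t powr \<kappa>"] by simp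
    then show ?case using 1 2 by (simp add: C_def distrib_right)
  qed
  define l where "l = p * (\<delta> - \<gamma>)"
  have l: "0 < l" using \<gamma>\<delta> p by (simp add: l_def)
  have Fd: "(?F has_real_derivative - l) (at w1)"
  proof -
    have "p * \<delta> = N - p" using p by (simp add: \<delta>_def)
    then have "p * spow ?a w1 - (N - p) = - l" by (simp add: l_def \<gamma>_def right_diff_distrib)
    then show ?thesis using riccati_deriv[OF p(1), of N \<mu> w1] by simp
  qed
  have rate: "\<forall>\<^sub>F t in at_top. \<bar>W t - w1\<bar> \<le> 4 * C / l * exp (- k * t)"
    by (rule repelling_equilibrium_rate[OF W' Fd roots(1) l Wl hb k])
  obtain \<theta> L where \<theta>: "0 < \<theta>" "0 < L" "\<forall>\<^sub>F w in nhds w1. \<bar>spow ?a w - spow ?a w1\<bar> \<le> L * \<bar>w - w1\<bar> powr \<theta>"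
    using spow_locally_holder[OF a] by blast
  have "\<forall>\<^sub>F t in at_top. \<bar>spow ?a (W t) - spow ?a w1\<bar> \<le> L * \<bar>W t - w1\<bar> powr \<theta>"
    using \<theta>(3) Wl by (auto simp: filterlim_iff)
  then have gb: "\<forall>\<^sub>F t in at_top. \<bar>spow ?a (W t) - \<gamma>\<bar> \<le> (L * (4 * C / l) powr \<theta>) * exp (- (k * \<theta>) * t)"
    using rate
  proof eventually_elim
    case (elim t)
    have "\<bar>W t - w1\<bar> powr \<theta> \<le> (4 * C / l * exp (- k * t)) powr \<theta>"
      using elim \<theta> by (intro powr_mono2) auto
    also have "\<dots> = (4 * C / l) powr \<theta> * exp (- (k * \<theta>) * t)"
      unfolding powr_mult exp_powr_real by (simp add: mult_ac)
    finally have "L * \<bar>W t - w1\<bar> powr \<theta> \<le> L * ((4 * C / l) powr \<theta> * exp (- (k * \<theta>) * t))"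
      using \<theta> by (intro mult_left_mono) auto
    then show ?case using elim by (simp add: \<gamma>_def mult.assoc)
  qed
  define f where "f t = ln (X t) - \<gamma> * t" for t
  have fd: "(f has_real_derivative spow ?a (W t) - \<gamma>) (at t)" if "t0 < t" for t
    unfolding f_def[abs_def] using X[OF that] by (auto intro!: derivative_eq_intros)
  have "\<exists>l. (f \<longlongrightarrow> l) at_top"
    by (rule tendsto_of_exponentially_small_derivative[OF fd gb])
      (use k \<theta> l in auto)
  then obtain l' where "(f \<longlongrightarrow> l') at_top" by blast
  then have "((\<lambda>t. exp (f t)) \<longlongrightarrow> exp l') at_top" by (rule tendsto_exp)
  moreover have "\<forall>\<^sub>F t in at_top. exp (f t) = X t * exp (- \<gamma> * t)"
    using eventually_gt_at_top[of t0]
    by eventually_elim (use X(1) in \<open>simp add: f_def exp_diff exp_minus field_simps\<close>)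
  ultimately have "((\<lambda>t. X t * exp (- \<gamma> * t)) \<longlongrightarrow> exp l') at_top" by (rule Lim_transform_eventually)
  then show "\<exists>C>0. ((\<lambda>t. X t * exp (- spow ?a w1 * t)) \<longlongrightarrow> C) at_top"
    unfolding \<gamma>_def by (intro exI[of _ "exp l'"]) simp
qed

section \<open>The asymptotics at the origin\<close>

text \<open>The substitution \<open>r = e\<^sup>-\<^sup>t\<close>. The function \<open>W\<close> is \<open>\<bar>\<gamma>\<bar>\<^sup>p\<^sup>-\<^sup>2 \<gamma>\<close> with \<open>\<gamma> = - r U' / U\<close>, written by means of \<open>A\<close> because that
  combination, unlike \<open>U'\<close>, is known to be differentiable. The exponent of the last term is right because
  \<open>(p\<^sup>*(s) - p) (N - p) / p = p - s\<close>.\<close>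

lemma emden_fowler_transform:
  fixes U A :: "real \<Rightarrow> real" and n :: nat and p s \<mu> lam R :: real
  defines "X \<equiv> \<lambda>t. U (exp (- t))"
    and "W \<equiv> \<lambda>t. - (A (exp (- t)) * exp ((real n - p) * t) * U (exp (- t)) powr (1 - p))"
  assumes p: "1 < p" "p < real n" and R: "0 < R"
    and U: "\<And>r. 0 < r \<Longrightarrow> r < R \<Longrightarrow> 0 < U r"
      "\<And>r. 0 < r \<Longrightarrow> r < R \<Longrightarrow> (U has_real_derivative spow (1 / (p - 1)) (A r / r ^ (n - 1))) (at r)"
    and A: "\<And>r. 0 < r \<Longrightarrow> r < R \<Longrightarrow> (A has_real_derivative
       - (r ^ (n - 1) * ((\<mu> / r powr p + lam) * U r powr (p - 1)
          + U r powr (crit_exp n p s - 1) / r powr s))) (at r)"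
    and t: "- ln R < t"
  shows "(X has_real_derivative X t * spow (1 / (p - 1)) (W t)) (at t)"
    and "(W has_real_derivative - (riccati (real n) p \<mu> (W t) +
        (lam * exp (- p * t) + (X t * exp (- ((real n - p) / p) * t)) powr (crit_exp n p s - p)))) (at t)"
    and "spow (1 / (p - 1)) (A (exp (- t)) / exp (- t) ^ (n - 1)) * exp (- t) = - (X t * spow (1 / (p - 1)) (W t))"
proof -
  let ?a = "1 / (p - 1)"
  define r where "r = exp (- t)"
  have "r < exp (ln R)" using t unfolding r_def by (simp only: exp_less_mono)
  then have r: "0 < r" "r < R" using R by (auto simp: r_def)
  have X0: "X t = U r" "0 < X t" using U(1)[OF r] by (auto simp: X_def r_def)
  have n: "n = Suc (n - 1)" using p by (cases n) auto
  have rn: "r ^ (n - 1) = r powr (real n - 1)"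
    using r(1) n by (simp add: powr_realpow[symmetric] of_nat_diff)
  have ert: "exp (c * t) = r powr (- c)" for c by (simp add: r_def powr_def)
  \<comment> \<open>The form of \<open>W\<close> that shows its relation to \<open>U'\<close>.\<close>
  have Wr: "W t = - ((r / X t) powr (p - 1) * (A r / r ^ (n - 1)))"
  proof -
    have "exp ((real n - p) * t) * X t powr (1 - p) = (r / X t) powr (p - 1) / r ^ (n - 1)"
      unfolding ert rn using r X0(2)
      by (simp add: powr_divide powr_diff powr_minus field_simps flip: powr_add)
    then show ?thesis unfolding W_def X0(1)[symmetric] r_def[symmetric]
      by (simp add: field_simps X_def r_def)
  qed
  have gW: "spow ?a (W t) = - (r / X t * spow ?a (A r / r ^ (n - 1)))"
  proof -
    have "((r / X t) powr (p - 1)) powr ?a = r / X t"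
      using r X0(2) p by (simp add: powr_powr)
    then show ?thesis unfolding Wr spow_minus by (subst spow_mult_nonneg) auto
  qed
  then have id3: "spow ?a (A r / r ^ (n - 1)) * r = - (X t * spow ?a (W t))"
    using X0(2) by simp
  then show "spow (1 / (p - 1)) (A (exp (- t)) / exp (- t) ^ (n - 1)) * exp (- t) = - (X t * spow (1 / (p - 1)) (W t))"
    by (simp add: r_def)
  have E: "((\<lambda>t. exp (- t)) has_real_derivative - r) (at t)"
    by (auto intro!: derivative_eq_intros simp: r_def)
  have rr: "exp (- t) = r" by (simp add: r_def)
  have Xd: "(X has_real_derivative X t * spow ?a (W t)) (at t)"
  proof -
    have "(X has_real_derivative - r * spow ?a (A r / r ^ (n - 1))) (at t)"
    proof -
      have "(U has_real_derivative spow ?a (A r / r ^ (n - 1))) (at (exp (- t)))"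
        unfolding rr by (rule U(2)[OF r])
      from DERIV_chain'[OF E this] show ?thesis
        unfolding X_def by (rule DERIV_cong) simp
    qed
    then show ?thesis using id3 by (simp add: mult.commute)
  qed
  then show "(X has_real_derivative X t * spow (1 / (p - 1)) (W t)) (at t)" .
  define k where "k = (\<mu> / r powr p + lam) * X t powr (p - 1) + X t powr (crit_exp n p s - 1) / r powr s"
  have Ad: "((\<lambda>t. A (exp (- t))) has_real_derivative - r * - (r ^ (n - 1) * k)) (at t)"
  proof -
    have "(A has_real_derivative - (r ^ (n - 1) * k)) (at (exp (- t)))"
      unfolding rr k_def X0(1) by (rule A[OF r])
    from DERIV_chain'[OF E this] show ?thesis by (rule DERIV_cong) simp
  qed
  have ed: "((\<lambda>t. exp ((real n - p) * t)) has_real_derivative (real n - p) * exp ((real n - p) * t)) (at t)"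
    by (auto intro!: derivative_eq_intros)
  have pd: "((\<lambda>t. X t powr (1 - p)) has_real_derivative X t * spow ?a (W t) * ((1 - p) * X t powr (1 - p - 1))) (at t)"
    using DERIV_chain'[OF Xd has_real_derivative_powr[where r = "1 - p", OF X0(2)]] by (simp add: mult_ac)
  define e x where "e = exp ((real n - p) * t)" and "x = X t powr (1 - p)"
  have WX: "W = (\<lambda>t. - (A (exp (- t)) * exp ((real n - p) * t) * X t powr (1 - p)))"
    by (simp add: W_def X_def)
  have Wt: "W t = - (A r * e * x)" by (simp add: WX rr e_def x_def)
  have "((\<lambda>t. - (A (exp (- t)) * exp ((real n - p) * t) * X t powr (1 - p))) has_real_derivative
      - ((- r * - (r ^ (n - 1) * k) * e + A r * ((real n - p) * e)) * x
         + A r * e * (X t * spow ?a (W t) * ((1 - p) * X t powr (1 - p - 1))))) (at t)"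
    by (rule DERIV_cong[OF DERIV_minus[OF DERIV_mult[OF DERIV_mult[OF Ad ed] pd]]])
      (simp add: rr e_def x_def algebra_simps)
  then have "(W has_real_derivative
      - ((- r * - (r ^ (n - 1) * k) * e + A r * ((real n - p) * e)) * x
         + A r * e * (X t * spow ?a (W t) * ((1 - p) * X t powr (1 - p - 1))))) (at t)"
    unfolding WX[symmetric] .
  also have "- ((- r * - (r ^ (n - 1) * k) * e + A r * ((real n - p) * e)) * x
         + A r * e * (X t * spow ?a (W t) * ((1 - p) * X t powr (1 - p - 1))))
      = - (riccati (real n) p \<mu> (W t) +
        (lam * exp (- p * t) + (X t * exp (- ((real n - p) / p) * t)) powr (crit_exp n p s - p)))"
  proof -
    have xx: "X t * X t powr (1 - p - 1) = x"
      using powr_mult_base[of "X t" "1 - p - 1"] X0(2) by (simp add: x_def)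
    have t3: "A r * e * (X t * spow ?a (W t) * ((1 - p) * X t powr (1 - p - 1))) = (p - 1) * (W t * spow ?a (W t))"
    proof -
      have "A r * e * (X t * spow ?a (W t) * ((1 - p) * X t powr (1 - p - 1)))
          = A r * e * (X t * X t powr (1 - p - 1)) * ((1 - p) * spow ?a (W t))" by (simp add: mult_ac)
      also have "\<dots> = (p - 1) * (W t * spow ?a (W t))" unfolding xx Wt by (simp add: algebra_simps)
      finally show ?thesis .
    qed
    have Wg: "W t * spow ?a (W t) = \<bar>W t\<bar> powr (p / (p - 1))"
    proof -
      have "p / (p - 1) = 1 + ?a" using p by (simp add: field_simps)
      then have "\<bar>W t\<bar> powr (p / (p - 1)) = \<bar>W t\<bar> * \<bar>W t\<bar> powr ?a"
        using powr_mult_base[of "\<bar>W t\<bar>" ?a] by simp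
      then show ?thesis by (simp add: spow_def abs_sgn mult_ac)
    qed
    have re: "r * r ^ (n - 1) * e = r powr p"
    proof -
      have "r * r ^ (n - 1) = r powr real n"
        using r(1) n by (metis power_Suc powr_realpow)
      then show ?thesis using r(1) unfolding e_def ert by (simp flip: powr_add)
    qed
    have kx: "r powr p * k * x = \<mu> + (lam * exp (- p * t) + (X t * exp (- ((real n - p) / p) * t)) powr (crit_exp n p s - p))"
    proof -
      have x1: "X t powr (p - 1) * x = 1"
        using X0(2) by (simp add: x_def flip: powr_add)
      have x2: "X t powr (crit_exp n p s - 1) * x = X t powr (crit_exp n p s - p)"
        by (simp add: x_def flip: powr_add)
      have "r powr p * k * x = r powr p * (\<mu> / r powr p + lam) * (X t powr (p - 1) * x)
          + (r powr p / r powr s) * (X t powr (crit_exp n p s - 1) * x)"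
        by (simp add: k_def algebra_simps)
      also have "\<dots> = \<mu> + lam * r powr p + r powr (p - s) * X t powr (crit_exp n p s - p)"
        unfolding x1 x2 using r(1) by (simp add: algebra_simps powr_diff)
      also have "lam * r powr p = lam * exp (- p * t)" by (simp only: ert) simp
      also have "r powr (p - s) * X t powr (crit_exp n p s - p)
          = (X t * exp (- ((real n - p) / p) * t)) powr (crit_exp n p s - p)"
      proof -
        have "(real n - p) / p * (crit_exp n p s - p) = p - s"
          using p by (simp add: crit_exp_def field_simps)
        then have "(r powr ((real n - p) / p)) powr (crit_exp n p s - p) = r powr (p - s)"
          by (simp add: powr_powr)
        then show ?thesis unfolding powr_mult ert by (simp add: mult.commute)
      qed
      finally show ?thesis by simp
    qed
    have "- ((- r * - (r ^ (n - 1) * k) * e + A r * ((real n - p) * e)) * x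
         + A r * e * (X t * spow ?a (W t) * ((1 - p) * X t powr (1 - p - 1))))
       = - ((r * r ^ (n - 1) * e) * k * x) - (real n - p) * (A r * e * x)
         - A r * e * (X t * spow ?a (W t) * ((1 - p) * X t powr (1 - p - 1)))"
      by (simp add: algebra_simps)
    also have "\<dots> = - (r powr p * k * x) + (real n - p) * W t - (p - 1) * \<bar>W t\<bar> powr (p / (p - 1))"
      unfolding re t3 Wg by (simp add: Wt)
    finally show ?thesis unfolding kx riccati_def by simp
  qed
  finally show "(W has_real_derivative - (riccati (real n) p \<mu> (W t) +
        (lam * exp (- p * t) + (X t * exp (- ((real n - p) / p) * t)) powr (crit_exp n p s - p)))) (at t)" .
qed

lemma radial_has_derivative:
  fixes u :: "'a::euclidean_space \<Rightarrow> real"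
  assumes U: "(U has_real_derivative D) (at (norm x))" and x: "x \<in> S" "x \<noteq> 0" "open S"
    and eq: "\<And>y. y \<in> S \<Longrightarrow> u y = U (norm y)"
  shows "u differentiable (at x)" "norm (grad u x) = \<bar>D\<bar>"
proof -
  have "(norm has_derivative (\<lambda>h. (1 / norm x) * (x \<bullet> h))) (at x)"
    using has_derivative_norm[OF x(2)] by (simp add: sgn_div_norm inner_commute divide_inverse)
  from DERIV_compose_FDERIV[OF U this]
  have "((\<lambda>x. U (norm x)) has_derivative (\<lambda>h. ((D / norm x) *\<^sub>R x) \<bullet> h)) (at x)"
    by (rule has_derivative_eq_rhs) (auto simp: mult_ac)
  then have d: "(u has_derivative (\<lambda>h. ((D / norm x) *\<^sub>R x) \<bullet> h)) (at x)"
    by (rule has_derivative_transform_within_open[OF _ x(3,1)]) (simp add: eq)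
  then show "u differentiable (at x)" by (rule differentiableI)
  show "norm (grad u x) = \<bar>D\<bar>" unfolding grad_eqI[OF d] using x(2) by simp
qed

lemma filterlim_minus_ln_norm:
  "filterlim (\<lambda>x::'a::euclidean_space. - ln (norm x)) at_top (at 0)"
proof -
  have "filterlim (norm :: 'a \<Rightarrow> real) (at_right 0) (at 0)"
    unfolding filterlim_at by (auto simp: eventually_at_filter intro!: tendsto_norm_zero tendsto_ident_at)
  from filterlim_compose[OF ln_at_0 this] show ?thesis
    by (simp add: filterlim_uminus_at_top)
qed

theorem theorem1p3:
  fixes u :: "'a::euclidean_space \<Rightarrow> real"
    and p s \<mu> lam R \<gamma>1 \<gamma>2 :: real
  assumes "DIM('a) \<ge> 2"
    and "1 < p" and "p < real DIM('a)"
    and "\<mu> < ((real DIM('a) - p) / p) powr p"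
    and "0 \<le> s" and "s < p"
    and "0 < R"
    and "weak_solution p s \<mu> lam (ball 0 R) u"
    and "continuous_on (ball 0 R - {0}) u"
    and "radial_on (ball 0 R - {0}) u"
    and "\<forall>x\<in>ball 0 R - {0}. u x > 0"
    and "\<gamma>1 < \<gamma>2"
    and "Gamma_fun DIM('a) p \<mu> \<gamma>1 = 0" and "Gamma_fun DIM('a) p \<mu> \<gamma>2 = 0"
  shows "(\<forall>x\<in>ball 0 R - {0}. u differentiable (at x)) \<and>
    (\<exists>C>0. ((\<lambda>x. u x * norm x powr \<gamma>1) \<longlongrightarrow> C) (at 0) \<and>
           ((\<lambda>x. norm (grad u x) * norm x powr (\<gamma>1 + 1)) \<longlongrightarrow> \<bar>\<gamma>1\<bar> * C) (at 0))"
proof -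
  let ?N = "DIM('a)" and ?a = "1 / (p - 1)"
  note p = assms(2,3) and R = assms(7)
  obtain e :: 'a where eB: "e \<in> Basis" using nonempty_Basis by blast
  then have e: "norm e = 1" by simp
  have pos: "\<And>x. x \<in> ball 0 R - {0} \<Longrightarrow> u x > 0" using assms(11) by blast
  define U where "U r = u (r *\<^sub>R e)" for r
  obtain A where U: "\<And>r. 0 < r \<Longrightarrow> r < R \<Longrightarrow> (U has_real_derivative spow ?a (A r / r ^ (?N - 1))) (at r)"
    and A: "\<And>r. 0 < r \<Longrightarrow> r < R \<Longrightarrow> (A has_real_derivative
       - (r ^ (?N - 1) * ((\<mu> / r powr p + lam) * U r powr (p - 1)
          + U r powr (crit_exp ?N p s - 1) / r powr s))) (at r)"
    using radial_solution_ode[OF p(1) e assms(8,9,10) pos] unfolding U_def[abs_def] by metis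
  have Upos: "0 < U r" if "0 < r" "r < R" for r
  proof -
    have "e \<noteq> 0" using e by auto
    then show ?thesis using pos[of "r *\<^sub>R e"] that e by (simp add: U_def)
  qed
  have uU: "u x = U (norm x)" if "x \<in> ball 0 R - {0}" for x
  proof -
    have "norm x *\<^sub>R e \<in> ball 0 R - {0}" "norm (norm x *\<^sub>R e) = norm x"
      using that e eB by auto
    then show ?thesis using assms(10) that unfolding radial_on_def U_def by metis
  qed
  define X where "X t = U (exp (- t))" for t
  define W where "W t = - (A (exp (- t)) * exp ((real ?N - p) * t) * U (exp (- t)) powr (1 - p))" for t
  define \<kappa> where "\<kappa> = crit_exp ?N p s - p"
  define \<delta> where "\<delta> = (real ?N - p) / p"
  define t0 where "t0 = - ln R"
  have EF: "(X has_real_derivative X t * spow ?a (W t)) (at t)"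
      "(W has_real_derivative - (riccati (real ?N) p \<mu> (W t) +
        (lam * exp (- p * t) + (X t * exp (- ((real ?N - p) / p) * t)) powr \<kappa>))) (at t)"
      "spow ?a (A (exp (- t)) / exp (- t) ^ (?N - 1)) * exp (- t) = - (X t * spow ?a (W t))"
    if "t0 < t" for t
    unfolding X_def[abs_def] W_def[abs_def] \<kappa>_def
    by (rule emden_fowler_transform[OF p R Upos U A that[unfolded t0_def]]; assumption)+
  note Xd = EF(1) and Wd = EF(2)
  have r_range: "exp (- t) < R" if "t0 < t" for t
  proof -
    have "exp (- t) < exp (ln R)" using that unfolding t0_def by (simp only: exp_less_mono)
    then show ?thesis using R by simp
  qed
  have Xpos: "0 < X t" if "t0 < t" for t
    using Upos[of "exp (- t)"] r_range[OF that] by (simp add: X_def)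
  have \<kappa>: "0 < \<kappa>"
    using p assms(6) by (simp add: \<kappa>_def crit_exp_def field_simps)
  define w1 w2 where "w1 = spow (p - 1) \<gamma>1" and "w2 = spow (p - 1) \<gamma>2"
  have roots: "riccati (real ?N) p \<mu> w1 = 0" "riccati (real ?N) p \<mu> w2 = 0" "w1 < w2"
    using assms(12,13,14) spow_strict_mono[of "p - 1" \<gamma>1 \<gamma>2] p(1)
    by (auto simp: w1_def w2_def Gamma_fun_eq_riccati)
  have \<gamma>w: "spow ?a w1 = \<gamma>1" using p(1) by (simp add: w1_def spow_spow)
  \<comment> \<open>The power of the solution is nonnegative, so only the null function \<open>lam e\<^sup>-\<^sup>p\<^sup>t\<close> can be negative.\<close>
  have hlow: "\<forall>\<^sub>F t in at_top. - \<epsilon> \<le> lam * exp (- p * t) + (X t * exp (- ((real ?N - p) / p) * t)) powr \<kappa>"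
    if "0 < \<epsilon>" for \<epsilon>
  proof -
    have "((\<lambda>t. lam * exp (- p * t)) \<longlongrightarrow> lam * 0) at_top"
      using p by (intro tendsto_mult tendsto_const exp_neg_mult_tendsto_0) auto
    then have "\<forall>\<^sub>F t in at_top. - \<epsilon> < lam * exp (- p * t)"
      using that by (intro order_tendstoD(1)) auto
    then show ?thesis by eventually_elim (smt (verit) powr_ge_zero)
  qed
  have "\<forall>\<^sub>F t in at_top. w1 - 1 \<le> W t"
    by (rule riccati_eventually_above[OF p roots Wd hlow]) auto
  then obtain T where T: "\<And>t. T \<le> t \<Longrightarrow> w1 - 1 \<le> W t" by (auto simp: eventually_at_top_linorder)
  define T' where "T' = max T t0"
  have "\<exists>c>0. \<forall>t s. T' < t \<longrightarrow> t \<le> s \<longrightarrow> s \<le> t + ln 2 \<longrightarrow>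
      c * (X t * exp (- \<delta> * t)) \<le> X s * exp (- \<delta> * s)"
    by (rule slow_decay_of_scaled_solution[OF p(1), where m = "w1 - 1"]) (use Xpos Xd T in \<open>auto simp: T'_def\<close>)
  then obtain c where c: "0 < c" "\<And>t s. T' < t \<Longrightarrow> t \<le> s \<Longrightarrow> s \<le> t + ln 2 \<Longrightarrow>
      c * (X t * exp (- \<delta> * t)) \<le> X s * exp (- \<delta> * s)" by blast
  have scale: "U r * r powr \<delta> = X (- ln r) * exp (- \<delta> * (- ln r))" if "0 < r" for r
    using that by (simp add: X_def powr_def)
  obtain G where G: "W0_gradient p (ball 0 R) u G"
    using assms(8) by (auto simp: weak_solution_def)
  \<comment> \<open>Finite energy enters here, through the Hardy inequality.\<close>
  have yr: "((\<lambda>r. U r * r powr ((real ?N - p) / p)) \<longlongrightarrow> 0) (at_right 0)"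
  proof (rule hardy_shell_decay[OF p(1) R _ hardy_finite[OF p G] uU Upos c(1)])
    show "u \<in> borel_measurable (lebesgue_on (ball 0 R))" using G by (simp add: W0_gradient_def)
    show "0 < exp (- T')" by simp
    fix r \<rho> :: real assume r: "0 < r" "r < exp (- T')" "r / 2 \<le> \<rho>" "\<rho> \<le> r"
    have "T' < - ln r" using r(1,2) by (metis exp_less_cancel_iff exp_ln less_minus_iff)
    moreover have "- ln r \<le> - ln \<rho>" using r by simp
    moreover have "- ln \<rho> \<le> - ln r + ln 2"
    proof -
      have "ln (r / 2) \<le> ln \<rho>" using r by (subst ln_le_cancel_iff) auto
      then show ?thesis using r by (simp add: ln_div)
    qed
    ultimately show "c * (U r * r powr ((real ?N - p) / p)) \<le> U \<rho> * \<rho> powr ((real ?N - p) / p)"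
      using c(2)[of "- ln r" "- ln \<rho>"] scale[of r] scale[of \<rho>] r unfolding \<delta>_def by simp
  qed
  have y: "((\<lambda>t. X t * exp (- ((real ?N - p) / p) * t)) \<longlongrightarrow> 0) at_top"
  proof -
    have "filterlim (\<lambda>t::real. exp (- t)) (at_right 0) at_top"
      using exp_neg_mult_tendsto_0[of 1] by (auto simp: filterlim_at)
    from filterlim_compose[OF yr this] show ?thesis
      by (simp add: X_def powr_def)
  qed
  note asy = riccati_solution_asymptotics[OF p roots \<kappa> Wd Xpos Xd y]
  have Wl: "(W \<longlongrightarrow> w1) at_top" by (rule asy(1))
  obtain C where C: "0 < C" "((\<lambda>t. X t * exp (- \<gamma>1 * t)) \<longlongrightarrow> C) at_top"
    using asy(2) unfolding \<gamma>w by blast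
  have ball: "open (ball 0 R - {0 :: 'a})" by auto
  have diff: "u differentiable (at x)" "norm (grad u x) = \<bar>spow ?a (A (norm x) / norm x ^ (?N - 1))\<bar>"
    if "x \<in> ball 0 R - {0}" for x
  proof -
    have n: "0 < norm x" "norm x < R" "x \<noteq> 0" using that by auto
    show "u differentiable (at x)" "norm (grad u x) = \<bar>spow ?a (A (norm x) / norm x ^ (?N - 1))\<bar>"
      by (rule radial_has_derivative[OF U[OF n(1,2)] that n(3) ball uU]; assumption)+
  qed
  have near: "\<forall>\<^sub>F x in at (0::'a). x \<in> ball 0 R - {0}"
    unfolding eventually_at by (intro exI[of _ R]) (use R in auto)
  have lim1: "((\<lambda>x. u x * norm x powr \<gamma>1) \<longlongrightarrow> C) (at 0)"
  proof (rule Lim_transform_eventually[OF filterlim_compose[OF C(2) filterlim_minus_ln_norm]])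
    show "\<forall>\<^sub>F x in at (0::'a). X (- ln (norm x)) * exp (- \<gamma>1 * - ln (norm x)) = u x * norm x powr \<gamma>1"
      using near by eventually_elim (simp add: X_def uU powr_def)
  qed
  have "((\<lambda>t. \<bar>spow ?a (W t)\<bar> * (X t * exp (- \<gamma>1 * t))) \<longlongrightarrow> \<bar>spow ?a w1\<bar> * C) at_top"
    using p(1) by (intro tendsto_mult tendsto_rabs C isCont_tendsto_compose[OF isCont_spow Wl]) auto
  then have lim2': "((\<lambda>t. \<bar>spow ?a (W t)\<bar> * (X t * exp (- \<gamma>1 * t))) \<longlongrightarrow> \<bar>\<gamma>1\<bar> * C) at_top"
    unfolding \<gamma>w .
  have lim2: "((\<lambda>x. norm (grad u x) * norm x powr (\<gamma>1 + 1)) \<longlongrightarrow> \<bar>\<gamma>1\<bar> * C) (at 0)"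
  proof (rule Lim_transform_eventually[OF filterlim_compose[OF lim2' filterlim_minus_ln_norm]])
    show "\<forall>\<^sub>F x in at (0::'a). \<bar>spow ?a (W (- ln (norm x)))\<bar> * (X (- ln (norm x)) * exp (- \<gamma>1 * - ln (norm x)))
        = norm (grad u x) * norm x powr (\<gamma>1 + 1)"
      using near
    proof eventually_elim
      case (elim x)
      define t where "t = - ln (norm x)"
      have nx: "0 < norm x" "norm x < R" using elim by auto
      have et: "exp (- t) = norm x" using nx by (simp add: t_def)
      have t: "t0 < t" using nx R by (simp add: t_def t0_def)
      have id: "spow ?a (A (norm x) / norm x ^ (?N - 1)) * norm x = - (X t * spow ?a (W t))"
        using EF(3)[OF t] unfolding et .
      have "norm (grad u x) * norm x powr (\<gamma>1 + 1)
          = \<bar>spow ?a (A (norm x) / norm x ^ (?N - 1)) * norm x\<bar> * norm x powr \<gamma>1"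
        using diff(2)[OF elim] nx by (simp add: powr_add abs_mult mult_ac)
      also have "\<dots> = \<bar>spow ?a (W t)\<bar> * (X t * norm x powr \<gamma>1)"
        unfolding id using Xpos[OF t] by (simp add: abs_mult mult_ac)
      also have "norm x powr \<gamma>1 = exp (- \<gamma>1 * t)" using nx by (simp add: powr_def t_def)
      finally show ?case by (simp add: t_def)
    qed
  qed
  show ?thesis using diff(1) C(1) lim1 lim2 by blast
qed

end
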